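(* Suppose that (1) for each $i\in[I]$ and $s\in S_i$ there exists $a_i(s)\in A_i$ such that $f_{i,\ell}(s,a_i(s))=\min_{a\in A_i}f_{i,\ell}(s,a)$ for all $\ell\in[L]$; and (2) for every $h$ and every state vector $(s_{i,n})\in\prod_iS_i^{N_i}$, $\sum_{i\in[I]}\sum_{n\in[N_i]}f_{i,\ell}(s_{i,n},a_i(s_{i,n}))\le0$ for all $\ell\in[L]$. Let $\mathbf x^*$ be an optimal solution of the linear program (LP) given in the context, and let $\psi$ be the FAB policy family (one FAB policy for each $h\in\mathbb N_+$), started from $\mathbf Y^{\psi,h}(0)=\mathbf y^0$. Then the FAB policy family is asymptotically optimal, and for any $\epsilon>0$ there exist $C,C_2>0$ and $C_1,H<\infty$ such that, for all $h>H$, $$\mathbb P\Bigl\{\max_{t\in[T]_0}\bigl\|\mathbf Z^{\psi,h}(t)-\mathbf z^{\varphi(\mathbf x^* )}(t)\bigr\|>\epsilon\Bigr\}\le e^{-Ch},\qquad \max_{t\in[T]_0}\bigl\|\mathbf z^{\psi,h}(t)-\mathbf z^{\varphi(\mathbf x^* )}(t)\bigr\|\le C_1e^{-C_2h}+\epsilon .$$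
   Context: Notation: $[n]=\{1,\dots,n\}$, $[n]_0=\{0,1,\dots,n\}$, $\mathbb N_+$ is the set of positive integers, $\|\cdot\|$ is the maximum norm. Model. Fix $I,T\in\mathbb N_+$, $L\in\mathbb N_+\cup\{0\}$ and, for each $i\in[I]$, finite nonempty sets $S_i$ (states) and $A_i$ (actions), transition probabilities $p_i(s,a,s')$, expected rewards $r_i:S_i\times A_i\to\mathbb R_{\ge0}$, constraint functions $f_{i,\ell}:S_i\times A_i\to\mathbb R$ ($\ell\in[L]$), and $N_i^0\in\mathbb N_+$. For the scaling parameter $h\in\mathbb N_+$ put $N_i=hN_i^0$, $N=h\sum_{i\in[I]}N_i^0$. The system with parameter $h$ consists, for each "gang" $i$, of $N_i$ processes with states $s_{i,n}(t)\in S_i$ and actions $a_{i,n}(t)\in A_i$, $t\in[T]_0$. A policy $\phi$ is a sequence of maps $\phi_t:\prod_iS_i^{N_i}\to\prod_iA_i^{N_i}$ giving the action vector at time $t$ from the state vector at time $t$; given states and actions at time $t$, the processes move independently, $(i,n)$ going to $s'$ with probability $p_i(s_{i,n}(t),a_{i,n}(t),s')$. $\Phi^h$ is the set of policies and $\Phi^{\mathrm{WC},h}$ the set of those satisfying $\sum_i\sum_nf_{i,\ell}(s_{i,n}(t),a_{i,n}(t))\le0$ for all $\ell\in[L]$, $t\in[T]_0$. Let $\mathcal J=\{(i,s,a):i\in[I],s\in S_i,a\in A_i\}$, $Z^{\phi,h}_{i,s,a}(t)=\frac1N|\{n\in[N_i]:s_{i,n}(t)=s,a_{i,n}(t)=a\}|$,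 $Y^{\phi,h}_{i,s}(t)=\sum_{a\in A_i}Z^{\phi,h}_{i,s,a}(t)$. The initial state is deterministic with $\mathbf Y^{\phi,h}(0)=\mathbf y^0$ (independent of $h$), $\mathbf z^{\phi,h}(t)=\mathbb E_{\mathbf y^0}[\mathbf Z^{\phi,h}(t)]$, and $\Gamma^{\phi,h}(\mathbf y^0)=\sum_{i}N_i^0\sum_{t=0}^T\sum_{(i,s,a)\in\mathcal J}\mathbb E_{\mathbf y^0}[Z^{\phi,h}_{i,s,a}(t)]r_i(s,a)$. A policy family $(\phi^h)_h$ with $\phi^h\in\Phi^{\mathrm{WC},h}$ is asymptotically optimal if $\lim_{h\to\infty}\bigl(\max_{\phi\in\Phi^{\mathrm{WC},h}}\Gamma^{\phi,h}(\mathbf y^0)-\Gamma^{\phi^h,h}(\mathbf y^0)\bigr)=0$. Linear program (LP): maximize $\sum_{t\in[T]_0}\sum_{(i,s,a)\in\mathcal J}r_i(s,a)x_t(i,s,a)N_i^0$ over $\mathbf x\in[0,1]^{|\mathcal J|(T+1)}$ subject to: $\sum_{s',a'}x_t(i,s',a')p_i(s',a',s)=\sum_ax_{t+1}(i,s,a)$ for $i\in[I],s\in S_i,t\in[T-1]_0$; $\sum_{s,a}x_t(i,s,a)=1$ for $i\in[I],t\in[T]_0$; $\sum_ax_0(i,s,a)=\frac{\sum_{i'}N_{i'}^0}{N_i^0}y^0_{i,s}$ for $i\in[I],s\in S_i$; $\sum_{(i,s,a)\in\mathcal J}N_i^0x_t(i,s,a)f_{i,\ell}(s,a)\le0$ for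 $\ell\in[L],t\in[T]_0$. For feasible $\mathbf x$, $\overline\alpha^{\mathrm{LP}}_{i,s,a}(\mathbf x,t)=x_t(i,s,a)/\sum_{a'}x_t(i,s,a')$ if the denominator is positive and $1/|A_i|$ otherwise. $\mathbf z^{\varphi(\mathbf x)}(t)$ denotes $\mathbb E_{\mathbf y^0}[\mathbf Z^{\phi(\mathbf x),h}(t)]$ (independent of $h$), where under the randomized policy $\phi(\mathbf x)$ each process of gang $i$ in state $s$ at time $t$ takes action $a$ with probability $\overline\alpha^{\mathrm{LP}}_{i,s,a}(\mathbf x,t)$. FAB policy $\psi$ for parameter $h$. At each $t\in[T]_0$, observing the states (hence $\mathbf Y^{\psi,h}(t)$), a vector $\mathbf Z=\mathbf Z^{\psi,h}(t)$ is computed as follows. (i) Set $Z_{i,s,a}=\frac1N\bigl\lfloor\overline\alpha^{\mathrm{LP}}_{i,s,a}(\mathbf x^*,t)\,Y^{\psi,h}_{i,s}(t)\,N\bigr\rfloor$ for all $(i,s,a)\in\mathcal J$. (ii) For every $(i,s)$ pick an action $a^0(i,s)\in A_i$ and reset $Z_{i,s,a^0(i,s)}=Y^{\psi,h}_{i,s}(t)-\sum_{a\ne a^0(i,s)}Z_{i,s,a}$. (iii) Let $L_\ell=\sum_{(i,s,a)\in\mathcal J}Z_{i,s,a}f_{i,\ell}(s,a)$ (always evaluated at the current $\mathbf Z$). If $L_\ell\le0$ for all $\ell$ go to (vi). Otherwise order $\mathcal J$ by ascending $\overline\alpha^{\mathrm{LP}}_{i,s,a}(\mathbf x^*,t)$,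 the $j$th triple being $(i(j),s(j),a(j))$. (iv) For each $\ell\in[L]$ with $L_\ell>0$, start with $j=1$ and carry out (v). (v) Increase $j$ if necessary until $Z_{i(j),s(j),a(j)}>0$. Let $M=|\{a'\in A_{i(j)}:f_{i(j),\ell}(s(j),a')<f_{i(j),\ell}(s(j),a(j))\}|+1$ (if $M=1$ the triple is left unchanged). Take actions $a_1,\dots,a_M\in A_{i(j)}$ with $a_M=a(j)$, $a_1=a^0(i(j),s(j))$ and, for all $\ell'\in[L]$, $f_{i(j),\ell'}(s(j),a_1)\le\dots\le f_{i(j),\ell'}(s(j),a_{M-1})<f_{i(j),\ell'}(s(j),a_M)$ (the procedure presupposes that such a list is available). For $m=M-1,M-2,\dots,1$, stopping as soon as $L_\ell\le0$: let $\Delta f_m=f_{i(j),\ell}(s(j),a_{m+1})-f_{i(j),\ell}(s(j),a_m)$, let $\Delta Z_{m,\ell}=\frac1N\lceil L_\ell N/\Delta f_m\rceil$ if $\Delta f_m>0$ and $\Delta Z_{m,\ell}=0$ otherwise, let $\delta=\min\{Z_{i(j),s(j),a_{m+1}},\Delta Z_{m,\ell}\}$, and replace $Z_{i(j),s(j),a_m}$ by $Z_{i(j),s(j),a_m}+\delta$, $Z_{i(j),s(j),a_{m+1}}$ by $Z_{i(j),s(j),a_{m+1}}-\delta$ (so $L_\ell$ decreases by $\Delta f_m\delta$). If still $L_\ell>0$, move to the smallest $j'>j$ with $Z_{i(j'),s(j'),a(j')}>0$ and repeat (v) with the same $\ell$; otherwise continue (iv) with the next $\ell$. (vi) Choose the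 action vector so that the proportions of processes in the triples $(i,s,a)$ are given by $\mathbf Z$.
   Formalization: If step (v) runs out of triples while L_ℓ>0 and two non-minimal actions of some state have equal f_{i,ℓ}, the FAB procedure is taken to have no output; such runs can strand processes at a tied action and violate the constraint, making the claim false. *)

theory Defs
  imports "HOL-Probability.Probability"
begin

type_synonym ('s, 'a) triple = "nat \<times> 's \<times> 'a"

text \<open>Process \<open>n\<close> of gang \<open>i\<close> is \<open>(i, n)\<close>; gangs, processes and constraints are
  numbered from 1.\<close>

type_synonym 'x vec = "nat \<times> nat \<Rightarrow> 'x"

type_synonym ('s, 'a) policy = "nat \<Rightarrow> 's vec \<Rightarrow> 'a vec"

type_synonym ('s, 'a) rand_policy = "nat \<Rightarrow> 's vec \<Rightarrow> 'a vec pmf"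

text \<open>In the usual notation the fields are \<open>I\<close>, \<open>T\<close>, \<open>L\<close>, \<open>S\<^sub>i\<close>, \<open>A\<^sub>i\<close>,
  \<open>p\<^sub>i(s, a, \<cdot>)\<close>, \<open>r\<^sub>i(s, a)\<close>, \<open>f\<^sub>i\<^sub>,\<^sub>l(s, a)\<close> (as \<open>cost M i l s a\<close>) and \<open>N\<^sub>i\<^sup>0\<close>.\<close>

record ('s, 'a) gang_model =
  num_gangs :: nat
  horizon :: nat
  num_constraints :: nat
  states :: "nat \<Rightarrow> 's set"
  actions :: "nat \<Rightarrow> 'a set"
  trans_prob :: "nat \<Rightarrow> 's \<Rightarrow> 'a \<Rightarrow> 's pmf"
  reward :: "nat \<Rightarrow> 's \<Rightarrow> 'a \<Rightarrow> real"
  cost :: "nat \<Rightarrow> nat \<Rightarrow> 's \<Rightarrow> 'a \<Rightarrow> real"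
  base_size :: "nat \<Rightarrow> nat"

definition valid_model :: "('s, 'a) gang_model \<Rightarrow> bool" where
  "valid_model M \<longleftrightarrow>
     num_gangs M \<ge> 1 \<and> horizon M \<ge> 1 \<and>
     (\<forall>i\<in>{1..num_gangs M}.
        finite (states M i) \<and> states M i \<noteq> {} \<and>
        finite (actions M i) \<and> actions M i \<noteq> {} \<and>
        base_size M i \<ge> 1 \<and>
        (\<forall>s\<in>states M i. \<forall>a\<in>actions M i.
           set_pmf (trans_prob M i s a) \<subseteq> states M i \<and> reward M i s a \<ge> 0))"

definition triples :: "('s, 'a) gang_model \<Rightarrow> ('s, 'a) triple set" where
  "triples M = {(i, s, a). i \<in> {1..num_gangs M} \<and> s \<in> states M i \<and> a \<in> actions M i}"

definition total_base_size :: "('s, 'a) gang_model \<Rightarrow> nat" where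
  "total_base_size M = (\<Sum>i\<in>{1..num_gangs M}. base_size M i)"

definition total_size :: "('s, 'a) gang_model \<Rightarrow> nat \<Rightarrow> nat" where
  "total_size M h = h * total_base_size M"

definition processes :: "('s, 'a) gang_model \<Rightarrow> nat \<Rightarrow> (nat \<times> nat) set" where
  "processes M h = (SIGMA i:{1..num_gangs M}. {1..h * base_size M i})"

definition state_vectors :: "('s, 'a) gang_model \<Rightarrow> nat \<Rightarrow> 's vec set" where
  "state_vectors M h = (\<Pi>\<^sub>E (i, n)\<in>processes M h. states M i)"

definition action_vectors :: "('s, 'a) gang_model \<Rightarrow> nat \<Rightarrow> 'a vec set" where
  "action_vectors M h = (\<Pi>\<^sub>E (i, n)\<in>processes M h. actions M i)"

definition policies :: "('s, 'a) gang_model \<Rightarrow> nat \<Rightarrow> ('s, 'a) policy set" where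
  "policies M h = (\<Pi>\<^sub>E t\<in>{0..horizon M}. \<Pi>\<^sub>E \<sigma>\<in>state_vectors M h. action_vectors M h)"

definition next_states ::
  "('s, 'a) gang_model \<Rightarrow> nat \<Rightarrow> 's vec \<Rightarrow> 'a vec \<Rightarrow> 's vec pmf" where
  "next_states M h \<sigma> \<alpha> =
     Pi_pmf (processes M h) undefined (\<lambda>(i, n). trans_prob M i (\<sigma> (i, n)) (\<alpha> (i, n)))"

text \<open>Law of the path \<open>[(s(0), a(0)), \<dots>, (s(t), a(t))]\<close>.\<close>

primrec path_law ::
  "('s, 'a) gang_model \<Rightarrow> nat \<Rightarrow> ('s, 'a) rand_policy \<Rightarrow> 's vec \<Rightarrow> nat \<Rightarrow>
   ('s vec \<times> 'a vec) list pmf" where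
  "path_law M h \<pi> \<sigma>0 0 = map_pmf (\<lambda>\<alpha>. [(\<sigma>0, \<alpha>)]) (\<pi> 0 \<sigma>0)"
| "path_law M h \<pi> \<sigma>0 (Suc t) =
     bind_pmf (path_law M h \<pi> \<sigma>0 t) (\<lambda>\<omega>.
     bind_pmf (next_states M h (fst (last \<omega>)) (snd (last \<omega>))) (\<lambda>\<sigma>.
     map_pmf (\<lambda>\<alpha>. \<omega> @ [(\<sigma>, \<alpha>)]) (\<pi> (Suc t) \<sigma>)))"

definition deterministic :: "('s, 'a) policy \<Rightarrow> ('s, 'a) rand_policy" where
  "deterministic \<phi> = (\<lambda>t \<sigma>. return_pmf (\<phi> t \<sigma>))"

fun Z_prop ::
  "('s, 'a) gang_model \<Rightarrow> nat \<Rightarrow> 's vec \<times> 'a vec \<Rightarrow> ('s, 'a) triple \<Rightarrow> real" where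
  "Z_prop M h (\<sigma>, \<alpha>) (i, s, a) =
     card {n \<in> {1..h * base_size M i}. \<sigma> (i, n) = s \<and> \<alpha> (i, n) = a} / total_size M h"

text \<open>The proportions \<open>Y\<close> are determined by the states alone; lemma \<open>Y_prop_eq_sum\<close>
  relates them to \<open>Z\<close>.\<close>

definition Y_prop :: "('s, 'a) gang_model \<Rightarrow> nat \<Rightarrow> 's vec \<Rightarrow> nat \<Rightarrow> 's \<Rightarrow> real" where
  "Y_prop M h \<sigma> i s = card {n \<in> {1..h * base_size M i}. \<sigma> (i, n) = s} / total_size M h"

lemma Y_prop_eq_sum:
  assumes "valid_model M" "i \<in> {1..num_gangs M}" "\<alpha> \<in> action_vectors M h"
  shows "Y_prop M h \<sigma> i s = (\<Sum>a\<in>actions M i. Z_prop M h (\<sigma>, \<alpha>) (i, s, a))"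
proof -
  let ?C = "\<lambda>a. {n \<in> {1..h * base_size M i}. \<sigma> (i, n) = s \<and> \<alpha> (i, n) = a}"
  have "\<alpha> (i, n) \<in> actions M i" if "n \<in> {1..h * base_size M i}" for n
    using assms(2,3) that by (auto simp: action_vectors_def processes_def dest!: PiE_mem)
  then have eq: "{n \<in> {1..h * base_size M i}. \<sigma> (i, n) = s} = (\<Union>a\<in>actions M i. ?C a)"
    by auto
  have fin: "finite (actions M i)"
    using assms(1,2) by (auto simp: valid_model_def)
  have "card (\<Union>a\<in>actions M i. ?C a) = (\<Sum>a\<in>actions M i. card (?C a))"
    by (rule card_UN_disjoint) (use fin in auto)
  then show ?thesis
    unfolding Y_prop_def eq by (simp only: Z_prop.simps of_nat_sum sum_divide_distrib)
qed

definition mean_Z ::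
  "('s, 'a) gang_model \<Rightarrow> nat \<Rightarrow> ('s, 'a) rand_policy \<Rightarrow> 's vec \<Rightarrow> nat \<Rightarrow>
   ('s, 'a) triple \<Rightarrow> real" where
  "mean_Z M h \<pi> \<sigma>0 t j =
     measure_pmf.expectation (path_law M h \<pi> \<sigma>0 (horizon M)) (\<lambda>\<omega>. Z_prop M h (\<omega> ! t) j)"

definition total_gain ::
  "('s, 'a) gang_model \<Rightarrow> nat \<Rightarrow> ('s, 'a) policy \<Rightarrow> 's vec \<Rightarrow> real" where
  "total_gain M h \<phi> \<sigma>0 =
     real (total_base_size M) *
     (\<Sum>t\<in>{0..horizon M}. \<Sum>(i, s, a)\<in>triples M.
        mean_Z M h (deterministic \<phi>) \<sigma>0 t (i, s, a) * reward M i s a)"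

text \<open>The constraints are required almost surely along the path, so the set of admissible
  policies depends on the initial state vector.\<close>

definition wc_policies ::
  "('s, 'a) gang_model \<Rightarrow> nat \<Rightarrow> 's vec \<Rightarrow> ('s, 'a) policy set" where
  "wc_policies M h \<sigma>0 =
     {\<phi> \<in> policies M h.
        \<forall>\<omega>\<in>set_pmf (path_law M h (deterministic \<phi>) \<sigma>0 (horizon M)).
        \<forall>t\<in>{0..horizon M}. \<forall>l\<in>{1..num_constraints M}.
          (\<Sum>i\<in>{1..num_gangs M}. \<Sum>n\<in>{1..h * base_size M i}.
             cost M i l (fst (\<omega> ! t) (i, n)) (snd (\<omega> ! t) (i, n))) \<le> 0}"

definition asymptotically_optimal ::
  "('s, 'a) gang_model \<Rightarrow> (nat \<Rightarrow> 's vec) \<Rightarrow> (nat \<Rightarrow> ('s, 'a) policy) \<Rightarrow> bool" where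
  "asymptotically_optimal M \<sigma>0 \<phi> \<longleftrightarrow>
     (\<forall>h\<ge>1. \<phi> h \<in> wc_policies M h (\<sigma>0 h)) \<and>
     (\<lambda>h. (MAX \<phi>'\<in>wc_policies M h (\<sigma>0 h). total_gain M h \<phi>' (\<sigma>0 h))
            - total_gain M h (\<phi> h) (\<sigma>0 h)) \<longlonglongrightarrow> 0"

definition triple_norm :: "('s, 'a) gang_model \<Rightarrow> (('s, 'a) triple \<Rightarrow> real) \<Rightarrow> real" where
  "triple_norm M v = (MAX j\<in>triples M. \<bar>v j\<bar>)"

definition lp_feasible ::
  "('s, 'a) gang_model \<Rightarrow> (nat \<Rightarrow> 's \<Rightarrow> real) \<Rightarrow> (nat \<Rightarrow> ('s, 'a) triple \<Rightarrow> real) \<Rightarrow> bool" where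
  "lp_feasible M y0 x \<longleftrightarrow>
     (\<forall>t\<in>{0..horizon M}. \<forall>j\<in>triples M. 0 \<le> x t j \<and> x t j \<le> 1) \<and>
     (\<forall>i\<in>{1..num_gangs M}. \<forall>s\<in>states M i. \<forall>t<horizon M.
        (\<Sum>s'\<in>states M i. \<Sum>a'\<in>actions M i. x t (i, s', a') * pmf (trans_prob M i s' a') s)
          = (\<Sum>a\<in>actions M i. x (Suc t) (i, s, a))) \<and>
     (\<forall>i\<in>{1..num_gangs M}. \<forall>t\<in>{0..horizon M}.
        (\<Sum>s\<in>states M i. \<Sum>a\<in>actions M i. x t (i, s, a)) = 1) \<and>
     (\<forall>i\<in>{1..num_gangs M}. \<forall>s\<in>states M i.
        (\<Sum>a\<in>actions M i. x 0 (i, s, a))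
          = real (total_base_size M) / real (base_size M i) * y0 i s) \<and>
     (\<forall>l\<in>{1..num_constraints M}. \<forall>t\<in>{0..horizon M}.
        (\<Sum>(i, s, a)\<in>triples M. real (base_size M i) * x t (i, s, a) * cost M i l s a) \<le> 0)"

definition lp_objective ::
  "('s, 'a) gang_model \<Rightarrow> (nat \<Rightarrow> ('s, 'a) triple \<Rightarrow> real) \<Rightarrow> real" where
  "lp_objective M x =
     (\<Sum>t\<in>{0..horizon M}. \<Sum>(i, s, a)\<in>triples M.
        reward M i s a * x t (i, s, a) * real (base_size M i))"

definition lp_optimal ::
  "('s, 'a) gang_model \<Rightarrow> (nat \<Rightarrow> 's \<Rightarrow> real) \<Rightarrow> (nat \<Rightarrow> ('s, 'a) triple \<Rightarrow> real) \<Rightarrow> bool" where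
  "lp_optimal M y0 x \<longleftrightarrow>
     lp_feasible M y0 x \<and> (\<forall>x'. lp_feasible M y0 x' \<longrightarrow> lp_objective M x' \<le> lp_objective M x)"

fun lp_alpha ::
  "('s, 'a) gang_model \<Rightarrow> (nat \<Rightarrow> ('s, 'a) triple \<Rightarrow> real) \<Rightarrow> nat \<Rightarrow> ('s, 'a) triple \<Rightarrow> real" where
  "lp_alpha M x t (i, s, a) =
     (let d = \<Sum>a'\<in>actions M i. x t (i, s, a')
      in if d > 0 then x t (i, s, a) / d else 1 / card (actions M i))"

text \<open>For feasible \<open>x\<close> and \<open>s \<in> states M i\<close> the argument of \<open>embed_pmf\<close> is nonnegative and sums
  to 1. Actions of different processes are drawn independently.\<close>

definition lp_policy ::
  "('s, 'a) gang_model \<Rightarrow> (nat \<Rightarrow> ('s, 'a) triple \<Rightarrow> real) \<Rightarrow> nat \<Rightarrow> ('s, 'a) rand_policy" where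
  "lp_policy M x h = (\<lambda>t \<sigma>.
     Pi_pmf (processes M h) undefined (\<lambda>(i, n).
       embed_pmf (\<lambda>a. if a \<in> actions M i then lp_alpha M x t (i, \<sigma> (i, n), a) else 0)))"

definition load ::
  "('s, 'a) gang_model \<Rightarrow> nat \<Rightarrow> (('s, 'a) triple \<Rightarrow> real) \<Rightarrow> real" where
  "load M l Z = (\<Sum>(i, s, a)\<in>triples M. Z (i, s, a) * cost M i l s a)"

text \<open>\<open>fab_floor\<close> rounds down; \<open>fab_init\<close> then gives the processes left over in \<open>(i, s)\<close> the
  action \<open>a0 i s\<close>.\<close>

fun fab_floor ::
  "('s, 'a) gang_model \<Rightarrow> (nat \<Rightarrow> ('s, 'a) triple \<Rightarrow> real) \<Rightarrow> nat \<Rightarrow> nat \<Rightarrow> 's vec \<Rightarrow>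
   ('s, 'a) triple \<Rightarrow> real" where
  "fab_floor M x h t \<sigma> (i, s, a) =
     of_int \<lfloor>lp_alpha M x t (i, s, a) * Y_prop M h \<sigma> i s * real (total_size M h)\<rfloor>
       / real (total_size M h)"

fun fab_init ::
  "('s, 'a) gang_model \<Rightarrow> (nat \<Rightarrow> ('s, 'a) triple \<Rightarrow> real) \<Rightarrow> nat \<Rightarrow> nat \<Rightarrow> 's vec \<Rightarrow>
   (nat \<Rightarrow> 's \<Rightarrow> 'a) \<Rightarrow> ('s, 'a) triple \<Rightarrow> real" where
  "fab_init M x h t \<sigma> a0 (i, s, a) =
     (if a = a0 i s
      then Y_prop M h \<sigma> i s - (\<Sum>a'\<in>actions M i - {a0 i s}. fab_floor M x h t \<sigma> (i, s, a'))
      else fab_floor M x h t \<sigma> (i, s, a))"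

text \<open>The list of actions \<open>b 1, \<dots>, b (card (cheaper M i l s a) + 1)\<close>, sorted by cost for all
  constraints at once, has distinct entries, so it enumerates \<open>a\<close> and all actions that are cheaper
  than \<open>a\<close> for constraint \<open>l\<close>.\<close>

definition cheaper :: "('s, 'a) gang_model \<Rightarrow> nat \<Rightarrow> nat \<Rightarrow> 's \<Rightarrow> 'a \<Rightarrow> 'a set" where
  "cheaper M i l s a = {a' \<in> actions M i. cost M i l s a' < cost M i l s a}"

definition fab_chain ::
  "('s, 'a) gang_model \<Rightarrow> (nat \<Rightarrow> 's \<Rightarrow> 'a) \<Rightarrow> nat \<Rightarrow> nat \<Rightarrow> 's \<Rightarrow> 'a \<Rightarrow> (nat \<Rightarrow> 'a) \<Rightarrow> bool" where
  "fab_chain M a0 l i s a b \<longleftrightarrow>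
     (let K = card (cheaper M i l s a) + 1
      in b ` {1..K} \<subseteq> actions M i \<and> inj_on b {1..K} \<and> b K = a \<and> b 1 = a0 i s \<and>
         (\<forall>l'\<in>{1..num_constraints M}.
            (\<forall>m. 1 \<le> m \<and> m + 1 < K \<longrightarrow> cost M i l' s (b m) \<le> cost M i l' s (b (m + 1))) \<and>
            cost M i l' s (b (K - 1)) < cost M i l' s (b K)))"

definition fab_transfer ::
  "('s, 'a) gang_model \<Rightarrow> nat \<Rightarrow> nat \<Rightarrow> nat \<Rightarrow> 's \<Rightarrow> 'a \<Rightarrow> 'a \<Rightarrow>
   (('s, 'a) triple \<Rightarrow> real) \<Rightarrow> ('s, 'a) triple \<Rightarrow> real" where
  "fab_transfer M h l i s lo hi Z =
     (let df = cost M i l s hi - cost M i l s lo;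
          dZ = (if df > 0
                then of_int \<lceil>load M l Z * real (total_size M h) / df\<rceil> / real (total_size M h)
                else 0);
          \<delta> = min (Z (i, s, hi)) dZ
      in Z((i, s, lo) := Z (i, s, lo) + \<delta>, (i, s, hi) := Z (i, s, hi) - \<delta>))"

primrec fab_shift ::
  "('s, 'a) gang_model \<Rightarrow> nat \<Rightarrow> nat \<Rightarrow> nat \<Rightarrow> 's \<Rightarrow> (nat \<Rightarrow> 'a) \<Rightarrow> nat \<Rightarrow>
   (('s, 'a) triple \<Rightarrow> real) \<Rightarrow> ('s, 'a) triple \<Rightarrow> real" where
  "fab_shift M h l i s b 0 Z = Z"
| "fab_shift M h l i s b (Suc m) Z =
     (if load M l Z \<le> 0 then Z
      else fab_shift M h l i s b m (fab_transfer M h l i s (b (Suc m)) (b (Suc (Suc m))) Z))"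

text \<open>\<open>fab_pass M h a0 l js Z Z'\<close>: treating constraint \<open>l\<close> by going through the remaining triples
  \<open>js\<close>, starting from \<open>Z\<close>, can end with \<open>Z'\<close>. There is no result if a required list of actions is
  not available.

  Rule \<open>exhausted\<close> concerns a run that reaches the end of the triples with
  \<open>load M l Z > 0\<close>: it goes on with the next constraint, provided that no two
  non-minimal actions of a state have the same cost. If there are such ties, \<open>fab_transfer\<close>
  can strand processes at an action whose triple was already passed (it moves nothing when
  \<open>df = 0\<close>), and the constraint may remain violated although processes could still be moved
  to cheaper actions; such an unfinished run has no result.\<close>

inductive fab_pass ::
  "('s, 'a) gang_model \<Rightarrow> nat \<Rightarrow> (nat \<Rightarrow> 's \<Rightarrow> 'a) \<Rightarrow> nat \<Rightarrow> ('s, 'a) triple list \<Rightarrow>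
   (('s, 'a) triple \<Rightarrow> real) \<Rightarrow> (('s, 'a) triple \<Rightarrow> real) \<Rightarrow> bool"
  for M h a0 l where
  satisfied: "load M l Z \<le> 0 \<Longrightarrow> fab_pass M h a0 l js Z Z"
| empty: "\<lbrakk>load M l Z > 0; Z j \<le> 0; fab_pass M h a0 l js Z Z'\<rbrakk>
    \<Longrightarrow> fab_pass M h a0 l (j # js) Z Z'"
| cheapest: "\<lbrakk>load M l Z > 0; Z (i, s, a) > 0; cheaper M i l s a = {};
      fab_pass M h a0 l js Z Z'\<rbrakk>
    \<Longrightarrow> fab_pass M h a0 l ((i, s, a) # js) Z Z'"
| shift: "\<lbrakk>load M l Z > 0; Z (i, s, a) > 0; cheaper M i l s a \<noteq> {};
      fab_chain M a0 l i s a b;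
      fab_pass M h a0 l js (fab_shift M h l i s b (card (cheaper M i l s a)) Z) Z'\<rbrakk>
    \<Longrightarrow> fab_pass M h a0 l ((i, s, a) # js) Z Z'"
| exhausted: "\<lbrakk>load M l Z > 0;
      \<forall>i\<in>{1..num_gangs M}. \<forall>s\<in>states M i.
        inj_on (cost M i l s) {a \<in> actions M i. cheaper M i l s a \<noteq> {}}\<rbrakk>
    \<Longrightarrow> fab_pass M h a0 l [] Z Z"

primrec fab_passes ::
  "('s, 'a) gang_model \<Rightarrow> nat \<Rightarrow> (nat \<Rightarrow> 's \<Rightarrow> 'a) \<Rightarrow> ('s, 'a) triple list \<Rightarrow> nat list \<Rightarrow>
   (('s, 'a) triple \<Rightarrow> real) \<Rightarrow> (('s, 'a) triple \<Rightarrow> real) \<Rightarrow> bool" where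
  "fab_passes M h a0 js [] Z Z' \<longleftrightarrow> Z' = Z"
| "fab_passes M h a0 js (l # ls) Z Z' \<longleftrightarrow>
     (\<exists>Z1. fab_pass M h a0 l js Z Z1 \<and> fab_passes M h a0 js ls Z1 Z')"

text \<open>If no constraint is violated by \<open>fab_init\<close>, then every pass ends at once by rule
  \<open>satisfied\<close>, so this case needs no separate treatment.\<close>

definition fab_result ::
  "('s, 'a) gang_model \<Rightarrow> (nat \<Rightarrow> ('s, 'a) triple \<Rightarrow> real) \<Rightarrow> nat \<Rightarrow> nat \<Rightarrow> 's vec \<Rightarrow>
   (('s, 'a) triple \<Rightarrow> real) \<Rightarrow> bool" where
  "fab_result M x h t \<sigma> Z \<longleftrightarrow>
     (\<exists>a0 js.
        (\<forall>i\<in>{1..num_gangs M}. \<forall>s\<in>states M i. a0 i s \<in> actions M i) \<and>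
        distinct js \<and> set js = triples M \<and>
        sorted_wrt (\<lambda>j k. lp_alpha M x t j \<le> lp_alpha M x t k) js \<and>
        fab_passes M h a0 js [1..<num_constraints M + 1] (fab_init M x h t \<sigma> a0) Z)"

text \<open>The choices left open by the procedure (picked actions, order of tied triples, lists of
  actions, and which processes take which action) may be made in any way, separately for
  each time and state vector.\<close>

definition fab_policy ::
  "('s, 'a) gang_model \<Rightarrow> (nat \<Rightarrow> ('s, 'a) triple \<Rightarrow> real) \<Rightarrow> nat \<Rightarrow> ('s, 'a) policy \<Rightarrow> bool" where
  "fab_policy M x h \<psi> \<longleftrightarrow>
     \<psi> \<in> policies M h \<and>
     (\<forall>t\<in>{0..horizon M}. \<forall>\<sigma>\<in>state_vectors M h.
        \<exists>Z. fab_result M x h t \<sigma> Z \<and> (\<forall>j\<in>triples M. Z_prop M h (\<sigma>, \<psi> t \<sigma>) j = Z j))"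

end

theory Submission
  imports Defs
begin

text \<open>Let \<open>fluid x\<close> be the optimal solution \<open>x\<close> of the linear program, rescaled by the shares of the gangs
in the whole system. It is the mean of the proportions under the randomized policy built from
\<open>x\<close> (\<open>mean_lp_policy\<close>), for every size of the system. The FAB policy follows this trajectory,
and the linear program bounds the gain of all competitors.

Two facts about one run of the FAB procedure carry the proof. First, it ends with all constraints
satisfied (\<open>pass_satisfies\<close>, \<open>passes_properties\<close>). A transfer moves processes to an action that is
at least as cheap for every constraint, so no load ever grows. If a pass came to the end of the
list with a positive load, it would have drained every action that is not cheapest. The remaining
allocation would then have the load of the cheapest actions, which is nonpositive by hypothesis.
Secondly, the procedure moves little when the states are close to the fluid solution
(\<open>fab_result_properties\<close>). The fluid solution has nonpositive load, so the load after rounding is at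
most a constant times \<open>\<eta> + 1 / N\<close>, where \<open>\<eta>\<close> is the distance of \<open>Y\<close> from its fluid value. One
transfer moves at most the load divided by the least positive cost difference, plus a rounding
error \<open>1 / N\<close>, and the number of transfers is bounded independently of the size of the system. Hence
\<open>Z\<close> stays within a constant times \<open>\<eta> + 1 / N\<close> of the fluid solution.

Given states and actions at time \<open>t\<close>, the proportions \<open>Y\<close> at time \<open>t + 1\<close> are averages of independent
indicators, and their mean is the image of \<open>Z\<close> at time \<open>t\<close> under the linear map that also governs
the fluid solution. Hoeffding's inequality (\<open>next_Y_concentration\<close>) and the second fact alternate
in an induction over time: deviations of \<open>Y\<close> and of \<open>Z\<close> have exponentially small probability
(\<open>deviating_Y_exp_small\<close>, \<open>deviating_Z_exp_small\<close>). Since proportions lie between 0 and 1, the means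
follow.

For asymptotic optimality, the means of a policy that satisfies the constraints form, after
rescaling, a feasible point of the linear program with the gain of the policy as objective value
(\<open>gain_le_lp_optimum\<close>). So every such gain is at most the optimal value of the linear program, and
the gain of the FAB policy tends to that value because its means tend to the fluid solution.\<close>

section \<open>Occupation proportions\<close>

text \<open>Averages over processes become sums over states or triples by counting the processes in
  each fibre.\<close>

lemma sum_over_fibres:
  fixes g :: "'b \<Rightarrow> real"
  assumes "finite A" "finite B" "f ` A \<subseteq> B"
  shows "(\<Sum>n\<in>A. g (f n)) = (\<Sum>b\<in>B. real (card {n\<in>A. f n = b}) * g b)"
proof -
  have "(\<Sum>n\<in>A. g (f n)) = (\<Sum>b\<in>B. \<Sum>n\<in>{n\<in>A. f n = b}. g (f n))"
    using sum.group[OF assms, of "\<lambda>n. g (f n)"] by simp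
  also have "\<dots> = (\<Sum>b\<in>B. real (card {n\<in>A. f n = b}) * g b)"
    by (intro sum.cong refl) simp
  finally show ?thesis .
qed

text \<open>Moving mass \<open>\<delta>\<close> from \<open>q\<close> to \<open>p\<close> changes a
  linear functional by \<open>\<delta>\<close> times the difference of the weights. With costs as
  weights this gives the effect on a load; with weights 1 it gives conservation of mass.\<close>

lemma sum_move:
  fixes g Z :: "'b \<Rightarrow> real"
  assumes "finite A" "p \<in> A" "q \<in> A" "p \<noteq> q"
  shows "(\<Sum>j\<in>A. (Z(p := Z p + \<delta>, q := Z q - \<delta>)) j * g j)
    = (\<Sum>j\<in>A. Z j * g j) + \<delta> * (g p - g q)"
proof -
  have "(\<Sum>j\<in>A. (Z(p := Z p + \<delta>, q := Z q - \<delta>)) j * g j)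
    = (\<Sum>j\<in>A. Z j * g j + (if j = p then \<delta> * g p else 0) - (if j = q then \<delta> * g q else 0))"
    using assms by (intro sum.cong) (auto simp: algebra_simps)
  also have "\<dots> = (\<Sum>j\<in>A. Z j * g j) + \<delta> * (g p - g q)"
    using assms by (simp add: sum.distrib sum_subtractf algebra_simps)
  finally show ?thesis .
qed

locale gang_system =
  fixes M :: "('s, 'a) gang_model"
  assumes valid: "valid_model M"
begin

lemma finite_states: "i \<in> {1..num_gangs M} \<Longrightarrow> finite (states M i)"
  and finite_actions: "i \<in> {1..num_gangs M} \<Longrightarrow> finite (actions M i)"
  and actions_nonempty: "i \<in> {1..num_gangs M} \<Longrightarrow> actions M i \<noteq> {}"
  and states_nonempty: "i \<in> {1..num_gangs M} \<Longrightarrow> states M i \<noteq> {}"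
  and base_size_pos: "i \<in> {1..num_gangs M} \<Longrightarrow> base_size M i > 0"
  and trans_prob_states: "i \<in> {1..num_gangs M} \<Longrightarrow> s \<in> states M i \<Longrightarrow> a \<in> actions M i \<Longrightarrow>
        set_pmf (trans_prob M i s a) \<subseteq> states M i"
  using valid unfolding valid_model_def by (fastforce simp: Suc_le_eq)+

lemma triples_iff: "(i, s, a) \<in> triples M \<longleftrightarrow>
    i \<in> {1..num_gangs M} \<and> s \<in> states M i \<and> a \<in> actions M i"
  by (simp add: triples_def)

lemma triples_eq_Sigma:
  "triples M = (SIGMA i:{1..num_gangs M}. states M i \<times> actions M i)"
  by (auto simp: triples_def)

lemma finite_triples: "finite (triples M)"
  unfolding triples_eq_Sigma
  by (intro finite_SigmaI finite_cartesian_product) (auto simp: finite_states finite_actions)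

lemma triples_nonempty: "triples M \<noteq> {}"
proof -
  have "1 \<in> {1..num_gangs M}"
    using valid by (simp add: valid_model_def)
  then show ?thesis
    using states_nonempty[of 1] actions_nonempty[of 1]
    by (auto simp: triples_eq_Sigma Sigma_empty_iff)
qed

lemma triple_norm_le_iff: "triple_norm M v \<le> c \<longleftrightarrow> (\<forall>j\<in>triples M. \<bar>v j\<bar> \<le> c)"
  unfolding triple_norm_def using finite_triples triples_nonempty by (subst Max_le_iff) auto

text \<open>Turns the nested maxima of the theorem into a bound for each time and triple.\<close>

lemma max_triple_norm_le_iff:
  "(MAX t\<in>{0..horizon M}. triple_norm M (v t)) \<le> c
    \<longleftrightarrow> (\<forall>t\<in>{0..horizon M}. \<forall>j\<in>triples M. \<bar>v t j\<bar> \<le> c)"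
  by (subst Max_le_iff) (auto simp: triple_norm_le_iff)

lemma sum_triples:
  fixes g :: "nat \<Rightarrow> 's \<Rightarrow> 'a \<Rightarrow> real"
  shows "(\<Sum>(i, s, a)\<in>triples M. g i s a)
    = (\<Sum>i\<in>{1..num_gangs M}. \<Sum>s\<in>states M i. \<Sum>a\<in>actions M i. g i s a)"
  unfolding triples_eq_Sigma
  by (subst sum.Sigma[symmetric])
    (auto simp: finite_states finite_actions sum.cartesian_product intro!: sum.cong)

lemma total_base_size_pos: "total_base_size M > 0"
proof -
  have "1 \<in> {1..num_gangs M}"
    using valid by (simp add: valid_model_def)
  then have "base_size M 1 \<le> total_base_size M" "base_size M 1 > 0"
    unfolding total_base_size_def by (auto intro!: member_le_sum base_size_pos)
  then show ?thesis by simp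
qed

lemma total_size_pos: "h \<ge> 1 \<Longrightarrow> real (total_size M h) > 0"
  using total_base_size_pos by (simp add: total_size_def)

lemma base_size_le_total: "i \<in> {1..num_gangs M} \<Longrightarrow> base_size M i \<le> total_base_size M"
  unfolding total_base_size_def by (rule member_le_sum) auto

lemma state_vectors_mem:
  "\<sigma> \<in> state_vectors M h \<Longrightarrow> i \<in> {1..num_gangs M} \<Longrightarrow> n \<in> {1..h * base_size M i} \<Longrightarrow>
    \<sigma> (i, n) \<in> states M i"
  by (auto simp: state_vectors_def processes_def dest!: PiE_mem)

lemma action_vectors_mem:
  "\<alpha> \<in> action_vectors M h \<Longrightarrow> i \<in> {1..num_gangs M} \<Longrightarrow> n \<in> {1..h * base_size M i} \<Longrightarrow>
    \<alpha> (i, n) \<in> actions M i"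
  by (auto simp: action_vectors_def processes_def dest!: PiE_mem)

lemma sum_processes_Z:
  fixes g :: "'s \<Rightarrow> 'a \<Rightarrow> real"
  assumes "\<sigma> \<in> state_vectors M h" "\<alpha> \<in> action_vectors M h" "i \<in> {1..num_gangs M}"
  shows "(\<Sum>n\<in>{1..h * base_size M i}. g (\<sigma> (i, n)) (\<alpha> (i, n))) / total_size M h
    = (\<Sum>s\<in>states M i. \<Sum>a\<in>actions M i. Z_prop M h (\<sigma>, \<alpha>) (i, s, a) * g s a)"
proof -
  have "(\<Sum>n\<in>{1..h * base_size M i}. g (\<sigma> (i, n)) (\<alpha> (i, n)))
    = (\<Sum>n\<in>{1..h * base_size M i}. (\<lambda>(s, a). g s a) (\<sigma> (i, n), \<alpha> (i, n)))" by simp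
  also have "\<dots> = (\<Sum>b\<in>states M i \<times> actions M i.
      real (card {n\<in>{1..h * base_size M i}. (\<sigma> (i, n), \<alpha> (i, n)) = b}) * (\<lambda>(s, a). g s a) b)"
    using assms by (intro sum_over_fibres)
      (auto simp: finite_states finite_actions intro!: state_vectors_mem action_vectors_mem)
  also have "\<dots> = (\<Sum>s\<in>states M i. \<Sum>a\<in>actions M i.
      real (card {n\<in>{1..h * base_size M i}. \<sigma> (i, n) = s \<and> \<alpha> (i, n) = a}) * g s a)"
    by (simp add: sum.cartesian_product split_beta prod_eq_iff)
  finally show ?thesis
    by (simp add: sum_divide_distrib)
qed

lemma sum_processes_Y:
  fixes g :: "'s \<Rightarrow> real"
  assumes "\<sigma> \<in> state_vectors M h" "i \<in> {1..num_gangs M}"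
  shows "(\<Sum>n\<in>{1..h * base_size M i}. g (\<sigma> (i, n))) / total_size M h
    = (\<Sum>s\<in>states M i. Y_prop M h \<sigma> i s * g s)"
proof -
  have "(\<Sum>n\<in>{1..h * base_size M i}. g (\<sigma> (i, n)))
     = (\<Sum>s\<in>states M i. real (card {n\<in>{1..h * base_size M i}. \<sigma> (i, n) = s}) * g s)"
    using assms by (intro sum_over_fibres) (auto simp: finite_states intro!: state_vectors_mem)
  then show ?thesis
    by (simp add: sum_divide_distrib Y_prop_def)
qed

text \<open>The constraints are stated for vectors of processes, but the FAB procedure works with
  proportions. The load is the bridge.\<close>

lemma load_eq_sum_costs:
  assumes "\<sigma> \<in> state_vectors M h" "\<alpha> \<in> action_vectors M h"
  shows "load M l (Z_prop M h (\<sigma>, \<alpha>)) =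
    (\<Sum>i\<in>{1..num_gangs M}. \<Sum>n\<in>{1..h * base_size M i}.
       cost M i l (\<sigma> (i, n)) (\<alpha> (i, n))) / total_size M h"
  unfolding load_def sum_triples sum_divide_distrib
  using sum_processes_Z[OF assms, symmetric] by (simp add: sum_divide_distrib)

lemma load_cong:
  "(\<And>j. j \<in> triples M \<Longrightarrow> Z j = Z' j) \<Longrightarrow> load M l Z = load M l Z'"
  unfolding load_def by (intro sum.cong) auto

lemma load_diff_le:
  assumes "\<And>j. j \<in> triples M \<Longrightarrow> \<bar>Z j - Z' j\<bar> \<le> \<eta>"
  shows "load M l Z \<le> load M l Z' + \<eta> * (\<Sum>(i, s, a)\<in>triples M. \<bar>cost M i l s a\<bar>)"
proof -
  have "load M l Z - load M l Z' = (\<Sum>(i, s, a)\<in>triples M. (Z (i, s, a) - Z' (i, s, a)) * cost M i l s a)"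
    unfolding load_def by (simp add: split_beta left_diff_distrib sum_subtractf)
  also have "\<dots> \<le> (\<Sum>(i, s, a)\<in>triples M. \<eta> * \<bar>cost M i l s a\<bar>)"
  proof (intro sum_mono, clarify)
    fix i s a assume j: "(i, s, a) \<in> triples M"
    have "(Z (i, s, a) - Z' (i, s, a)) * cost M i l s a
      \<le> \<bar>Z (i, s, a) - Z' (i, s, a)\<bar> * \<bar>cost M i l s a\<bar>"
      by (simp flip: abs_mult)
    also have "\<dots> \<le> \<eta> * \<bar>cost M i l s a\<bar>"
      using assms[OF j] by (intro mult_right_mono) auto
    finally show "(Z (i, s, a) - Z' (i, s, a)) * cost M i l s a \<le> \<eta> * \<bar>cost M i l s a\<bar>" .
  qed
  finally show ?thesis
    by (simp add: sum_distrib_left split_beta)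
qed

section \<open>Repairs of an allocation\<close>

text \<open>The effect of any stretch of the FAB procedure: processes change their actions but not
  their states, and never to a dearer action. The bounds \<open>D\<close> add up under composition,
  so it suffices to bound one transfer and to count transfers.\<close>

definition repairs ::
  "real \<Rightarrow> (('s, 'a) triple \<Rightarrow> real) \<Rightarrow> (('s, 'a) triple \<Rightarrow> real) \<Rightarrow> bool" where
  "repairs D Z Z' \<longleftrightarrow>
     (\<forall>j\<in>triples M. 0 \<le> Z' j) \<and>
     (\<forall>i\<in>{1..num_gangs M}. \<forall>s\<in>states M i.
        (\<Sum>a\<in>actions M i. Z' (i, s, a)) = (\<Sum>a\<in>actions M i. Z (i, s, a))) \<and>
     (\<forall>l\<in>{1..num_constraints M}. load M l Z' \<le> load M l Z) \<and>
     (\<forall>j\<in>triples M. \<bar>Z' j - Z j\<bar> \<le> D)"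

lemma repairs_refl: "(\<forall>j\<in>triples M. 0 \<le> Z j) \<Longrightarrow> D \<ge> 0 \<Longrightarrow> repairs D Z Z"
  by (simp add: repairs_def)

lemma repairs_trans:
  "repairs D1 Z1 Z2 \<Longrightarrow> repairs D2 Z2 Z3 \<Longrightarrow> repairs (D1 + D2) Z1 Z3"
  unfolding repairs_def by (smt (verit, ccfv_SIG))

lemma repairs_mono: "repairs D Z Z' \<Longrightarrow> D \<le> D' \<Longrightarrow> repairs D' Z Z'"
  unfolding repairs_def by force

text \<open>The amount of a transfer is a load divided by a positive cost difference, so a lower
  bound for these differences limits all transfers at once.\<close>

definition cost_gap :: "real \<Rightarrow> bool" where
  "cost_gap d \<longleftrightarrow> d > 0 \<and>
     (\<forall>l\<in>{1..num_constraints M}. \<forall>i\<in>{1..num_gangs M}. \<forall>s\<in>states M i.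
      \<forall>a\<in>actions M i. \<forall>a'\<in>actions M i.
        cost M i l s a < cost M i l s a' \<longrightarrow> d \<le> cost M i l s a' - cost M i l s a)"

text \<open>There are finitely many cost differences. The extra element 1 covers the case that none
  is positive.\<close>

lemma cost_gap_exists: "\<exists>d. cost_gap d"
proof -
  let ?P = "\<lambda>(l, (i, s, a), (i', s', a')). cost M i' l s' a' - cost M i l s a"
  let ?G = "{g \<in> ?P ` ({1..num_constraints M} \<times> triples M \<times> triples M). g > 0}"
  let ?d = "Min (insert 1 ?G)"
  have fin: "finite (insert 1 ?G)"
    using finite_triples by auto
  have "cost_gap ?d"
    unfolding cost_gap_def
  proof (intro conjI ballI impI)
    show "?d > 0"
      by (subst Min_gr_iff[OF fin]) auto
  next
    fix l i s a a'
    assume *: "l \<in> {1..num_constraints M}" "i \<in> {1..num_gangs M}" "s \<in> states M i"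
      "a \<in> actions M i" "a' \<in> actions M i" "cost M i l s a < cost M i l s a'"
    have "?P (l, (i, s, a), (i, s, a')) \<in> ?P ` ({1..num_constraints M} \<times> triples M \<times> triples M)"
      using * by (intro imageI) (simp add: triples_iff)
    then have "cost M i l s a' - cost M i l s a \<in> insert 1 ?G"
      using * by simp
    then show "?d \<le> cost M i l s a' - cost M i l s a"
      by (rule Min_le[OF fin])
  qed
  then show ?thesis ..
qed

lemma load_eq_sum: "load M l Z = (\<Sum>j\<in>triples M. Z j * (case j of (i, s, a) \<Rightarrow> cost M i l s a))"
  unfolding load_def by (intro sum.cong) auto

lemma load_move:
  assumes "(i, s, lo) \<in> triples M" "(i, s, hi) \<in> triples M" "lo \<noteq> hi"
  shows "load M l (Z((i, s, lo) := Z (i, s, lo) + \<delta>, (i, s, hi) := Z (i, s, hi) - \<delta>))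
    = load M l Z - \<delta> * (cost M i l s hi - cost M i l s lo)"
  using sum_move[OF finite_triples assms(1,2), of Z \<delta> "\<lambda>(i, s, a). cost M i l s a"] assms(3)
  unfolding load_eq_sum by (simp add: algebra_simps)

lemma row_move:
  fixes Z :: "('s, 'a) triple \<Rightarrow> real"
  assumes "(i, s, lo) \<in> triples M" "(i, s, hi) \<in> triples M" "lo \<noteq> hi" "i' \<in> {1..num_gangs M}"
  shows "(\<Sum>a\<in>actions M i'. (Z((i, s, lo) := Z (i, s, lo) + \<delta>, (i, s, hi) := Z (i, s, hi) - \<delta>)) (i', s', a))
    = (\<Sum>a\<in>actions M i'. Z (i', s', a))"
proof (cases "(i', s') = (i, s)")
  case True
  let ?V = "\<lambda>a. Z (i, s, a) :: real"
  have "(\<Sum>a\<in>actions M i'. (Z((i, s, lo) := Z (i, s, lo) + \<delta>, (i, s, hi) := Z (i, s, hi) - \<delta>)) (i', s', a))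
    = (\<Sum>a\<in>actions M i. (?V(lo := ?V lo + \<delta>, hi := ?V hi - \<delta>)) a * 1)"
    using True assms(3) by (intro sum.cong) (auto simp: fun_upd_def)
  also have "\<dots> = (\<Sum>a\<in>actions M i. ?V a * 1) + \<delta> * (1 - 1)"
    using assms by (intro sum_move) (auto simp: triples_iff finite_actions)
  finally show ?thesis
    using True by (simp del: fun_upd_apply)
qed auto

text \<open>The amount moved is nonnegative because the load is positive. It is at most the load
  divided by the cost difference, rounded up to a multiple of \<open>1 / N\<close>.\<close>

lemma repairs_transfer:
  assumes h: "h \<ge> 1" and l: "l \<in> {1..num_constraints M}"
    and lo: "(i, s, lo) \<in> triples M" and hi: "(i, s, hi) \<in> triples M" and ne: "lo \<noteq> hi"
    and cheap: "\<forall>l'\<in>{1..num_constraints M}. cost M i l' s lo \<le> cost M i l' s hi"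
    and nonneg: "\<forall>j\<in>triples M. 0 \<le> Z j"
    and load: "load M l Z > 0" "load M l Z \<le> B" and gap: "cost_gap d"
  shows "repairs (B / d + 1 / total_size M h) Z (fab_transfer M h l i s lo hi Z)"
proof -
  define N where "N = real (total_size M h)"
  have N: "N > 0" using total_size_pos[OF h] by (simp add: N_def)
  define df where "df = cost M i l s hi - cost M i l s lo"
  define dZ where "dZ = (if df > 0 then of_int \<lceil>load M l Z * N / df\<rceil> / N else 0)"
  define \<delta> where "\<delta> = min (Z (i, s, hi)) dZ"
  have tr: "fab_transfer M h l i s lo hi Z
      = Z((i, s, lo) := Z (i, s, lo) + \<delta>, (i, s, hi) := Z (i, s, hi) - \<delta>)"
    unfolding fab_transfer_def Let_def df_def dZ_def \<delta>_def N_def ..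
  have d: "d > 0" using gap by (simp add: cost_gap_def)
  have dZ0: "dZ \<ge> 0"
    using load N unfolding dZ_def
    by (auto intro!: divide_nonneg_pos order.trans[OF _ le_of_int_ceiling]
        simp flip: of_int_0_le_iff[where 'a = real] simp del: of_int_0_le_iff)
  have "dZ \<le> B / d + 1 / N"
  proof (cases "df > 0")
    case True
    then have ddf: "d \<le> df"
      using gap l lo hi unfolding cost_gap_def df_def triples_iff by auto
    have "dZ \<le> (load M l Z * N / df + 1) / N"
      unfolding dZ_def using True N by (auto intro!: divide_right_mono)
    also have "\<dots> = load M l Z / df + 1 / N"
      using N by (simp add: field_simps)
    also have "load M l Z / df \<le> B / d"
      using load ddf d by (intro frac_le) auto
    finally show ?thesis by simp
  qed (use load d N in \<open>auto simp: dZ_def\<close>)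
  then have \<delta>: "0 \<le> \<delta>" "\<delta> \<le> Z (i, s, hi)" "\<delta> \<le> B / d + 1 / N"
    using dZ0 nonneg hi by (auto simp: \<delta>_def)
  show ?thesis
    unfolding repairs_def tr
  proof (intro conjI ballI)
    fix j assume "j \<in> triples M"
    then show "0 \<le> (Z((i, s, lo) := Z (i, s, lo) + \<delta>, (i, s, hi) := Z (i, s, hi) - \<delta>)) j"
      using nonneg \<delta> lo by auto
  next
    fix i' s' assume "i' \<in> {1..num_gangs M}" "s' \<in> states M i'"
    then show "(\<Sum>a\<in>actions M i'. (Z((i, s, lo) := Z (i, s, lo) + \<delta>, (i, s, hi) := Z (i, s, hi) - \<delta>)) (i', s', a))
      = (\<Sum>a\<in>actions M i'. Z (i', s', a))"
      by (intro row_move lo hi ne)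
  next
    fix l' assume "l' \<in> {1..num_constraints M}"
    then show "load M l' (Z((i, s, lo) := Z (i, s, lo) + \<delta>, (i, s, hi) := Z (i, s, hi) - \<delta>)) \<le> load M l' Z"
      using \<delta> cheap by (simp add: load_move[OF lo hi ne])
  next
    fix j assume "j \<in> triples M"
    then show "\<bar>(Z((i, s, lo) := Z (i, s, lo) + \<delta>, (i, s, hi) := Z (i, s, hi) - \<delta>)) j - Z j\<bar>
      \<le> B / d + 1 / real (total_size M h)"
      using \<delta> unfolding N_def[symmetric] by auto
  qed
qed

lemma transfer_outside: "j \<notin> {(i, s, lo), (i, s, hi)} \<Longrightarrow> fab_transfer M h l i s lo hi Z j = Z j"
  by (auto simp: fab_transfer_def Let_def)

text \<open>Had the transfer been limited by the rounded amount, it would have removed the whole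
  load. So a load that stays positive means that all processes at \<open>hi\<close> were
  moved.\<close>

lemma transfer_empties:
  assumes h: "h \<ge> 1"
    and lo: "(i, s, lo) \<in> triples M" and hi: "(i, s, hi) \<in> triples M" and ne: "lo \<noteq> hi"
    and less: "cost M i l s lo < cost M i l s hi"
    and pos: "load M l (fab_transfer M h l i s lo hi Z) > 0"
  shows "fab_transfer M h l i s lo hi Z (i, s, hi) = 0"
proof -
  define N where "N = real (total_size M h)"
  have N: "N > 0" using total_size_pos[OF h] by (simp add: N_def)
  define df where "df = cost M i l s hi - cost M i l s lo"
  have df: "df > 0" using less by (simp add: df_def)
  define dZ where "dZ = of_int \<lceil>load M l Z * N / df\<rceil> / N"
  define \<delta> where "\<delta> = min (Z (i, s, hi)) dZ"
  have tr: "fab_transfer M h l i s lo hi Z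
      = Z((i, s, lo) := Z (i, s, lo) + \<delta>, (i, s, hi) := Z (i, s, hi) - \<delta>)"
    using df unfolding fab_transfer_def Let_def df_def dZ_def \<delta>_def N_def by simp
  have "load M l Z - \<delta> * df > 0"
    using pos unfolding tr by (simp add: load_move[OF lo hi ne] df_def)
  moreover have "dZ \<ge> (load M l Z * N / df) / N"
    unfolding dZ_def using N by (intro divide_right_mono) auto
  then have "dZ * df \<ge> load M l Z"
    using N df by (simp add: field_simps)
  ultimately have "\<delta> \<noteq> dZ"
    by auto
  then have "\<delta> = Z (i, s, hi)"
    by (auto simp: \<delta>_def min_def split: if_splits)
  then show ?thesis
    unfolding tr by simp
qed

text \<open>A shift walks down a chain of actions. An action that has been drained is not touched
  again during the same shift, because later transfers only involve lower positions of the
  chain.\<close>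

lemma shift_properties:
  assumes h: "h \<ge> 1" and l: "l \<in> {1..num_constraints M}"
    and i: "i \<in> {1..num_gangs M}" "s \<in> states M i"
    and gap: "cost_gap d"
    and "b ` {1..Suc m} \<subseteq> actions M i" "inj_on b {1..Suc m}"
    and "\<forall>l'\<in>{1..num_constraints M}. \<forall>k\<in>{1..m}. cost M i l' s (b k) \<le> cost M i l' s (b (Suc k))"
    and "\<forall>j\<in>triples M. 0 \<le> Z j" "load M l Z \<le> B" "B \<ge> 0"
  shows "repairs (m * (B / d + 1 / total_size M h)) Z (fab_shift M h l i s b m Z)"
    and "j \<notin> (\<lambda>k. (i, s, b k)) ` {1..Suc m} \<Longrightarrow> fab_shift M h l i s b m Z j = Z j"
    and "load M l (fab_shift M h l i s b m Z) > 0 \<Longrightarrow> k \<in> {1..m} \<Longrightarrow>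
      cost M i l s (b k) < cost M i l s (b (Suc k)) \<Longrightarrow>
      fab_shift M h l i s b m Z (i, s, b (Suc k)) = 0"
  using assms(6-)
proof (induction m arbitrary: Z j k)
  case 0
  {
    case 1 then show ?case by (simp add: repairs_refl)
  next
    case 2 then show ?case by simp
  next
    case 3 then show ?case by simp
  }
next
  case (Suc m)
  let ?D = "B / d + 1 / real (total_size M h)"
  let ?tr = "fab_transfer M h l i s (b (Suc m)) (b (Suc (Suc m)))"
  have D: "?D \<ge> 0"
    using gap \<open>B \<ge> 0\<close> by (simp add: cost_gap_def)
  have step: "repairs ?D Z (?tr Z)"
    if "load M l Z > 0" and p: "b ` {1..Suc (Suc m)} \<subseteq> actions M i" "inj_on b {1..Suc (Suc m)}"
       "\<forall>l'\<in>{1..num_constraints M}. \<forall>k\<in>{1..Suc m}. cost M i l' s (b k) \<le> cost M i l' s (b (Suc k))"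
       "\<forall>j\<in>triples M. 0 \<le> Z j" "load M l Z \<le> B" for Z
  proof (rule repairs_transfer[OF h l _ _ _ _ _ _ _ gap])
    show "b (Suc m) \<noteq> b (Suc (Suc m))"
      using p(2) by (auto dest!: inj_onD[of b _ "Suc m" "Suc (Suc m)"])
  qed (use that i in \<open>auto simp: triples_iff image_subset_iff\<close>)
  have inh: "b ` {1..Suc m} \<subseteq> actions M i" "inj_on b {1..Suc m}"
      "\<forall>l'\<in>{1..num_constraints M}. \<forall>k\<in>{1..m}. cost M i l' s (b k) \<le> cost M i l' s (b (Suc k))"
      "\<forall>j\<in>triples M. 0 \<le> ?tr Z j" "load M l (?tr Z) \<le> B"
    if "load M l Z > 0" and p: "b ` {1..Suc (Suc m)} \<subseteq> actions M i" "inj_on b {1..Suc (Suc m)}"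
       "\<forall>l'\<in>{1..num_constraints M}. \<forall>k\<in>{1..Suc m}. cost M i l' s (b k) \<le> cost M i l' s (b (Suc k))"
       "\<forall>j\<in>triples M. 0 \<le> Z j" "load M l Z \<le> B" for Z
  proof -
    note st = step[OF that, unfolded repairs_def]
    show "\<forall>j\<in>triples M. 0 \<le> ?tr Z j"
      using st by blast
    have "load M l (?tr Z) \<le> load M l Z"
      using st l by blast
    then show "load M l (?tr Z) \<le> B"
      using p(5) by linarith
    show "inj_on b {1..Suc m}"
      by (rule inj_on_subset[OF p(2)]) auto
    show "b ` {1..Suc m} \<subseteq> actions M i"
      using p(1) by (rule order.trans[rotated]) (intro image_mono, auto)
    show "\<forall>l'\<in>{1..num_constraints M}. \<forall>k\<in>{1..m}. cost M i l' s (b k) \<le> cost M i l' s (b (Suc k))"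
      using p(3) by simp
  qed
  have inj: "(i, s, b (Suc (Suc m))) \<notin> (\<lambda>k. (i, s, b k)) ` {1..Suc m}"
    if "inj_on b {1..Suc (Suc m)}"
  proof
    assume "(i, s, b (Suc (Suc m))) \<in> (\<lambda>k. (i, s, b k)) ` {1..Suc m}"
    then obtain k where "k \<in> {1..Suc m}" "b (Suc (Suc m)) = b k"
      by auto
    with inj_onD[OF that, of "Suc (Suc m)" k] show False
      by auto
  qed
  {
    case 1
    show ?case
    proof (cases "load M l Z \<le> 0")
      case True
      then show ?thesis
        using 1 D by (simp add: repairs_refl del: of_nat_Suc)
    next
      case False
      then have pos: "load M l Z > 0" by simp
      have "repairs (?D + m * ?D) Z (fab_shift M h l i s b m (?tr Z))"
        using inh[OF pos 1(1-5)] 1 by (intro repairs_trans[OF step[OF pos 1(1-5)]] Suc.IH(1)) auto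
      moreover have "?D + m * ?D = real (Suc m) * ?D"
        by (simp only: of_nat_Suc distrib_right mult_1_left add.commute)
      ultimately show ?thesis
        using False by simp
    qed
  next
    case 2
    show ?case
    proof (cases "load M l Z \<le> 0")
      case False
      then have pos: "load M l Z > 0" by simp
      have j: "j \<notin> (\<lambda>k. (i, s, b k)) ` {1..Suc m}"
          "j \<notin> {(i, s, b (Suc m)), (i, s, b (Suc (Suc m)))}"
        using 2(1) by auto
      have "fab_shift M h l i s b m (?tr Z) j = ?tr Z j"
        by (rule Suc.IH(2)[OF j(1) inh[OF pos 2(2-6)] 2(7)])
      then show ?thesis
        using False transfer_outside[OF j(2)] by simp
    qed simp
  next
    case 3
    then have False0: "\<not> load M l Z \<le> 0"
      by (auto split: if_splits)
    then have pos: "load M l Z > 0" by simp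
    note inh' = inh[OF pos 3(4-8)]
    have pos1: "load M l (fab_shift M h l i s b m (?tr Z)) > 0"
      using 3(1) False0 by simp
    show ?case
    proof (cases "k = Suc m")
      case True
      have "load M l (fab_shift M h l i s b m (?tr Z)) \<le> load M l (?tr Z)"
        using Suc.IH(1)[OF inh' 3(9)] l by (simp add: repairs_def)
      with pos1 have "load M l (?tr Z) > 0" by simp
      moreover have "b (Suc m) \<noteq> b (Suc (Suc m))"
        using 3(5) by (auto dest!: inj_onD[of b _ "Suc m" "Suc (Suc m)"])
      ultimately have "?tr Z (i, s, b (Suc (Suc m))) = 0"
        using 3 i True by (intro transfer_empties[OF h]) (auto simp: triples_iff image_subset_iff)
      moreover have "fab_shift M h l i s b m (?tr Z) (i, s, b (Suc (Suc m))) = ?tr Z (i, s, b (Suc (Suc m)))"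
        by (rule Suc.IH(2)[OF inj[OF 3(5)] inh' 3(9)])
      ultimately show ?thesis
        using False0 True by simp
    next
      case False
      then have "k \<in> {1..m}" using 3(2) by auto
      from Suc.IH(3)[OF pos1 this 3(3) inh' 3(9)] show ?thesis
        using False0 by simp
    qed
  }
qed

text \<open>The strict last inequality puts every action of the chain below \<open>a\<close>, and
  the chain has as many distinct entries as there are cheaper actions. Hence it lists exactly
  these.\<close>

lemma fab_chain_properties:
  assumes l: "l \<in> {1..num_constraints M}"
    and ia: "i \<in> {1..num_gangs M}" "s \<in> states M i" "a \<in> actions M i"
    and ne: "cheaper M i l s a \<noteq> {}"
    and chain: "fab_chain M a0 l i s a b"
  defines "m \<equiv> card (cheaper M i l s a)"
  shows "b ` {1..Suc m} \<subseteq> actions M i" "inj_on b {1..Suc m}" "b (Suc m) = a"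
    and "\<forall>l'\<in>{1..num_constraints M}. \<forall>k\<in>{1..m}. cost M i l' s (b k) \<le> cost M i l' s (b (Suc k))"
    and "b ` {1..m} = cheaper M i l s a"
proof -
  have fin: "finite (cheaper M i l s a)"
    using ia by (auto simp: cheaper_def finite_actions)
  have m: "m \<ge> 1"
    using ne fin by (simp add: m_def Suc_le_eq card_gt_0_iff)
  have c: "b ` {1..Suc m} \<subseteq> actions M i" "inj_on b {1..Suc m}" "b (Suc m) = a"
    and asc: "\<And>l' k. l' \<in> {1..num_constraints M} \<Longrightarrow> 1 \<le> k \<Longrightarrow> k < m \<Longrightarrow>
        cost M i l' s (b k) \<le> cost M i l' s (b (Suc k))"
    and strict: "\<And>l'. l' \<in> {1..num_constraints M} \<Longrightarrow> cost M i l' s (b m) < cost M i l' s (b (Suc m))"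
    using chain by (auto simp: fab_chain_def Let_def m_def)
  show "b ` {1..Suc m} \<subseteq> actions M i" "inj_on b {1..Suc m}" "b (Suc m) = a"
    by (fact c)+
  show "\<forall>l'\<in>{1..num_constraints M}. \<forall>k\<in>{1..m}. cost M i l' s (b k) \<le> cost M i l' s (b (Suc k))"
  proof (intro ballI)
    fix l' k assume "l' \<in> {1..num_constraints M}" "k \<in> {1..m}"
    then show "cost M i l' s (b k) \<le> cost M i l' s (b (Suc k))"
      using asc[of l' k] strict[of l'] by (cases "k = m") auto
  qed
  have le: "cost M i l s (b k) \<le> cost M i l s (b m)" if "1 \<le> k" "k \<le> m" for k
    using that(2,1)
  proof (induction k rule: inc_induct)
    case (step k)
    then show ?case using asc[OF l, of k] by simp
  qed simp
  have "b ` {1..m} \<subseteq> cheaper M i l s a"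
  proof clarify
    fix k assume "k \<in> {1..m}"
    then show "b k \<in> cheaper M i l s a"
      using le[of k] strict[OF l] c by (force simp: cheaper_def)
  qed
  moreover have "card (b ` {1..m}) = m"
    by (subst card_image) (auto intro!: inj_on_subset[OF c(2)])
  ultimately show "b ` {1..m} = cheaper M i l s a"
    using fin by (intro card_subset_eq) (auto simp: m_def)
qed

text \<open>The side condition of rule \<open>exhausted\<close> of \<open>fab_pass\<close>.\<close>

definition untied :: "nat \<Rightarrow> bool" where
  "untied l \<longleftrightarrow> (\<forall>i\<in>{1..num_gangs M}. \<forall>s\<in>states M i.
     inj_on (cost M i l s) {a \<in> actions M i. cheaper M i l s a \<noteq> {}})"

text \<open>In an unsatisfied shift every step with a positive cost difference drains the upper
  action. Without ties, a step with equal costs can only occur between two cheapest actions: the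
  predecessor of a non-cheapest action is either cheapest, hence strictly cheaper, or not cheapest,
  hence of different cost. Therefore every non-cheapest action of the chain ends up empty.\<close>

lemma shift_drains:
  assumes h: "h \<ge> 1" and l: "l \<in> {1..num_constraints M}" and gap: "cost_gap d"
    and ia: "i \<in> {1..num_gangs M}" "s \<in> states M i" "a \<in> actions M i"
    and ne: "cheaper M i l s a \<noteq> {}"
    and chain: "fab_chain M a0 l i s a b"
    and Z: "\<forall>j\<in>triples M. 0 \<le> Z j"
    and untied: "untied l"
  defines "Z' \<equiv> fab_shift M h l i s b (card (cheaper M i l s a)) Z"
  assumes pos: "load M l Z' > 0"
    and c: "c \<in> insert a (cheaper M i l s a)" "cheaper M i l s c \<noteq> {}"
  shows "Z' (i, s, c) = 0"
proof -
  define m where "m = card (cheaper M i l s a)"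
  note ch = fab_chain_properties[OF l ia ne chain, folded m_def]
  obtain k where k: "k \<in> {1..Suc m}" "c = b k"
  proof (cases "c = a")
    case True
    then show ?thesis using that[of "Suc m"] ch(3) by simp
  next
    case False
    then have "c \<in> b ` {1..m}" using c ch(5) by simp
    then obtain n where "n \<in> {1..m}" "c = b n" by blast
    then show ?thesis using that[of n] by simp
  qed
  \<comment> \<open>The chain starts at a cheapest action, so a non-cheapest action of it has a predecessor.\<close>
  have min: "cheaper M i l s (b 1) = {}"
  proof (rule ccontr)
    assume "cheaper M i l s (b 1) \<noteq> {}"
    then obtain e where e: "e \<in> actions M i" "cost M i l s e < cost M i l s (b 1)"
      by (auto simp: cheaper_def)
    have up: "cost M i l s (b 1) \<le> cost M i l s (b k)" if "1 \<le> k" "k \<le> Suc m" for k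
      using that
    proof (induction k rule: dec_induct)
      case (step k)
      then show ?case using ch(4) l by force
    qed simp
    have "e \<in> cheaper M i l s a"
      using e up[of "Suc m"] ch(3) by (simp add: cheaper_def)
    then have "e \<in> b ` {1..m}"
      using ch(5) by simp
    then obtain k where "k \<in> {1..m}" "e = b k"
      by blast
    with up[of k] e show False by simp
  qed
  obtain k' where k': "k = Suc k'" "k' \<in> {1..m}"
  proof (cases k)
    case (Suc n)
    then have "n \<noteq> 0"
      using min c k by auto
    then show ?thesis using that[of n] k Suc by simp
  qed (use k in auto)
  have acts: "b k' \<in> actions M i" "b k \<in> actions M i"
    using ch(1) k k' by auto
  have neq: "b k' \<noteq> b k"
    using inj_onD[OF ch(2), of k' k] k k' by auto
  have "cost M i l s (b k') \<noteq> cost M i l s (b k)"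
  proof
    assume eq: "cost M i l s (b k') = cost M i l s (b k)"
    then have "cheaper M i l s (b k') = cheaper M i l s (b k)"
      by (simp add: cheaper_def)
    then have "b k' \<in> {a \<in> actions M i. cheaper M i l s a \<noteq> {}}"
        "b k \<in> {a \<in> actions M i. cheaper M i l s a \<noteq> {}}"
      using c k acts by auto
    with untied ia eq neq show False
      unfolding untied_def by (meson inj_onD)
  qed
  moreover have "cost M i l s (b k') \<le> cost M i l s (b k)"
    using ch(4) l k' by auto
  ultimately have less: "cost M i l s (b k') < cost M i l s (b (Suc k'))"
    using k' by simp
  have "fab_shift M h l i s b m Z (i, s, b (Suc k')) = 0"
    by (rule shift_properties(3)[OF h l ia(1,2) gap ch(1,2,4) Z _ _ _ k'(2) less,
          of "max 0 (load M l Z)"])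
      (use pos in \<open>auto simp: Z'_def m_def\<close>)
  then show ?thesis
    using k k' by (simp add: Z'_def m_def)
qed

text \<open>A pass treats each triple of the list at most once, and one shift has at most
  \<open>K\<close> transfers.\<close>

lemma repairs_pass:
  assumes h: "h \<ge> 1" and l: "l \<in> {1..num_constraints M}" and gap: "cost_gap d"
    and K: "\<forall>i\<in>{1..num_gangs M}. card (actions M i) \<le> K" and B: "B \<ge> 0"
    and pass: "fab_pass M h a0 l js Z Z'"
    and "set js \<subseteq> triples M" "\<forall>j\<in>triples M. 0 \<le> Z j" "load M l Z \<le> B"
  shows "repairs (length js * (K * (B / d + 1 / total_size M h))) Z Z'"
  using assms(6-)
proof (induction rule: fab_pass.induct)
  case (satisfied Z js)
  then show ?case
    using gap B by (intro repairs_refl) (auto simp: cost_gap_def)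
next
  case (empty Z j js Z')
  then have "repairs (length js * (K * (B / d + 1 / total_size M h))) Z Z'"
    by simp
  then show ?case
    by (rule repairs_mono) (use gap B in \<open>auto simp: cost_gap_def intro!: mult_right_mono\<close>)
next
  case (cheapest Z i s a js Z')
  then have "repairs (length js * (K * (B / d + 1 / total_size M h))) Z Z'"
    by simp
  then show ?case
    by (rule repairs_mono) (use gap B in \<open>auto simp: cost_gap_def intro!: mult_right_mono\<close>)
next
  case (shift Z i s a b js Z')
  define D where "D = B / d + 1 / real (total_size M h)"
  define m where "m = card (cheaper M i l s a)"
  have D: "D \<ge> 0" using gap B by (simp add: D_def cost_gap_def)
  have ia: "i \<in> {1..num_gangs M}" "s \<in> states M i" "a \<in> actions M i"
    using shift by (auto simp: triples_iff)
  note ch = fab_chain_properties[OF l ia shift(3,4), folded m_def]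
  let ?Z1 = "fab_shift M h l i s b m Z"
  have r1: "repairs (m * D) Z ?Z1"
    unfolding D_def by (rule shift_properties(1)[OF h l ia(1,2) gap ch(1,2,4)])
      (use shift B in auto)
  have "m \<le> card (actions M i)"
    unfolding m_def using ia by (intro card_mono) (auto simp: finite_actions cheaper_def)
  also have "\<dots> \<le> K" using K ia by auto
  finally have "m * D \<le> K * D" using D by (intro mult_right_mono) auto
  with r1 have r1: "repairs (K * D) Z ?Z1" by (rule repairs_mono)
  then have "\<forall>j\<in>triples M. 0 \<le> ?Z1 j" "load M l ?Z1 \<le> B"
    using l shift.prems(3) unfolding repairs_def by fastforce+
  then have "repairs (length js * (K * D)) ?Z1 Z'"
    using shift.IH shift.prems(1) unfolding m_def D_def by auto
  from repairs_trans[OF r1 this] show ?case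
    by (simp add: D_def distrib_right)
next
  case (exhausted Z)
  then show ?case by (intro repairs_refl) auto
qed

end

text \<open>The two hypotheses on costs: one action per state is cheapest for all constraints at
  once, and taking it everywhere satisfies the constraints.\<close>

locale cheapest_feasible_system = gang_system M
  for M :: "('s, 'a) gang_model" +
  fixes best :: "nat \<Rightarrow> 's \<Rightarrow> 'a"
  assumes best_action: "i \<in> {1..num_gangs M} \<Longrightarrow> s \<in> states M i \<Longrightarrow>
          best i s \<in> actions M i \<and>
          (\<forall>l\<in>{1..num_constraints M}. cost M i l s (best i s) = (MIN a\<in>actions M i. cost M i l s a))"
    and best_feasible: "h \<ge> 1 \<Longrightarrow> \<sigma> \<in> state_vectors M h \<Longrightarrow> l \<in> {1..num_constraints M} \<Longrightarrow>
          (\<Sum>i\<in>{1..num_gangs M}. \<Sum>n\<in>{1..h * base_size M i}.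
             cost M i l (\<sigma> (i, n)) (best i (\<sigma> (i, n)))) \<le> 0"
begin

text \<open>If all processes sit at cheapest actions, the load is that of the action
  \<open>best\<close> in the current states.\<close>

lemma load_cheapest_nonpos:
  assumes h: "h \<ge> 1" and l: "l \<in> {1..num_constraints M}"
    and \<sigma>: "\<sigma> \<in> state_vectors M h"
    and rows: "\<forall>i\<in>{1..num_gangs M}. \<forall>s\<in>states M i.
        (\<Sum>a\<in>actions M i. Z (i, s, a)) = Y_prop M h \<sigma> i s"
    and cheapest: "\<And>i s a. (i, s, a) \<in> triples M \<Longrightarrow> cheaper M i l s a \<noteq> {} \<Longrightarrow> Z (i, s, a) = 0"
  shows "load M l Z \<le> 0"
proof -
  have "Z (i, s, a) * cost M i l s a = Z (i, s, a) * cost M i l s (best i s)"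
    if j: "i \<in> {1..num_gangs M}" "s \<in> states M i" "a \<in> actions M i" for i s a
  proof (cases "cheaper M i l s a = {}")
    case True
    have "cost M i l s (best i s) \<le> cost M i l s a"
      using best_action[OF j(1,2)] l j by (auto intro!: Min_le simp: finite_actions)
    moreover have "\<not> cost M i l s (best i s) < cost M i l s a"
      using True best_action[OF j(1,2)] by (auto simp: cheaper_def)
    ultimately show ?thesis by simp
  qed (use cheapest j in \<open>auto simp: triples_iff\<close>)
  then have "load M l Z = (\<Sum>i\<in>{1..num_gangs M}. \<Sum>s\<in>states M i. \<Sum>a\<in>actions M i.
      Z (i, s, a) * cost M i l s (best i s))"
    unfolding load_def sum_triples by (intro sum.cong refl)
  also have "\<dots> = (\<Sum>i\<in>{1..num_gangs M}. \<Sum>s\<in>states M i. Y_prop M h \<sigma> i s * cost M i l s (best i s))"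
    using rows by (simp flip: sum_distrib_right)
  also have "\<dots> = (\<Sum>i\<in>{1..num_gangs M}. (\<Sum>n\<in>{1..h * base_size M i}.
           cost M i l (\<sigma> (i, n)) (best i (\<sigma> (i, n)))) / total_size M h)"
    using sum_processes_Y[OF \<sigma>, symmetric] by simp
  also have "\<dots> \<le> 0"
    using best_feasible[OF h \<sigma> l] total_size_pos[OF h]
    by (simp add: divide_nonpos_pos flip: sum_divide_distrib)
  finally show ?thesis .
qed

text \<open>The induction invariant is the last assumption: triples that were already passed and are
  not cheapest are empty. A later shift in the same state may move processes back to a passed
  triple, but as long as the load stays positive it drains that triple again
  (\<open>shift_drains\<close>). At the end of the list the invariant covers all triples.\<close>

lemma pass_satisfies:
  assumes h: "h \<ge> 1" and l: "l \<in> {1..num_constraints M}" and gap: "cost_gap d"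
    and \<sigma>: "\<sigma> \<in> state_vectors M h"
    and pass: "fab_pass M h a0 l js Z Z'"
    and "set js \<subseteq> triples M" "\<forall>j\<in>triples M. 0 \<le> Z j"
      "\<forall>i\<in>{1..num_gangs M}. \<forall>s\<in>states M i. (\<Sum>a\<in>actions M i. Z (i, s, a)) = Y_prop M h \<sigma> i s"
      "untied l \<Longrightarrow> (\<And>i s a. (i, s, a) \<in> triples M - set js \<Longrightarrow> cheaper M i l s a \<noteq> {} \<Longrightarrow> Z (i, s, a) = 0)"
  shows "load M l Z' \<le> 0"
  using pass assms(6-)
proof (induction rule: fab_pass.induct)
  case (satisfied Z js)
  show ?case by (fact satisfied.hyps)
next
  case (empty Z j js Z')
  show ?case
  proof (rule empty.IH)
    fix i s a assume *: "untied l" "(i, s, a) \<in> triples M - set js" "cheaper M i l s a \<noteq> {}"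
    show "Z (i, s, a) = 0"
    proof (cases "(i, s, a) = j")
      case True
      then show ?thesis using empty * by force
    qed (use empty.prems(4)[OF *(1) _ *(3)] * in auto)
  qed (use empty.prems in auto)
next
  case (cheapest Z i s a js Z')
  show ?case
  proof (rule cheapest.IH)
    fix i' s' a' assume *: "untied l" "(i', s', a') \<in> triples M - set js" "cheaper M i' l s' a' \<noteq> {}"
    then show "Z (i', s', a') = 0"
      using cheapest.prems(4)[OF *(1) _ *(3)] cheapest.hyps by auto
  qed (use cheapest.prems in auto)
next
  case (shift Z i s a b js Z')
  have ia: "i \<in> {1..num_gangs M}" "s \<in> states M i" "a \<in> actions M i"
    using shift by (auto simp: triples_iff)
  define m where "m = card (cheaper M i l s a)"
  note ch = fab_chain_properties[OF l ia shift(3,4), folded m_def]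
  let ?Z1 = "fab_shift M h l i s b (card (cheaper M i l s a)) Z"
  have "\<exists>D. repairs D Z ?Z1"
    using shift_properties(1)[OF h l ia(1,2) gap ch(1,2,4) shift.prems(2), of "load M l Z"] shift.hyps(1)
    unfolding m_def by auto
  then obtain D where r: "repairs D Z ?Z1" ..
  show ?case
  proof (cases "load M l ?Z1 \<le> 0")
    case True
    with shift.hyps(5) have "Z' = ?Z1"
      by cases auto
    with True show ?thesis by simp
  next
    case False
    show ?thesis
    proof (rule shift.IH)
      fix i' s' c assume *: "untied l" "(i', s', c) \<in> triples M - set js" "cheaper M i' l s' c \<noteq> {}"
      show "?Z1 (i', s', c) = 0"
      proof (cases "i' = i \<and> s' = s \<and> c \<in> insert a (cheaper M i l s a)")
        case True
        then show ?thesis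
          using shift_drains[OF h l gap ia shift.hyps(3,4) shift.prems(2) *(1)] False * by auto
      next
        case out: False
        have "{1..Suc m} = insert (Suc m) {1..m}" by auto
        then have "b ` {1..Suc m} = insert a (cheaper M i l s a)"
          using ch(3,5) by simp
        then have "(i', s', c) \<notin> (\<lambda>k. (i, s, b k)) ` {1..Suc m}"
          using out by blast
        then have "?Z1 (i', s', c) = Z (i', s', c)"
          using shift_properties(2)[OF h l ia(1,2) gap ch(1,2,4) shift.prems(2) order.refl]
            shift.hyps(1) unfolding m_def by simp
        moreover have "(i', s', c) \<noteq> (i, s, a)"
          using out by auto
        ultimately show ?thesis
          using shift.prems(4)[OF *(1) _ *(3)] * by auto
      qed
    qed (use shift.prems r in \<open>auto simp: repairs_def\<close>)
  qed
next
  case (exhausted Z)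
  then have untied: "untied l" by (simp add: untied_def)
  show ?case
  proof (rule load_cheapest_nonpos[OF h l \<sigma> exhausted.prems(3)])
    fix i s a assume "(i, s, a) \<in> triples M" "cheaper M i l s a \<noteq> {}"
    then show "Z (i, s, a) = 0"
      using exhausted.prems(4)[OF untied, of i s a] by simp
  qed
qed

text \<open>The bound \<open>B\<close> on the loads remains valid for all later passes, and a
  constraint that was satisfied by its pass remains satisfied, because loads do not
  increase.\<close>

lemma passes_properties:
  assumes h: "h \<ge> 1" and gap: "cost_gap d"
    and K: "\<forall>i\<in>{1..num_gangs M}. card (actions M i) \<le> K" and B: "B \<ge> 0"
    and \<sigma>: "\<sigma> \<in> state_vectors M h" and js: "set js = triples M"
  shows "fab_passes M h a0 js ls Z Z' \<Longrightarrow> set ls \<subseteq> {1..num_constraints M} \<Longrightarrow>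
      \<forall>j\<in>triples M. 0 \<le> Z j \<Longrightarrow>
      \<forall>i\<in>{1..num_gangs M}. \<forall>s\<in>states M i. (\<Sum>a\<in>actions M i. Z (i, s, a)) = Y_prop M h \<sigma> i s \<Longrightarrow>
      \<forall>l\<in>{1..num_constraints M}. load M l Z \<le> B \<Longrightarrow>
      repairs (length ls * (length js * (K * (B / d + 1 / total_size M h)))) Z Z' \<and>
      (\<forall>l\<in>set ls. load M l Z' \<le> 0)"
proof (induction ls arbitrary: Z)
  case Nil
  then show ?case by (simp add: repairs_refl)
next
  case (Cons l ls)
  let ?D = "length js * (K * (B / d + 1 / real (total_size M h)))"
  from Cons.prems obtain Z1 where
    p: "fab_pass M h a0 l js Z Z1" and ps: "fab_passes M h a0 js ls Z1 Z'" by auto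
  have l: "l \<in> {1..num_constraints M}" using Cons.prems by simp
  have r: "repairs ?D Z Z1"
    by (rule repairs_pass[OF h l gap K B p equalityD1[OF js] Cons.prems(3)])
      (use Cons.prems(5) l in blast)
  have l0: "load M l Z1 \<le> 0"
  proof (rule pass_satisfies[OF h l gap \<sigma> p _ Cons.prems(3,4)])
    show "set js \<subseteq> triples M"
      by (rule equalityD1[OF js])
    show "Z (i, s, a) = 0" if "(i, s, a) \<in> triples M - set js" for i s a
      using that js by simp
  qed
  have le: "load M l' Z1 \<le> load M l' Z" if "l' \<in> {1..num_constraints M}" for l'
    using r that by (simp add: repairs_def)
  have IH: "repairs (length ls * ?D) Z1 Z' \<and> (\<forall>l\<in>set ls. load M l Z' \<le> 0)"
  proof (rule Cons.IH[OF ps])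
    show "\<forall>l\<in>{1..num_constraints M}. load M l Z1 \<le> B"
      using Cons.prems(5) le order.trans by blast
    show "\<forall>j\<in>triples M. 0 \<le> Z1 j"
      using r by (simp add: repairs_def)
    show "\<forall>i\<in>{1..num_gangs M}. \<forall>s\<in>states M i. (\<Sum>a\<in>actions M i. Z1 (i, s, a)) = Y_prop M h \<sigma> i s"
      using r Cons.prems(4) by (simp add: repairs_def)
    show "set ls \<subseteq> {1..num_constraints M}"
      using Cons.prems(2) by simp
  qed
  then have "load M l Z' \<le> load M l Z1"
    using l by (simp add: repairs_def)
  with l0 have "load M l Z' \<le> 0" by simp
  moreover have "repairs (?D + length ls * ?D) Z Z'"
    using repairs_trans[OF r] IH by blast
  moreover have "?D + length ls * ?D = length (l # ls) * ?D"
    by (simp only: length_Cons of_nat_Suc distrib_right mult_1_left add.commute)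
  ultimately show ?case
    using IH by simp
qed

end

section \<open>Staying close to the fluid solution\<close>

context gang_system
begin

text \<open>The linear program measures proportions within a gang, \<open>Z\<close> measures them
  within the whole system. The factor converts the former to the latter.\<close>

definition fluid :: "(nat \<Rightarrow> ('s, 'a) triple \<Rightarrow> real) \<Rightarrow> nat \<Rightarrow> ('s, 'a) triple \<Rightarrow> real" where
  "fluid x t = (\<lambda>(i, s, a). real (base_size M i) / real (total_base_size M) * x t (i, s, a))"

definition fluid_Y :: "(nat \<Rightarrow> ('s, 'a) triple \<Rightarrow> real) \<Rightarrow> nat \<Rightarrow> nat \<Rightarrow> 's \<Rightarrow> real" where
  "fluid_Y x t i s = (\<Sum>a\<in>actions M i. fluid x t (i, s, a))"

text \<open>The last part says that acting with the probabilities \<open>lp_alpha\<close> splits the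
  fluid state proportions into the fluid solution. If the denominator of \<open>lp_alpha\<close>
  vanishes, both sides are 0.\<close>

lemma lp_alpha_properties:
  assumes "lp_feasible M y0 x" "t \<in> {0..horizon M}" "i \<in> {1..num_gangs M}" "s \<in> states M i"
  shows "a \<in> actions M i \<Longrightarrow> 0 \<le> lp_alpha M x t (i, s, a)"
    and "(\<Sum>a\<in>actions M i. lp_alpha M x t (i, s, a)) = 1"
    and "a \<in> actions M i \<Longrightarrow> lp_alpha M x t (i, s, a) \<le> 1"
    and "a \<in> actions M i \<Longrightarrow> lp_alpha M x t (i, s, a) * fluid_Y x t i s = fluid x t (i, s, a)"
proof -
  have x: "0 \<le> x t (i, s, a)" if "a \<in> actions M i" for a
    using assms that by (auto simp: lp_feasible_def triples_iff)
  let ?d = "\<Sum>a\<in>actions M i. x t (i, s, a)"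
  have fin: "finite (actions M i)" and ne: "actions M i \<noteq> {}"
    using assms by (auto simp: finite_actions actions_nonempty)
  show pos: "0 \<le> lp_alpha M x t (i, s, a)" if "a \<in> actions M i" for a
    using x that by (auto simp: Let_def)
  show one: "(\<Sum>a\<in>actions M i. lp_alpha M x t (i, s, a)) = 1"
    using fin ne by (cases "?d > 0") (auto simp: Let_def simp flip: sum_divide_distrib)
  show "lp_alpha M x t (i, s, a) \<le> 1" if "a \<in> actions M i"
    unfolding one[symmetric] by (rule member_le_sum) (use that pos fin in auto)
  show "lp_alpha M x t (i, s, a) * fluid_Y x t i s = fluid x t (i, s, a)" if a: "a \<in> actions M i"
  proof (cases "?d > 0")
    case True
    then show ?thesis
      by (simp add: Let_def fluid_def fluid_Y_def flip: sum_distrib_left sum_divide_distrib)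
  next
    case False
    then have "?d = 0"
      using x sum_nonneg[of "actions M i" "\<lambda>a. x t (i, s, a)"] by force
    then have "x t (i, s, a) = 0" if "a \<in> actions M i" for a
      using that x fin by (simp add: sum_nonneg_eq_0_iff)
    with a show ?thesis
      by (simp add: fluid_def fluid_Y_def)
  qed
qed

lemma load_fluid_nonpos:
  assumes "lp_feasible M y0 x" "t \<in> {0..horizon M}" "l \<in> {1..num_constraints M}"
  shows "load M l (fluid x t) \<le> 0"
proof -
  have "load M l (fluid x t) =
    (\<Sum>(i, s, a)\<in>triples M. real (base_size M i) * x t (i, s, a) * cost M i l s a) / total_base_size M"
    unfolding load_def fluid_def sum_divide_distrib by (intro sum.cong) auto
  also have "\<dots> \<le> 0"
    using assms by (intro divide_nonpos_nonneg) (auto simp: lp_feasible_def)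
  finally show ?thesis .
qed

lemma Y_prop_nonneg: "Y_prop M h \<sigma> i s \<ge> 0"
  by (simp add: Y_prop_def)

text \<open>Rounding loses less than \<open>1 / N\<close> per action, and all that is lost in a
  state is given to the action \<open>a0 i s\<close>.\<close>

lemma fab_init_properties:
  assumes x: "lp_feasible M y0 x" and t: "t \<in> {0..horizon M}" and h: "h \<ge> 1"
    and i: "i \<in> {1..num_gangs M}" "s \<in> states M i"
    and a0: "a0 i s \<in> actions M i"
  shows "(\<Sum>a\<in>actions M i. fab_init M x h t \<sigma> a0 (i, s, a)) = Y_prop M h \<sigma> i s"
    and "a \<in> actions M i \<Longrightarrow> 0 \<le> fab_init M x h t \<sigma> a0 (i, s, a)"
    and "a \<in> actions M i \<Longrightarrow>
      \<bar>fab_init M x h t \<sigma> a0 (i, s, a) - lp_alpha M x t (i, s, a) * Y_prop M h \<sigma> i s\<bar>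
        \<le> card (actions M i) / total_size M h"
proof -
  define N where "N = real (total_size M h)"
  have N: "N > 0" using total_size_pos[OF h] by (simp add: N_def)
  define \<alpha> where "\<alpha> a = lp_alpha M x t (i, s, a)" for a
  define Y where "Y = Y_prop M h \<sigma> i s"
  define F where "F a = fab_floor M x h t \<sigma> (i, s, a)" for a
  let ?A = "actions M i" and ?b = "a0 i s"
  have fin: "finite ?A" using i by (simp add: finite_actions)
  have F: "F a = of_int \<lfloor>\<alpha> a * Y * N\<rfloor> / N" for a
    by (simp add: F_def \<alpha>_def Y_def N_def)
  have Fle: "F a \<le> \<alpha> a * Y" for a
    unfolding F using N by (simp add: divide_le_eq)
  have Fge: "\<alpha> a * Y - 1 / N \<le> F a" for a
  proof -
    have "(\<alpha> a * Y * N - 1) / N \<le> F a"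
      unfolding F using N by (intro divide_right_mono) linarith+
    then show ?thesis using N by (simp add: diff_divide_distrib)
  qed
  have \<alpha>: "\<alpha> a \<ge> 0" if "a \<in> ?A" for a
    unfolding \<alpha>_def by (rule lp_alpha_properties(1)[OF x t i that])
  have Y: "Y \<ge> 0" by (simp add: Y_def Y_prop_nonneg)
  have F0: "F a \<ge> 0" if "a \<in> ?A" for a
    unfolding F using N Y \<alpha>[OF that] by simp
  have one: "sum \<alpha> ?A = 1"
    unfolding \<alpha>_def by (rule lp_alpha_properties(2)[OF x t i])
  have init: "fab_init M x h t \<sigma> a0 (i, s, a) = (if a = ?b then Y - sum F (?A - {?b}) else F a)" for a
    by (simp add: F_def Y_def del: fab_floor.simps)
  show "(\<Sum>a\<in>?A. fab_init M x h t \<sigma> a0 (i, s, a)) = Y_prop M h \<sigma> i s"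
    unfolding init Y_def[symmetric] by (subst sum.remove[OF fin a0]) simp
  have split: "Y = \<alpha> ?b * Y + (\<Sum>a\<in>?A - {?b}. \<alpha> a * Y)"
    using one sum.remove[OF fin a0, of \<alpha>] by (simp flip: sum_distrib_right distrib_right)
  have diff: "Y - sum F (?A - {?b}) = \<alpha> ?b * Y + (\<Sum>a\<in>?A - {?b}. \<alpha> a * Y - F a)"
    by (subst split) (simp add: sum_subtractf)
  have low: "(\<Sum>a\<in>?A - {?b}. \<alpha> a * Y - F a) \<ge> 0"
    using Fle by (intro sum_nonneg) simp
  have "(\<Sum>a\<in>?A - {?b}. \<alpha> a * Y - F a) \<le> (\<Sum>a\<in>?A - {?b}. 1 / N)"
    using Fge by (intro sum_mono) (simp add: algebra_simps)
  also have "\<dots> \<le> (\<Sum>a\<in>?A. 1 / N)"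
    using N fin by (intro sum_mono2) auto
  finally have up: "(\<Sum>a\<in>?A - {?b}. \<alpha> a * Y - F a) \<le> card ?A / N" by simp
  {
    fix a assume a: "a \<in> ?A"
    show "0 \<le> fab_init M x h t \<sigma> a0 (i, s, a)"
      unfolding init using F0[OF a] low mult_nonneg_nonneg[OF \<alpha>[OF a] Y] by (auto simp: diff)
    have "card ?A \<ge> 1"
      using a fin by (simp add: Suc_le_eq card_gt_0_iff) blast
    then have "1 / N \<le> card ?A / N"
      using N by (intro divide_right_mono) auto
    then show "\<bar>fab_init M x h t \<sigma> a0 (i, s, a) - lp_alpha M x t (i, s, a) * Y_prop M h \<sigma> i s\<bar>
        \<le> card (actions M i) / total_size M h"
      unfolding init Y_def[symmetric] \<alpha>_def[symmetric] N_def[symmetric]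
      using Fge[of a] Fle[of a] low up by (auto simp: diff)
  }
qed

end

context cheapest_feasible_system
begin

text \<open>The two facts about one run of the FAB procedure that the later parts use; the constant
  depends neither on the size of the system, nor on time or state vector.\<close>

lemma fab_result_properties:
  assumes x: "lp_feasible M y0 x"
  obtains C where "C > 0"
    and "\<And>h t \<sigma> Z l. h \<ge> 1 \<Longrightarrow> t \<in> {0..horizon M} \<Longrightarrow> \<sigma> \<in> state_vectors M h \<Longrightarrow>
      fab_result M x h t \<sigma> Z \<Longrightarrow> l \<in> {1..num_constraints M} \<Longrightarrow> load M l Z \<le> 0"
    and "\<And>h t \<sigma> Z \<eta> j. h \<ge> 1 \<Longrightarrow> t \<in> {0..horizon M} \<Longrightarrow> \<sigma> \<in> state_vectors M h \<Longrightarrow>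
      fab_result M x h t \<sigma> Z \<Longrightarrow> \<eta> \<ge> 0 \<Longrightarrow>
      (\<forall>i\<in>{1..num_gangs M}. \<forall>s\<in>states M i. \<bar>Y_prop M h \<sigma> i s - fluid_Y x t i s\<bar> \<le> \<eta>) \<Longrightarrow>
      j \<in> triples M \<Longrightarrow> \<bar>Z j - fluid x t j\<bar> \<le> C * (\<eta> + 1 / total_size M h)"
proof -
  obtain d where gap: "cost_gap d" using cost_gap_exists ..
  then have d: "d > 0" by (simp add: cost_gap_def)
  \<comment> \<open>A common bound for the numbers of actions; the successor makes it at least 1.\<close>
  define K where "K = Suc (\<Sum>i\<in>{1..num_gangs M}. card (actions M i))"
  have K: "\<forall>i\<in>{1..num_gangs M}. card (actions M i) \<le> K"
    unfolding K_def by (auto intro!: le_SucI member_le_sum)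
  have K1: "real K \<ge> 1" unfolding K_def by linarith
  \<comment> \<open>By this factor a load changes at most if all entries change by at most 1.\<close>
  define W where "W = (\<Sum>l\<in>{1..num_constraints M}. \<Sum>(i, s, a)\<in>triples M. \<bar>cost M i l s a\<bar>)"
  have W0: "W \<ge> 0" unfolding W_def by (auto intro!: sum_nonneg)
  have W: "(\<Sum>(i, s, a)\<in>triples M. \<bar>cost M i l s a\<bar>) \<le> W" if "l \<in> {1..num_constraints M}" for l
    unfolding W_def using that by (intro member_le_sum) (auto intro!: sum_nonneg)
  \<comment> \<open>\<open>R\<close> bounds the number of transfers in one run.\<close>
  define R where "R = real (num_constraints M) * (real (card (triples M)) * real K)"
  have R: "R \<ge> 0" by (simp add: R_def)
  \<comment> \<open>The summand 1 comes from rounding, the other one from the transfers.\<close>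
  define C where "C = real K * (1 + R * (W / d + 1))"
  have C: "C > 0"
    unfolding C_def using K1 R W0 d by (intro mult_pos_pos add_pos_nonneg) auto
  have main: "(\<forall>l\<in>{1..num_constraints M}. load M l Z \<le> 0) \<and>
      (\<forall>j\<in>triples M. \<bar>Z j - fluid x t j\<bar> \<le> C * (\<eta> + 1 / total_size M h))"
    if h: "h \<ge> 1" and t: "t \<in> {0..horizon M}" and \<sigma>: "\<sigma> \<in> state_vectors M h"
      and res: "fab_result M x h t \<sigma> Z" and \<eta>: "\<eta> \<ge> 0"
      and near: "\<forall>i\<in>{1..num_gangs M}. \<forall>s\<in>states M i. \<bar>Y_prop M h \<sigma> i s - fluid_Y x t i s\<bar> \<le> \<eta>"
    for h t \<sigma> Z \<eta>
  proof -
    define N where "N = real (total_size M h)"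
    have N: "N > 0" using total_size_pos[OF h] by (simp add: N_def)
    \<comment> \<open>\<open>\<rho>\<close> bounds the distance of the rounded allocation from the fluid solution.\<close>
    define \<rho> where "\<rho> = K * (\<eta> + 1 / N)"
    have \<rho>0: "\<rho> \<ge> 0" using N \<eta> by (simp add: \<rho>_def)
    have "1 * (\<eta> + 1 / N) \<le> \<rho>"
      unfolding \<rho>_def using K1 N \<eta> by (intro mult_right_mono) auto
    then have N\<rho>: "1 / N \<le> \<rho>" using \<eta> by simp
    obtain a0 js where a0: "\<forall>i\<in>{1..num_gangs M}. \<forall>s\<in>states M i. a0 i s \<in> actions M i"
      and js: "distinct js" "set js = triples M"
      and passes: "fab_passes M h a0 js [1..<num_constraints M + 1] (fab_init M x h t \<sigma> a0) Z"
      using res unfolding fab_result_def by blast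
    let ?Z0 = "fab_init M x h t \<sigma> a0"
    have len: "length js = card (triples M)" "length [1..<num_constraints M + 1] = num_constraints M"
      using distinct_card[OF js(1)] js(2) by auto
    have near0: "\<bar>?Z0 j - fluid x t j\<bar> \<le> \<rho>" if j: "j \<in> triples M" for j
    proof -
      obtain i s a where [simp]: "j = (i, s, a)" by (cases j)
      have i: "i \<in> {1..num_gangs M}" "s \<in> states M i" "a \<in> actions M i"
        using j by (simp_all add: triples_iff)
      let ?\<alpha> = "lp_alpha M x t (i, s, a)"
      have \<alpha>: "0 \<le> ?\<alpha>" "?\<alpha> \<le> 1"
        using lp_alpha_properties(1,3)[OF x t i(1,2,3)] .
      have "\<bar>?Z0 j - ?\<alpha> * Y_prop M h \<sigma> i s\<bar> \<le> card (actions M i) / N"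
        using fab_init_properties(3)[OF x t h i(1,2) _ i(3)] a0 i by (simp add: N_def)
      also have "\<dots> \<le> K / N"
        using K i N by (intro divide_right_mono) auto
      finally have 1: "\<bar>?Z0 j - ?\<alpha> * Y_prop M h \<sigma> i s\<bar> \<le> K / N" .
      have "\<bar>?\<alpha> * Y_prop M h \<sigma> i s - fluid x t j\<bar> = ?\<alpha> * \<bar>Y_prop M h \<sigma> i s - fluid_Y x t i s\<bar>"
        unfolding \<open>j = _\<close> lp_alpha_properties(4)[OF x t i, symmetric] right_diff_distrib[symmetric] abs_mult
        using \<alpha> by simp
      also have "\<dots> \<le> 1 * \<eta>"
        using \<alpha> near i by (intro mult_mono) auto
      also have "\<dots> \<le> K * \<eta>"
        using K1 \<eta> by (intro mult_right_mono) auto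
      finally show ?thesis
        using 1 unfolding \<rho>_def distrib_left by simp
    qed
    have load0: "load M l ?Z0 \<le> \<rho> * W" if l: "l \<in> {1..num_constraints M}" for l
    proof -
      have "load M l ?Z0 \<le> load M l (fluid x t) + \<rho> * (\<Sum>(i, s, a)\<in>triples M. \<bar>cost M i l s a\<bar>)"
        by (rule load_diff_le) (rule near0)
      also have "\<rho> * (\<Sum>(i, s, a)\<in>triples M. \<bar>cost M i l s a\<bar>) \<le> \<rho> * W"
        by (rule mult_left_mono[OF W[OF l] \<rho>0])
      finally show ?thesis
        using load_fluid_nonpos[OF x t l] by simp
    qed
    have "repairs (length [1..<num_constraints M + 1] * (length js * (K * (\<rho> * W / d + 1 / total_size M h)))) ?Z0 Z
      \<and> (\<forall>l\<in>set [1..<num_constraints M + 1]. load M l Z \<le> 0)"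
    proof (rule passes_properties[OF h gap K _ \<sigma> js(2) passes])
      show "0 \<le> \<rho> * W" using \<rho>0 W0 by simp
      show "\<forall>j\<in>triples M. 0 \<le> ?Z0 j"
        using fab_init_properties(2)[OF x t h] a0 by (auto simp: triples_def simp del: fab_init.simps)
      show "\<forall>i\<in>{1..num_gangs M}. \<forall>s\<in>states M i. (\<Sum>a\<in>actions M i. ?Z0 (i, s, a)) = Y_prop M h \<sigma> i s"
        using fab_init_properties(1)[OF x t h] a0 by blast
      show "\<forall>l\<in>{1..num_constraints M}. load M l ?Z0 \<le> \<rho> * W"
        using load0 by blast
    qed auto
    then have rep: "repairs (R * (\<rho> * W / d + 1 / N)) ?Z0 Z"
      and sat: "\<forall>l\<in>{1..num_constraints M}. load M l Z \<le> 0"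
      unfolding len R_def N_def by (auto simp: mult.assoc)
    have "\<bar>Z j - fluid x t j\<bar> \<le> C * (\<eta> + 1 / N)" if j: "j \<in> triples M" for j
    proof -
      have "\<bar>Z j - ?Z0 j\<bar> \<le> R * (\<rho> * W / d + 1 / N)"
        using rep j by (simp add: repairs_def)
      also have "\<dots> \<le> R * (\<rho> * W / d + \<rho>)"
        using R N\<rho> by (intro mult_left_mono add_mono) auto
      finally have "\<bar>Z j - fluid x t j\<bar> \<le> R * (\<rho> * W / d + \<rho>) + \<rho>"
        using near0[OF j] by linarith
      also have "\<dots> = C * (\<eta> + 1 / N)"
        unfolding C_def \<rho>_def by (simp add: algebra_simps)
      finally show ?thesis .
    qed
    with sat show ?thesis
      unfolding N_def by blast
  qed
  show ?thesis
  proof (rule that[OF C])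
    fix h t \<sigma> Z l
    assume *: "h \<ge> 1" "t \<in> {0..horizon M}" "\<sigma> \<in> state_vectors M h" "fab_result M x h t \<sigma> Z"
      "l \<in> {1..num_constraints M}"
    \<comment> \<open>Any bound of the deviation will do here, since the conclusion on the load does not mention it.\<close>
    let ?e = "\<lambda>i s. \<bar>Y_prop M h \<sigma> i s - fluid_Y x t i s\<bar>"
    let ?\<eta> = "\<Sum>i\<in>{1..num_gangs M}. \<Sum>s\<in>states M i. ?e i s"
    have "?e i s \<le> ?\<eta>" if "i \<in> {1..num_gangs M}" "s \<in> states M i" for i s
    proof -
      have "?e i s \<le> (\<Sum>s\<in>states M i. ?e i s)"
        using that by (intro member_le_sum) (auto simp: finite_states)
      also have "\<dots> \<le> ?\<eta>"
        using that by (intro member_le_sum) (auto intro!: sum_nonneg)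
      finally show ?thesis .
    qed
    moreover have "?\<eta> \<ge> 0"
      by (intro sum_nonneg) auto
    ultimately show "load M l Z \<le> 0"
      using main[OF *(1-4), of ?\<eta>] *(5) by blast
  next
    fix h t \<sigma> Z \<eta> j
    assume "h \<ge> 1" "t \<in> {0..horizon M}" "\<sigma> \<in> state_vectors M h" "fab_result M x h t \<sigma> Z" "\<eta> \<ge> 0"
      "\<forall>i\<in>{1..num_gangs M}. \<forall>s\<in>states M i. \<bar>Y_prop M h \<sigma> i s - fluid_Y x t i s\<bar> \<le> \<eta>"
      "j \<in> triples M"
    then show "\<bar>Z j - fluid x t j\<bar> \<le> C * (\<eta> + 1 / total_size M h)"
      using main by blast
  qed
qed

end

section \<open>Marginal laws\<close>

text \<open>Finite supports make all integrability conditions trivial.\<close>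

lemma expectation_bind_finite:
  fixes g :: "'b \<Rightarrow> real"
  assumes "finite (set_pmf p)" "\<And>x. x \<in> set_pmf p \<Longrightarrow> finite (set_pmf (f x))"
  shows "measure_pmf.expectation (bind_pmf p f) g
    = measure_pmf.expectation p (\<lambda>x. measure_pmf.expectation (f x) g)"
proof -
  have "measure_pmf.expectation (bind_pmf p f) g
      = (\<Sum>a\<in>set_pmf p. pmf p a *\<^sub>R measure_pmf.expectation (f a) g)"
    by (rule pmf_expectation_bind) (use assms in auto)
  also have "\<dots> = measure_pmf.expectation p (\<lambda>x. measure_pmf.expectation (f x) g)"
    by (rule integral_measure_pmf[symmetric]) (use assms in auto)
  finally show ?thesis .
qed

text \<open>Conditioning on the first stage: outside \<open>B\<close> the second stage hits
  \<open>A\<close> with probability at most \<open>c\<close>.\<close>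

lemma prob_bind_le:
  assumes "finite (set_pmf p)" "c \<ge> 0"
    and "\<And>x. x \<in> set_pmf p \<Longrightarrow> x \<notin> B \<Longrightarrow> measure_pmf.prob (f x) A \<le> c"
  shows "measure_pmf.prob (bind_pmf p f) A \<le> measure_pmf.prob p B + c"
proof -
  have int: "integrable (measure_pmf p) g" for g :: "'a \<Rightarrow> real"
    using assms(1) by (rule integrable_measure_pmf_finite)
  have "measure_pmf.prob (bind_pmf p f) A = measure_pmf.expectation p (\<lambda>x. measure_pmf.prob (f x) A)"
    using measurable_measure_pmf[of f] unfolding measure_pmf_bind
    by (intro measure_pmf.measure_bind[where N = "count_space UNIV"]) auto
  also have "\<dots> \<le> measure_pmf.expectation p (\<lambda>x. indicator B x + c)"
  proof (rule integral_mono_AE[OF int int], rule AE_pmfI)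
    fix x assume "x \<in> set_pmf p"
    then show "measure_pmf.prob (f x) A \<le> indicator B x + c"
      using assms(2,3) measure_pmf.prob_le_1[of "f x" A]
      by (cases "x \<in> B") (auto simp del: measure_pmf.prob_le_1 intro: order.trans)
  qed
  also have "\<dots> = measure_pmf.prob p B + c"
    by (subst Bochner_Integration.integral_add[OF int int]) simp
  finally show ?thesis .
qed

lemma set_Pi_pmf_undefined:
  assumes "finite A" "\<And>x. x \<in> A \<Longrightarrow> set_pmf (p x) \<subseteq> B x"
  shows "set_pmf (Pi_pmf A undefined p) \<subseteq> Pi\<^sub>E A B"
  using assms by (auto simp: set_Pi_pmf PiE_dflt_def PiE_iff extensional_def)

lemma expectation_of_bool_Pi_pmf:
  assumes "finite A" "k \<in> A"
  shows "measure_pmf.expectation (Pi_pmf A dflt q) (\<lambda>f. of_bool (f k = v) :: real) = pmf (q k) v"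
proof -
  have "measure_pmf.expectation (Pi_pmf A dflt q) (\<lambda>f. of_bool (f k = v) :: real)
     = measure_pmf.expectation (map_pmf (\<lambda>f. f k) (Pi_pmf A dflt q)) (indicator {v})"
    unfolding integral_map_pmf by (rule Bochner_Integration.integral_cong) (auto simp: indicator_def)
  also have "\<dots> = pmf (q k) v"
    using assms by (simp add: Pi_pmf_component measure_pmf_single)
  finally show ?thesis .
qed

lemma length_path_law: "\<omega> \<in> set_pmf (path_law M h \<pi> \<sigma>0 t) \<Longrightarrow> length \<omega> = Suc t"
  by (induction t arbitrary: \<omega>) auto

context gang_system
begin

text \<open>Gains and constraints involve one time at a time, and deviations are collected by a
  union bound over times, so the marginal laws of a path suffice. They satisfy a recursion over
  states alone.\<close>

primrec state_law :: "nat \<Rightarrow> ('s, 'a) rand_policy \<Rightarrow> 's vec \<Rightarrow> nat \<Rightarrow> 's vec pmf" where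
  "state_law h \<pi> \<sigma>0 0 = return_pmf \<sigma>0"
| "state_law h \<pi> \<sigma>0 (Suc t) =
     bind_pmf (state_law h \<pi> \<sigma>0 t) (\<lambda>\<sigma>. bind_pmf (\<pi> t \<sigma>) (next_states M h \<sigma>))"

definition law :: "nat \<Rightarrow> ('s, 'a) rand_policy \<Rightarrow> 's vec \<Rightarrow> nat \<Rightarrow> ('s vec \<times> 'a vec) pmf" where
  "law h \<pi> \<sigma>0 t = bind_pmf (state_law h \<pi> \<sigma>0 t) (\<lambda>\<sigma>. map_pmf (Pair \<sigma>) (\<pi> t \<sigma>))"

lemma state_law_Suc_eq:
  "state_law h \<pi> \<sigma>0 (Suc t) = bind_pmf (law h \<pi> \<sigma>0 t) (\<lambda>p. next_states M h (fst p) (snd p))"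
  by (simp add: law_def bind_assoc_pmf bind_map_pmf)

lemma law_deterministic:
  "law h (deterministic \<phi>) \<sigma> t = map_pmf (\<lambda>\<sigma>. (\<sigma>, \<phi> t \<sigma>)) (state_law h (deterministic \<phi>) \<sigma> t)"
  by (simp add: law_def deterministic_def map_pmf_def bind_return_pmf)

lemma map_fst_law: "map_pmf fst (law h \<pi> \<sigma>0 t) = state_law h \<pi> \<sigma>0 t"
  by (simp add: law_def map_bind_pmf map_pmf_comp bind_return_pmf' map_pmf_const)

lemma map_last_path_law: "map_pmf last (path_law M h \<pi> \<sigma>0 t) = law h \<pi> \<sigma>0 t"
proof (induction t)
  case 0
  show ?case by (simp add: law_def map_pmf_comp bind_return_pmf)
next
  case (Suc t)
  have "law h \<pi> \<sigma>0 (Suc t) = bind_pmf (map_pmf last (path_law M h \<pi> \<sigma>0 t)) (\<lambda>p.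
      bind_pmf (next_states M h (fst p) (snd p)) (\<lambda>\<sigma>. map_pmf (Pair \<sigma>) (\<pi> (Suc t) \<sigma>)))"
    unfolding Suc.IH by (simp add: law_def state_law_Suc_eq bind_assoc_pmf bind_map_pmf)
  then show ?case
    by (simp add: map_bind_pmf map_pmf_comp bind_map_pmf)
qed

text \<open>The entry at position \<open>t\<close> is final once the path has reached time
  \<open>t\<close>.\<close>

lemma map_nth_path_law:
  "t \<le> T \<Longrightarrow> map_pmf (\<lambda>\<omega>. \<omega> ! t) (path_law M h \<pi> \<sigma>0 T) = law h \<pi> \<sigma>0 t"
proof (induction T)
  case 0
  then show ?case
    by (simp add: law_def map_pmf_comp bind_return_pmf)
next
  case (Suc T)
  show ?case
  proof (cases "t = Suc T")
    case True
    have "map_pmf (\<lambda>\<omega>. \<omega> ! t) (path_law M h \<pi> \<sigma>0 (Suc T)) = map_pmf last (path_law M h \<pi> \<sigma>0 (Suc T))"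
    proof (rule map_pmf_cong[OF refl])
      fix \<omega> assume "\<omega> \<in> set_pmf (path_law M h \<pi> \<sigma>0 (Suc T))"
      then have "length \<omega> = Suc (Suc T)" by (rule length_path_law)
      then show "\<omega> ! t = last \<omega>"
        using True by (subst last_conv_nth) auto
    qed
    then show ?thesis using True by (simp only: map_last_path_law)
  next
    case False
    with Suc have "t \<le> T" by simp
    have "map_pmf (\<lambda>\<omega>. \<omega> ! t) (path_law M h \<pi> \<sigma>0 (Suc T))
      = bind_pmf (path_law M h \<pi> \<sigma>0 T) (\<lambda>\<omega>.
     bind_pmf (next_states M h (fst (last \<omega>)) (snd (last \<omega>))) (\<lambda>\<sigma>.
     map_pmf (\<lambda>\<alpha>. (\<omega> @ [(\<sigma>, \<alpha>)]) ! t) (\<pi> (Suc T) \<sigma>)))"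
      by (simp add: map_bind_pmf map_pmf_comp)
    also have "\<dots> = bind_pmf (path_law M h \<pi> \<sigma>0 T) (\<lambda>\<omega>. return_pmf (\<omega> ! t))"
    proof (rule bind_pmf_cong[OF refl])
      fix \<omega> assume "\<omega> \<in> set_pmf (path_law M h \<pi> \<sigma>0 T)"
      then have "length \<omega> = Suc T" by (rule length_path_law)
      then show "bind_pmf (next_states M h (fst (last \<omega>)) (snd (last \<omega>))) (\<lambda>\<sigma>.
         map_pmf (\<lambda>\<alpha>. (\<omega> @ [(\<sigma>, \<alpha>)]) ! t) (\<pi> (Suc T) \<sigma>)) = return_pmf (\<omega> ! t)"
        using \<open>t \<le> T\<close> by (simp add: nth_append map_pmf_const)
    qed
    also have "\<dots> = law h \<pi> \<sigma>0 t"
      using Suc.IH[OF \<open>t \<le> T\<close>] by (simp add: map_pmf_def)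
    finally show ?thesis .
  qed
qed

lemma finite_processes: "finite (processes M h)"
  by (auto simp: processes_def)

lemma finite_state_vectors: "finite (state_vectors M h)"
  unfolding state_vectors_def
  by (intro finite_PiE finite_processes) (auto simp: processes_def finite_states)

lemma finite_action_vectors: "finite (action_vectors M h)"
  unfolding action_vectors_def
  by (intro finite_PiE finite_processes) (auto simp: processes_def finite_actions)

lemma set_next_states:
  assumes "\<sigma> \<in> state_vectors M h" "\<alpha> \<in> action_vectors M h"
  shows "set_pmf (next_states M h \<sigma> \<alpha>) \<subseteq> state_vectors M h"
  unfolding next_states_def state_vectors_def
proof (rule set_Pi_pmf_undefined[OF finite_processes], clarify)
  fix i n x assume p: "(i, n) \<in> processes M h"
    and x: "x \<in> set_pmf (trans_prob M i (\<sigma> (i, n)) (\<alpha> (i, n)))"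
  from p have i: "i \<in> {1..num_gangs M}" "n \<in> {1..h * base_size M i}" by (auto simp: processes_def)
  from trans_prob_states[OF i(1) state_vectors_mem[OF assms(1) i] action_vectors_mem[OF assms(2) i]] x
  show "x \<in> states M i" by blast
qed

text \<open>Randomized counterpart of membership in \<open>policies\<close>. It keeps all laws
  within the finite sets of state and action vectors.\<close>

definition admissible :: "nat \<Rightarrow> ('s, 'a) rand_policy \<Rightarrow> bool" where
  "admissible h \<pi> \<longleftrightarrow>
     (\<forall>t\<in>{0..horizon M}. \<forall>\<sigma>\<in>state_vectors M h. set_pmf (\<pi> t \<sigma>) \<subseteq> action_vectors M h)"

lemma admissible_deterministic: "\<phi> \<in> policies M h \<Longrightarrow> admissible h (deterministic \<phi>)"
  unfolding admissible_def deterministic_def policies_def by (auto dest!: PiE_mem)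

lemma set_state_law:
  assumes "admissible h \<pi>" "\<sigma>0 \<in> state_vectors M h"
  shows "t \<le> horizon M \<Longrightarrow> set_pmf (state_law h \<pi> \<sigma>0 t) \<subseteq> state_vectors M h"
proof (induction t)
  case (Suc t)
  show ?case
  proof
    fix \<sigma>' assume "\<sigma>' \<in> set_pmf (state_law h \<pi> \<sigma>0 (Suc t))"
    then obtain \<sigma> \<alpha> where *: "\<sigma> \<in> set_pmf (state_law h \<pi> \<sigma>0 t)" "\<alpha> \<in> set_pmf (\<pi> t \<sigma>)"
      "\<sigma>' \<in> set_pmf (next_states M h \<sigma> \<alpha>)"
      by auto
    then have "\<sigma> \<in> state_vectors M h" using Suc by auto
    then have "set_pmf (\<pi> t \<sigma>) \<subseteq> action_vectors M h"
      using assms(1) Suc.prems by (simp add: admissible_def)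
    with *(2) have "\<alpha> \<in> action_vectors M h" by blast
    with \<open>\<sigma> \<in> state_vectors M h\<close> show "\<sigma>' \<in> state_vectors M h"
      using set_next_states *(3) by blast
  qed
qed (use assms in auto)

lemma set_law:
  assumes "admissible h \<pi>" "\<sigma>0 \<in> state_vectors M h" "t \<le> horizon M"
  shows "set_pmf (law h \<pi> \<sigma>0 t) \<subseteq> state_vectors M h \<times> action_vectors M h"
  using set_state_law[OF assms] assms(1,3) unfolding law_def admissible_def by fastforce

lemma finite_set_state_law:
  assumes "admissible h \<pi>" "\<sigma>0 \<in> state_vectors M h" "t \<le> horizon M"
  shows "finite (set_pmf (state_law h \<pi> \<sigma>0 t))"
  by (rule finite_subset[OF set_state_law[OF assms] finite_state_vectors])

lemma finite_set_law:
  assumes "admissible h \<pi>" "\<sigma>0 \<in> state_vectors M h" "t \<le> horizon M"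
  shows "finite (set_pmf (law h \<pi> \<sigma>0 t))"
  by (rule finite_subset[OF set_law[OF assms]])
    (intro finite_cartesian_product finite_state_vectors finite_action_vectors)

lemma mean_Z_eq_law:
  assumes "t \<le> horizon M"
  shows "mean_Z M h \<pi> \<sigma>0 t j = measure_pmf.expectation (law h \<pi> \<sigma>0 t) (\<lambda>p. Z_prop M h p j)"
  unfolding mean_Z_def map_nth_path_law[OF assms, symmetric] by simp

lemma mean_Y_eq_state_law:
  assumes "admissible h \<pi>" "\<sigma>0 \<in> state_vectors M h" "t \<le> horizon M" "i \<in> {1..num_gangs M}"
  shows "(\<Sum>a\<in>actions M i. mean_Z M h \<pi> \<sigma>0 t (i, s, a))
    = measure_pmf.expectation (state_law h \<pi> \<sigma>0 t) (\<lambda>\<sigma>. Y_prop M h \<sigma> i s)"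
proof -
  note fin = finite_set_law[OF assms(1-3)]
  have "(\<Sum>a\<in>actions M i. mean_Z M h \<pi> \<sigma>0 t (i, s, a))
    = measure_pmf.expectation (law h \<pi> \<sigma>0 t) (\<lambda>p. \<Sum>a\<in>actions M i. Z_prop M h p (i, s, a))"
    unfolding mean_Z_eq_law[OF assms(3)]
    by (rule Bochner_Integration.integral_sum[symmetric]) (rule integrable_measure_pmf_finite[OF fin])
  also have "\<dots> = measure_pmf.expectation (law h \<pi> \<sigma>0 t) (\<lambda>p. Y_prop M h (fst p) i s)"
  proof (rule integral_cong_AE, simp, simp, rule AE_pmfI)
    fix p assume "p \<in> set_pmf (law h \<pi> \<sigma>0 t)"
    then obtain \<sigma> \<alpha> where "p = (\<sigma>, \<alpha>)" "\<alpha> \<in> action_vectors M h"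
      using set_law[OF assms(1-3)] by (cases p) auto
    then show "(\<Sum>a\<in>actions M i. Z_prop M h p (i, s, a)) = Y_prop M h (fst p) i s"
      using Y_prop_eq_sum[OF valid assms(4), of \<alpha> h \<sigma> s] by simp
  qed
  also have "\<dots> = measure_pmf.expectation (map_pmf fst (law h \<pi> \<sigma>0 t)) (\<lambda>\<sigma>. Y_prop M h \<sigma> i s)"
    by simp
  finally show ?thesis unfolding map_fst_law .
qed

lemma Y_prop_eq_sum_of_bool:
  "Y_prop M h \<sigma> i s = (\<Sum>n\<in>{1..h * base_size M i}. of_bool (\<sigma> (i, n) = s)) / total_size M h"
  by (simp add: Y_prop_def sum_of_bool_eq Int_def)

lemma expectation_next_Y:
  assumes "\<sigma> \<in> state_vectors M h" "\<alpha> \<in> action_vectors M h" "i \<in> {1..num_gangs M}"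
  shows "measure_pmf.expectation (next_states M h \<sigma> \<alpha>) (\<lambda>\<sigma>'. Y_prop M h \<sigma>' i s)
    = (\<Sum>s'\<in>states M i. \<Sum>a'\<in>actions M i.
         Z_prop M h (\<sigma>, \<alpha>) (i, s', a') * pmf (trans_prob M i s' a') s)"
proof -
  have fin: "finite (set_pmf (next_states M h \<sigma> \<alpha>))"
    by (rule finite_subset[OF set_next_states[OF assms(1,2)] finite_state_vectors])
  have "measure_pmf.expectation (next_states M h \<sigma> \<alpha>) (\<lambda>\<sigma>'. Y_prop M h \<sigma>' i s)
    = (\<Sum>n\<in>{1..h * base_size M i}. measure_pmf.expectation (next_states M h \<sigma> \<alpha>)
        (\<lambda>\<sigma>'. of_bool (\<sigma>' (i, n) = s))) / total_size M h"
    unfolding Y_prop_eq_sum_of_bool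
    by (simp add: Bochner_Integration.integral_sum integrable_measure_pmf_finite[OF fin]
        del: sum_of_bool_eq)
  also have "\<dots> = (\<Sum>n\<in>{1..h * base_size M i}. pmf (trans_prob M i (\<sigma> (i, n)) (\<alpha> (i, n))) s) / total_size M h"
  proof (intro arg_cong2[where f = "(/)"] sum.cong refl)
    fix n assume "n \<in> {1..h * base_size M i}"
    then show "measure_pmf.expectation (next_states M h \<sigma> \<alpha>) (\<lambda>\<sigma>'. of_bool (\<sigma>' (i, n) = s))
        = pmf (trans_prob M i (\<sigma> (i, n)) (\<alpha> (i, n))) s"
      unfolding next_states_def using assms(3)
      by (subst expectation_of_bool_Pi_pmf) (auto simp: finite_processes processes_def)
  qed
  also have "\<dots> = (\<Sum>s'\<in>states M i. \<Sum>a'\<in>actions M i.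
         Z_prop M h (\<sigma>, \<alpha>) (i, s', a') * pmf (trans_prob M i s' a') s)"
    by (rule sum_processes_Z[OF assms])
  finally show ?thesis .
qed

text \<open>The balance equation of the linear program holds for the means of every policy, because
  the conditional mean of \<open>Y\<close> is linear in \<open>Z\<close>.\<close>

lemma mean_flow:
  assumes "admissible h \<pi>" "\<sigma>0 \<in> state_vectors M h" "t < horizon M" "i \<in> {1..num_gangs M}"
  shows "(\<Sum>a\<in>actions M i. mean_Z M h \<pi> \<sigma>0 (Suc t) (i, s, a))
    = (\<Sum>s'\<in>states M i. \<Sum>a'\<in>actions M i. mean_Z M h \<pi> \<sigma>0 t (i, s', a') * pmf (trans_prob M i s' a') s)"
proof -
  have t: "t \<le> horizon M" using assms by simp
  note fin = finite_set_law[OF assms(1,2) t] and set = set_law[OF assms(1,2) t]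
  have fin': "finite (set_pmf (next_states M h (fst p) (snd p)))" if "p \<in> set_pmf (law h \<pi> \<sigma>0 t)" for p
    using that set by (intro finite_subset[OF set_next_states finite_state_vectors]) auto
  have "(\<Sum>a\<in>actions M i. mean_Z M h \<pi> \<sigma>0 (Suc t) (i, s, a))
    = measure_pmf.expectation (state_law h \<pi> \<sigma>0 (Suc t)) (\<lambda>\<sigma>. Y_prop M h \<sigma> i s)"
    using assms by (intro mean_Y_eq_state_law) auto
  also have "\<dots> = measure_pmf.expectation (law h \<pi> \<sigma>0 t) (\<lambda>p.
      measure_pmf.expectation (next_states M h (fst p) (snd p)) (\<lambda>\<sigma>. Y_prop M h \<sigma> i s))"
    unfolding state_law_Suc_eq by (rule expectation_bind_finite[OF fin fin'])
  also have "\<dots> = measure_pmf.expectation (law h \<pi> \<sigma>0 t) (\<lambda>p.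
      \<Sum>s'\<in>states M i. \<Sum>a'\<in>actions M i. Z_prop M h p (i, s', a') * pmf (trans_prob M i s' a') s)"
  proof (rule integral_cong_AE, simp, simp, rule AE_pmfI)
    fix p assume "p \<in> set_pmf (law h \<pi> \<sigma>0 t)"
    then show "measure_pmf.expectation (next_states M h (fst p) (snd p)) (\<lambda>\<sigma>. Y_prop M h \<sigma> i s)
      = (\<Sum>s'\<in>states M i. \<Sum>a'\<in>actions M i. Z_prop M h p (i, s', a') * pmf (trans_prob M i s' a') s)"
      using set expectation_next_Y[of "fst p" h "snd p" i s] assms(4) by (cases p) auto
  qed
  also have "\<dots> = (\<Sum>s'\<in>states M i. \<Sum>a'\<in>actions M i.
      mean_Z M h \<pi> \<sigma>0 t (i, s', a') * pmf (trans_prob M i s' a') s)"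
    unfolding mean_Z_eq_law[OF t]
    by (simp add: Bochner_Integration.integral_sum integrable_measure_pmf_finite[OF fin])
  finally show ?thesis .
qed

lemma sum_Z_prop:
  assumes "h \<ge> 1" "\<sigma> \<in> state_vectors M h" "\<alpha> \<in> action_vectors M h" "i \<in> {1..num_gangs M}"
  shows "(\<Sum>s\<in>states M i. \<Sum>a\<in>actions M i. Z_prop M h (\<sigma>, \<alpha>) (i, s, a))
    = real (base_size M i) / real (total_base_size M)"
  using sum_processes_Z[OF assms(2-4), of "\<lambda>_ _. 1"] assms(1) by (simp add: total_size_def)

lemma Z_prop_bounds:
  assumes "h \<ge> 1" "j \<in> triples M"
  shows "0 \<le> Z_prop M h p j" "Z_prop M h p j \<le> real (base_size M (fst j)) / real (total_base_size M)"
proof -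
  obtain i s a \<sigma> \<alpha> where [simp]: "j = (i, s, a)" "p = (\<sigma>, \<alpha>)" by (cases j, cases p)
  show "0 \<le> Z_prop M h p j" by simp
  have "card {n \<in> {1..h * base_size M i}. \<sigma> (i, n) = s \<and> \<alpha> (i, n) = a} \<le> card {1..h * base_size M i}"
    by (intro card_mono) auto
  then have "Z_prop M h p j \<le> real (h * base_size M i) / real (total_size M h)"
    by (simp add: divide_right_mono flip: of_nat_mult del: of_nat_mult)
  then show "Z_prop M h p j \<le> real (base_size M (fst j)) / real (total_base_size M)"
    using assms(1) by (simp add: total_size_def)
qed

lemma mean_Z_bounds:
  assumes "h \<ge> 1" "j \<in> triples M" "t \<le> horizon M" "admissible h \<pi>" "\<sigma>0 \<in> state_vectors M h"
  shows "0 \<le> mean_Z M h \<pi> \<sigma>0 t j"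
    "mean_Z M h \<pi> \<sigma>0 t j \<le> real (base_size M (fst j)) / real (total_base_size M)"
proof -
  let ?E = "measure_pmf.expectation (law h \<pi> \<sigma>0 t)"
  show "0 \<le> mean_Z M h \<pi> \<sigma>0 t j"
    unfolding mean_Z_eq_law[OF assms(3)]
    by (rule Bochner_Integration.integral_nonneg) (rule Z_prop_bounds[OF assms(1,2)])
  have "?E (\<lambda>p. Z_prop M h p j) \<le> ?E (\<lambda>_. real (base_size M (fst j)) / real (total_base_size M))"
    by (intro integral_mono integrable_measure_pmf_finite finite_set_law assms)
      (rule Z_prop_bounds[OF assms(1,2)])
  then show "mean_Z M h \<pi> \<sigma>0 t j \<le> real (base_size M (fst j)) / real (total_base_size M)"
    unfolding mean_Z_eq_law[OF assms(3)] by simp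
qed

lemma initial_mean_Y:
  assumes "admissible h \<pi>" "\<sigma>0 \<in> state_vectors M h" "i \<in> {1..num_gangs M}"
  shows "(\<Sum>a\<in>actions M i. mean_Z M h \<pi> \<sigma>0 0 (i, s, a)) = Y_prop M h \<sigma>0 i s"
  using mean_Y_eq_state_law[OF assms(1,2) _ assms(3), of 0 s] by simp

lemma sum_mean_Z:
  assumes "h \<ge> 1" "t \<le> horizon M" "admissible h \<pi>" "\<sigma>0 \<in> state_vectors M h" "i \<in> {1..num_gangs M}"
  shows "(\<Sum>s\<in>states M i. \<Sum>a\<in>actions M i. mean_Z M h \<pi> \<sigma>0 t (i, s, a))
    = real (base_size M i) / real (total_base_size M)"
proof -
  let ?E = "measure_pmf.expectation (law h \<pi> \<sigma>0 t)"
  have "(\<Sum>s\<in>states M i. \<Sum>a\<in>actions M i. mean_Z M h \<pi> \<sigma>0 t (i, s, a))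
    = ?E (\<lambda>p. \<Sum>s\<in>states M i. \<Sum>a\<in>actions M i. Z_prop M h p (i, s, a))"
    unfolding mean_Z_eq_law[OF assms(2)]
    by (simp add: Bochner_Integration.integral_sum integrable_measure_pmf_finite finite_set_law assms)
  also have "\<dots> = ?E (\<lambda>_. real (base_size M i) / real (total_base_size M))"
  proof (rule integral_cong_AE, simp, simp, rule AE_pmfI)
    fix p assume "p \<in> set_pmf (law h \<pi> \<sigma>0 t)"
    then show "(\<Sum>s\<in>states M i. \<Sum>a\<in>actions M i. Z_prop M h p (i, s, a))
        = real (base_size M i) / real (total_base_size M)"
      using set_law[OF assms(3,4,2)] sum_Z_prop[OF assms(1) _ _ assms(5)] by (cases p) auto
  qed
  finally show ?thesis by simp
qed

section \<open>The linear program as a relaxation\<close>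

text \<open>Almost sure constraints along the path are constraints on the support of each marginal
  law.\<close>

lemma wc_policies_iff_law:
  assumes "\<phi> \<in> policies M h"
  shows "\<phi> \<in> wc_policies M h \<sigma>0 \<longleftrightarrow>
    (\<forall>t\<in>{0..horizon M}. \<forall>p\<in>set_pmf (law h (deterministic \<phi>) \<sigma>0 t). \<forall>l\<in>{1..num_constraints M}.
       (\<Sum>i\<in>{1..num_gangs M}. \<Sum>n\<in>{1..h * base_size M i}.
             cost M i l (fst p (i, n)) (snd p (i, n))) \<le> 0)"
proof -
  have "set_pmf (law h (deterministic \<phi>) \<sigma>0 t)
    = (\<lambda>\<omega>. \<omega> ! t) ` set_pmf (path_law M h (deterministic \<phi>) \<sigma>0 (horizon M))"
    if "t \<in> {0..horizon M}" for t
    using that by (subst map_nth_path_law[of t "horizon M", symmetric]) auto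
  then show ?thesis
    using assms unfolding wc_policies_def by auto
qed

text \<open>The load is linear in \<open>Z\<close>, so a constraint that holds almost surely also
  holds for the mean.\<close>

lemma mean_load_nonpos:
  assumes h: "h \<ge> 1" and \<phi>: "\<phi> \<in> wc_policies M h \<sigma>0" and \<sigma>0: "\<sigma>0 \<in> state_vectors M h"
    and t: "t \<in> {0..horizon M}" and l: "l \<in> {1..num_constraints M}"
  shows "load M l (mean_Z M h (deterministic \<phi>) \<sigma>0 t) \<le> 0"
proof -
  have pol: "\<phi> \<in> policies M h" using \<phi> by (simp add: wc_policies_def)
  note adm = admissible_deterministic[OF pol]
  have t': "t \<le> horizon M" using t by simp
  let ?E = "measure_pmf.expectation (law h (deterministic \<phi>) \<sigma>0 t)"
  have int: "integrable (law h (deterministic \<phi>) \<sigma>0 t) g" for g :: "_ \<Rightarrow> real"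
    by (intro integrable_measure_pmf_finite finite_set_law adm \<sigma>0 t')
  have "load M l (mean_Z M h (deterministic \<phi>) \<sigma>0 t) = ?E (\<lambda>p. load M l (Z_prop M h p))"
    unfolding load_eq_sum mean_Z_eq_law[OF t']
    by (simp add: Bochner_Integration.integral_sum int)
  also have "\<dots> \<le> ?E (\<lambda>_. 0)"
  proof (rule integral_mono_AE[OF int int], rule AE_pmfI)
    fix p assume p: "p \<in> set_pmf (law h (deterministic \<phi>) \<sigma>0 t)"
    obtain \<sigma> \<alpha> where [simp]: "p = (\<sigma>, \<alpha>)" by (cases p)
    have "\<sigma> \<in> state_vectors M h" "\<alpha> \<in> action_vectors M h"
      using set_law[OF adm \<sigma>0 t'] p by auto
    then have "load M l (Z_prop M h p) = (\<Sum>i\<in>{1..num_gangs M}. \<Sum>n\<in>{1..h * base_size M i}.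
       cost M i l (\<sigma> (i, n)) (\<alpha> (i, n))) / total_size M h"
      by (simp only: \<open>p = _\<close> load_eq_sum_costs)
    also have "\<dots> \<le> 0"
    proof (rule divide_nonpos_nonneg)
      have "(\<Sum>i\<in>{1..num_gangs M}. \<Sum>n\<in>{1..h * base_size M i}.
          cost M i l (fst p (i, n)) (snd p (i, n))) \<le> 0"
        using \<phi> p t l unfolding wc_policies_iff_law[OF pol] by blast
      then show "(\<Sum>i\<in>{1..num_gangs M}. \<Sum>n\<in>{1..h * base_size M i}.
          cost M i l (\<sigma> (i, n)) (\<alpha> (i, n))) \<le> 0" by simp
    qed simp
    finally show "load M l (Z_prop M h p) \<le> 0" .
  qed
  finally show ?thesis by simp
qed

text \<open>The means of \<open>\<phi>\<close>, rescaled to proportions within each gang, are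
  feasible for the linear program, and their objective value is the gain of
  \<open>\<phi>\<close>.\<close>

lemma gain_le_lp_optimum:
  assumes h: "h \<ge> 1" and \<phi>: "\<phi> \<in> wc_policies M h \<sigma>0" and \<sigma>0: "\<sigma>0 \<in> state_vectors M h"
    and y0: "\<forall>i\<in>{1..num_gangs M}. \<forall>s\<in>states M i. Y_prop M h \<sigma>0 i s = y0 i s"
    and opt: "lp_optimal M y0 x"
  shows "total_gain M h \<phi> \<sigma>0 \<le> lp_objective M x"
proof -
  have pol: "\<phi> \<in> policies M h" using \<phi> by (simp add: wc_policies_def)
  note adm = admissible_deterministic[OF pol]
  let ?z = "mean_Z M h (deterministic \<phi>) \<sigma>0"
  let ?c = "\<lambda>i. real (total_base_size M) / real (base_size M i)"
  define x' where "x' t = (\<lambda>(i, s, a). ?c i * ?z t (i, s, a))" for t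
  have c: "base_size M i > 0" if "i \<in> {1..num_gangs M}" for i
    using that by (rule base_size_pos)
  have c0: "base_size M i \<noteq> 0" if "i \<in> {1..num_gangs M}" for i
    using c[OF that] by simp
  have "lp_feasible M y0 x'"
    unfolding lp_feasible_def
  proof (intro conjI ballI allI impI)
    fix t j assume t: "t \<in> {0..horizon M}" and j: "j \<in> triples M"
    obtain i s a where [simp]: "j = (i, s, a)" by (cases j)
    have i: "i \<in> {1..num_gangs M}" using j by (simp add: triples_iff)
    note b = mean_Z_bounds[OF h j _ adm \<sigma>0, of t]
    show "0 \<le> x' t j"
      using b t by (simp add: x'_def)
    have "?c i * ?z t j \<le> ?c i * (real (base_size M i) / real (total_base_size M))"
      using b t by (intro mult_left_mono) auto
    then show "x' t j \<le> 1"
      using c[OF i] total_base_size_pos by (simp add: x'_def)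
  next
    fix i s t assume "i \<in> {1..num_gangs M}" "s \<in> states M i" "t < horizon M"
    then show "(\<Sum>s'\<in>states M i. \<Sum>a'\<in>actions M i. x' t (i, s', a') * pmf (trans_prob M i s' a') s)
          = (\<Sum>a\<in>actions M i. x' (Suc t) (i, s, a))"
      using mean_flow[OF adm \<sigma>0, of t i s]
      by (simp add: x'_def mult.assoc flip: sum_distrib_left sum_divide_distrib)
  next
    fix i t assume "i \<in> {1..num_gangs M}" "t \<in> {0..horizon M}"
    then show "(\<Sum>s\<in>states M i. \<Sum>a\<in>actions M i. x' t (i, s, a)) = 1"
      using sum_mean_Z[OF h _ adm \<sigma>0, of t i] c[of i] total_base_size_pos
      by (simp add: x'_def flip: sum_distrib_left sum_divide_distrib)
  next
    fix i s assume "i \<in> {1..num_gangs M}" "s \<in> states M i"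
    then show "(\<Sum>a\<in>actions M i. x' 0 (i, s, a)) = ?c i * y0 i s"
      using initial_mean_Y[OF adm \<sigma>0, of i s] y0
      by (simp add: x'_def flip: sum_distrib_left sum_divide_distrib)
  next
    fix l t assume l: "l \<in> {1..num_constraints M}" and t: "t \<in> {0..horizon M}"
    have "(\<Sum>(i, s, a)\<in>triples M. real (base_size M i) * x' t (i, s, a) * cost M i l s a)
      = real (total_base_size M) * load M l (?z t)"
      unfolding load_def sum_distrib_left
      by (intro sum.cong) (auto simp: x'_def triples_iff c0)
    then show "(\<Sum>(i, s, a)\<in>triples M. real (base_size M i) * x' t (i, s, a) * cost M i l s a) \<le> 0"
      using mean_load_nonpos[OF h \<phi> \<sigma>0 t l] by (simp add: mult_nonneg_nonpos)
  qed
  then have "lp_objective M x' \<le> lp_objective M x"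
    using opt by (simp add: lp_optimal_def)
  moreover have "lp_objective M x' = total_gain M h \<phi> \<sigma>0"
    unfolding lp_objective_def total_gain_def sum_distrib_left
    by (intro sum.cong) (auto simp: x'_def triples_iff c0)
  ultimately show ?thesis by simp
qed

end

section \<open>The mean of the randomized policy\<close>

context gang_system
begin

lemma pmf_lp_choice:
  assumes "lp_feasible M y0 x" "t \<in> {0..horizon M}" "i \<in> {1..num_gangs M}" "s \<in> states M i"
  shows "pmf (embed_pmf (\<lambda>a. if a \<in> actions M i then lp_alpha M x t (i, s, a) else 0)) a
    = (if a \<in> actions M i then lp_alpha M x t (i, s, a) else 0)"
proof (rule pmf_embed_pmf)
  let ?f = "\<lambda>a. if a \<in> actions M i then lp_alpha M x t (i, s, a) else 0"
  note \<alpha> = lp_alpha_properties[OF assms]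
  have "(\<integral>\<^sup>+ a. ennreal (?f a) \<partial>count_space UNIV) = (\<Sum>a\<in>actions M i. ennreal (?f a))"
    by (rule nn_integral_count_space') (use assms in \<open>auto simp: finite_actions\<close>)
  also have "\<dots> = ennreal (\<Sum>a\<in>actions M i. ?f a)"
    using \<alpha>(1) by (intro sum_ennreal) (simp del: lp_alpha.simps)
  also have "(\<Sum>a\<in>actions M i. ?f a) = 1"
    using \<alpha>(2) by simp
  finally show "(\<integral>\<^sup>+ a. ennreal (?f a) \<partial>count_space UNIV) = 1" by simp
  show "0 \<le> ?f a" for a
    using \<alpha>(1) by simp
qed

lemma admissible_lp_policy:
  assumes "lp_feasible M y0 x"
  shows "admissible h (lp_policy M x h)"
  unfolding admissible_def
proof (intro ballI)
  fix t \<sigma> assume t: "t \<in> {0..horizon M}" and \<sigma>: "\<sigma> \<in> state_vectors M h"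
  show "set_pmf (lp_policy M x h t \<sigma>) \<subseteq> action_vectors M h"
    unfolding lp_policy_def action_vectors_def
  proof (rule set_Pi_pmf_undefined[OF finite_processes], clarify)
    fix i n a assume p: "(i, n) \<in> processes M h"
      and a: "a \<in> set_pmf (embed_pmf (\<lambda>a. if a \<in> actions M i then lp_alpha M x t (i, \<sigma> (i, n), a) else 0))"
    from p have i: "i \<in> {1..num_gangs M}" "n \<in> {1..h * base_size M i}" by (auto simp: processes_def)
    show "a \<in> actions M i"
      using a pmf_lp_choice[OF assms t i(1) state_vectors_mem[OF \<sigma> i], of a]
      unfolding set_pmf_iff by (auto split: if_splits)
  qed
qed

lemma Z_prop_eq_sum_of_bool:
  "Z_prop M h (\<sigma>, \<alpha>) (i, s, a)
    = (\<Sum>n\<in>{1..h * base_size M i}. of_bool (\<sigma> (i, n) = s) * of_bool (\<alpha> (i, n) = a)) / total_size M h"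
proof -
  have "card {n \<in> {1..h * base_size M i}. \<sigma> (i, n) = s \<and> \<alpha> (i, n) = a}
    = (\<Sum>n\<in>{1..h * base_size M i}. of_bool (\<sigma> (i, n) = s \<and> \<alpha> (i, n) = a))"
    by (simp add: sum_of_bool_eq Int_def)
  then show ?thesis
    by (simp add: of_bool_conj del: sum_of_bool_eq)
qed

lemma expectation_lp_policy:
  assumes x: "lp_feasible M y0 x" and t: "t \<in> {0..horizon M}" and \<sigma>: "\<sigma> \<in> state_vectors M h"
    and i: "i \<in> {1..num_gangs M}" "a \<in> actions M i"
  shows "measure_pmf.expectation (lp_policy M x h t \<sigma>) (\<lambda>\<alpha>. Z_prop M h (\<sigma>, \<alpha>) (i, s, a))
    = lp_alpha M x t (i, s, a) * Y_prop M h \<sigma> i s"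
proof -
  have "set_pmf (lp_policy M x h t \<sigma>) \<subseteq> action_vectors M h"
    using admissible_lp_policy[OF x] t \<sigma> by (simp add: admissible_def)
  then have fin: "finite (set_pmf (lp_policy M x h t \<sigma>))"
    using finite_action_vectors by (rule finite_subset)
  have "measure_pmf.expectation (lp_policy M x h t \<sigma>) (\<lambda>\<alpha>. Z_prop M h (\<sigma>, \<alpha>) (i, s, a))
    = (\<Sum>n\<in>{1..h * base_size M i}. of_bool (\<sigma> (i, n) = s) *
        measure_pmf.expectation (lp_policy M x h t \<sigma>) (\<lambda>\<alpha>. of_bool (\<alpha> (i, n) = a))) / total_size M h"
    unfolding Z_prop_eq_sum_of_bool
    by (simp add: Bochner_Integration.integral_sum integrable_measure_pmf_finite[OF fin]
        del: sum_of_bool_eq)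
  also have "\<dots> = (\<Sum>n\<in>{1..h * base_size M i}. lp_alpha M x t (i, s, a) * of_bool (\<sigma> (i, n) = s)) / total_size M h"
  proof (intro arg_cong2[where f = "(/)"] sum.cong refl)
    fix n assume n: "n \<in> {1..h * base_size M i}"
    have "measure_pmf.expectation (lp_policy M x h t \<sigma>) (\<lambda>\<alpha>. of_bool (\<alpha> (i, n) = a))
        = lp_alpha M x t (i, \<sigma> (i, n), a)"
      unfolding lp_policy_def using i n
      by (subst expectation_of_bool_Pi_pmf)
        (auto simp: finite_processes processes_def
           pmf_lp_choice[OF x t i(1) state_vectors_mem[OF \<sigma> i(1) n]] simp del: lp_alpha.simps)
    then show "of_bool (\<sigma> (i, n) = s) *
        measure_pmf.expectation (lp_policy M x h t \<sigma>) (\<lambda>\<alpha>. of_bool (\<alpha> (i, n) = a))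
      = lp_alpha M x t (i, s, a) * of_bool (\<sigma> (i, n) = s)"
      by (simp del: lp_alpha.simps)
  qed
  also have "\<dots> = lp_alpha M x t (i, s, a) * Y_prop M h \<sigma> i s"
    unfolding Y_prop_eq_sum_of_bool sum_distrib_left[symmetric] by simp
  finally show ?thesis .
qed

lemma fluid_Y_initial:
  assumes "lp_feasible M y0 x" "i \<in> {1..num_gangs M}" "s \<in> states M i"
  shows "fluid_Y x 0 i s = y0 i s"
  using assms base_size_pos[OF assms(2)] total_base_size_pos
  by (simp add: fluid_Y_def fluid_def lp_feasible_def flip: sum_distrib_left sum_divide_distrib)

lemma fluid_flow:
  assumes "lp_feasible M y0 x" "i \<in> {1..num_gangs M}" "s \<in> states M i" "t < horizon M"
  shows "fluid_Y x (Suc t) i s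
    = (\<Sum>s'\<in>states M i. \<Sum>a'\<in>actions M i. fluid x t (i, s', a') * pmf (trans_prob M i s' a') s)"
proof -
  have "(\<Sum>s'\<in>states M i. \<Sum>a'\<in>actions M i. x t (i, s', a') * pmf (trans_prob M i s' a') s)
          = (\<Sum>a\<in>actions M i. x (Suc t) (i, s, a))"
    using assms by (simp add: lp_feasible_def)
  then show ?thesis
    by (simp add: fluid_Y_def fluid_def mult.assoc flip: sum_distrib_left sum_divide_distrib)
qed

text \<open>Averaging over the random actions turns \<open>Z\<close> into \<open>lp_alpha\<close>
  times \<open>Y\<close>, a product that is linear in \<open>Y\<close>. Hence only the mean of
  \<open>Y\<close> matters.\<close>

lemma mean_lp_policy_step:
  assumes x: "lp_feasible M y0 x" and \<sigma>0: "\<sigma>0 \<in> state_vectors M h" and t: "t \<le> horizon M"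
    and i: "i \<in> {1..num_gangs M}" "s \<in> states M i" "a \<in> actions M i"
    and Y: "(\<Sum>a\<in>actions M i. mean_Z M h (lp_policy M x h) \<sigma>0 t (i, s, a)) = fluid_Y x t i s"
  shows "mean_Z M h (lp_policy M x h) \<sigma>0 t (i, s, a) = fluid x t (i, s, a)"
proof -
  note adm = admissible_lp_policy[OF x, of h]
  note set = set_state_law[OF adm \<sigma>0 t]
  have t': "t \<in> {0..horizon M}" using t by simp
  have fin: "finite (set_pmf (lp_policy M x h t \<sigma>))" if "\<sigma> \<in> set_pmf (state_law h (lp_policy M x h) \<sigma>0 t)" for \<sigma>
  proof (rule finite_subset[OF _ finite_action_vectors])
    show "set_pmf (lp_policy M x h t \<sigma>) \<subseteq> action_vectors M h"
      using adm t' that set unfolding admissible_def by blast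
  qed
  have "mean_Z M h (lp_policy M x h) \<sigma>0 t (i, s, a)
    = measure_pmf.expectation (state_law h (lp_policy M x h) \<sigma>0 t) (\<lambda>\<sigma>.
        measure_pmf.expectation (map_pmf (Pair \<sigma>) (lp_policy M x h t \<sigma>)) (\<lambda>p. Z_prop M h p (i, s, a)))"
    unfolding mean_Z_eq_law[OF t] law_def
    by (rule expectation_bind_finite) (use finite_set_state_law[OF adm \<sigma>0 t] fin in auto)
  also have "\<dots> = measure_pmf.expectation (state_law h (lp_policy M x h) \<sigma>0 t)
      (\<lambda>\<sigma>. lp_alpha M x t (i, s, a) * Y_prop M h \<sigma> i s)"
  proof (rule integral_cong_AE, simp, simp, rule AE_pmfI)
    fix \<sigma> assume "\<sigma> \<in> set_pmf (state_law h (lp_policy M x h) \<sigma>0 t)"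
    then have "\<sigma> \<in> state_vectors M h" using set by blast
    then show "measure_pmf.expectation (map_pmf (Pair \<sigma>) (lp_policy M x h t \<sigma>)) (\<lambda>p. Z_prop M h p (i, s, a))
      = lp_alpha M x t (i, s, a) * Y_prop M h \<sigma> i s"
      using expectation_lp_policy[OF x t' _ i(1,3)] by (simp del: lp_alpha.simps Z_prop.simps)
  qed
  also have "\<dots> = lp_alpha M x t (i, s, a) * fluid_Y x t i s"
    unfolding Y[symmetric] mean_Y_eq_state_law[OF adm \<sigma>0 t i(1)] by simp
  also have "\<dots> = fluid x t (i, s, a)"
    by (rule lp_alpha_properties(4)[OF x t' i])
  finally show ?thesis .
qed

text \<open>The mean and the fluid solution have the same initial state proportions, the same
  splitting among actions and the same flow.\<close>

lemma mean_lp_policy: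
  assumes x: "lp_feasible M y0 x" and \<sigma>0: "\<sigma>0 \<in> state_vectors M h"
    and y0: "\<forall>i\<in>{1..num_gangs M}. \<forall>s\<in>states M i. Y_prop M h \<sigma>0 i s = y0 i s"
  shows "t \<le> horizon M \<Longrightarrow> (i, s, a) \<in> triples M \<Longrightarrow>
    mean_Z M h (lp_policy M x h) \<sigma>0 t (i, s, a) = fluid x t (i, s, a)"
proof (induction t arbitrary: i s a)
  case 0
  then have i: "i \<in> {1..num_gangs M}" "s \<in> states M i" "a \<in> actions M i"
    by (simp_all add: triples_iff)
  show ?case
  proof (rule mean_lp_policy_step[OF x \<sigma>0 0(1) i])
    show "(\<Sum>a\<in>actions M i. mean_Z M h (lp_policy M x h) \<sigma>0 0 (i, s, a)) = fluid_Y x 0 i s"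
      unfolding initial_mean_Y[OF admissible_lp_policy[OF x] \<sigma>0 i(1)] fluid_Y_initial[OF x i(1,2)]
      using y0 i by blast
  qed
next
  case (Suc t)
  then have i: "i \<in> {1..num_gangs M}" "s \<in> states M i" "a \<in> actions M i" and t: "t < horizon M"
    by (simp_all add: triples_iff)
  show ?case
  proof (rule mean_lp_policy_step[OF x \<sigma>0 Suc.prems(1) i])
    show "(\<Sum>a\<in>actions M i. mean_Z M h (lp_policy M x h) \<sigma>0 (Suc t) (i, s, a)) = fluid_Y x (Suc t) i s"
      unfolding mean_flow[OF admissible_lp_policy[OF x] \<sigma>0 t i(1)] fluid_flow[OF x i(1,2) t]
      using Suc.IH t i by (intro sum.cong refl) (simp add: triples_iff)
  qed
qed

end

section \<open>Exponentially small probabilities\<close>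

text \<open>Allowing a prefactor \<open>K\<close> makes the notion closed under finite sums;
  \<open>exp_small_eventually_le_exp\<close> removes it in the end.\<close>

definition exp_small :: "(nat \<Rightarrow> real) \<Rightarrow> bool" where
  "exp_small f \<longleftrightarrow> (\<exists>K C. C > 0 \<and> (\<forall>\<^sub>F h in sequentially. f h \<le> K * exp (- C * real h)))"

lemma exp_smallI: "C > 0 \<Longrightarrow> \<forall>\<^sub>F h in sequentially. f h \<le> K * exp (- C * real h) \<Longrightarrow> exp_small f"
  unfolding exp_small_def by blast

lemma exp_small_mono:
  assumes "exp_small g" "\<forall>\<^sub>F h in sequentially. f h \<le> g h"
  shows "exp_small f"
proof -
  obtain K C where C: "C > 0" and g: "\<forall>\<^sub>F h in sequentially. g h \<le> K * exp (- C * real h)"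
    using assms(1) unfolding exp_small_def by blast
  have "\<forall>\<^sub>F h in sequentially. f h \<le> K * exp (- C * real h)"
    using assms(2) g by eventually_elim simp
  with C show ?thesis by (rule exp_smallI)
qed

lemma exp_small_add:
  assumes "exp_small f" "exp_small g"
  shows "exp_small (\<lambda>h. f h + g h)"
proof -
  obtain K1 C1 where C1: "C1 > 0" and f: "\<forall>\<^sub>F h in sequentially. f h \<le> K1 * exp (- C1 * real h)"
    using assms(1) unfolding exp_small_def by blast
  obtain K2 C2 where C2: "C2 > 0" and g: "\<forall>\<^sub>F h in sequentially. g h \<le> K2 * exp (- C2 * real h)"
    using assms(2) unfolding exp_small_def by blast
  have *: "K * exp (- c * real h) \<le> \<bar>K\<bar> * exp (- min C1 C2 * real h)" if "min C1 C2 \<le> c" for K c h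
    using that by (intro mult_mono) (auto intro: mult_right_mono simp: min_le_iff_disj)
  have "\<forall>\<^sub>F h in sequentially. f h + g h \<le> (\<bar>K1\<bar> + \<bar>K2\<bar>) * exp (- min C1 C2 * real h)"
    using f g
  proof eventually_elim
    case (elim h)
    then show ?case
      using *[of C1 K1 h] *[of C2 K2 h] by (simp add: distrib_right)
  qed
  with C1 C2 show ?thesis by (intro exp_smallI[of "min C1 C2"]) auto
qed

lemma exp_small_sum:
  assumes "finite A" "\<And>a. a \<in> A \<Longrightarrow> exp_small (f a)"
  shows "exp_small (\<lambda>h. \<Sum>a\<in>A. f a h)"
  using assms
proof (induction A rule: finite_induct)
  case empty
  show ?case by (rule exp_smallI[of 1 _ 0]) auto
next
  case (insert a A)
  then have "exp_small (\<lambda>h. f a h + (\<Sum>a\<in>A. f a h))"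
    by (intro exp_small_add) auto
  with insert show ?case by simp
qed

text \<open>Half of the rate absorbs the prefactor.\<close>

lemma exp_small_eventually_le_exp:
  assumes "exp_small f"
  obtains C where "C > 0" "\<forall>\<^sub>F h in sequentially. f h \<le> exp (- C * real h)"
proof -
  obtain K C where C: "C > 0" and f: "\<forall>\<^sub>F h in sequentially. f h \<le> K * exp (- C * real h)"
    using assms unfolding exp_small_def by blast
  have "(\<lambda>h. K * exp (- (C / 2) * real h)) \<longlonglongrightarrow> 0"
    using C by real_asymp
  then have "\<forall>\<^sub>F h in sequentially. K * exp (- (C / 2) * real h) < 1"
    by (rule order_tendstoD) simp
  with f have "\<forall>\<^sub>F h in sequentially. f h \<le> exp (- (C / 2) * real h)"
  proof eventually_elim
    case (elim h)
    have "- C * real h = - (C / 2) * real h + - (C / 2) * real h" by simp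
    then have "f h \<le> K * exp (- (C / 2) * real h) * exp (- (C / 2) * real h)"
      using elim(1) by (simp only: exp_add mult.assoc)
    also have "\<dots> \<le> 1 * exp (- (C / 2) * real h)"
      using elim(2) by (intro mult_right_mono) auto
    finally show ?case by simp
  qed
  then show ?thesis using C that[of "C / 2"] by simp
qed

section \<open>Concentration of the proportions\<close>

context gang_system
begin

lemma Y_prop_eq_sum_pairs:
  "Y_prop M h \<sigma> i s = (\<Sum>k\<in>{i} \<times> {1..h * base_size M i}. of_bool (\<sigma> k = s)) / total_size M h"
proof -
  have "(\<Sum>k\<in>{i} \<times> {1..h * base_size M i}. of_bool (\<sigma> k = s))
    = (\<Sum>n\<in>{1..h * base_size M i}. of_bool (\<sigma> (i, n) = s) :: real)"
    by (rule sum.reindex_bij_witness[of _ "Pair i" snd]) auto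
  then show ?thesis
    unfolding Y_prop_eq_sum_of_bool by simp
qed

text \<open>Hoeffding's inequality for the indicators that process \<open>n\<close> of gang
  \<open>i\<close> moves to state \<open>s\<close>. The number of indicators and \<open>h\<close>
  are both at most the size \<open>N\<close> of the system, which gives the exponent.\<close>

lemma next_Y_concentration:
  assumes h: "h \<ge> 1" and \<sigma>: "\<sigma> \<in> state_vectors M h" and \<alpha>: "\<alpha> \<in> action_vectors M h"
    and i: "i \<in> {1..num_gangs M}" and \<delta>: "\<delta> \<ge> 0"
  shows "measure_pmf.prob (next_states M h \<sigma> \<alpha>)
      {\<sigma>'. \<delta> \<le> \<bar>Y_prop M h \<sigma>' i s -
        (\<Sum>s'\<in>states M i. \<Sum>a'\<in>actions M i. Z_prop M h (\<sigma>, \<alpha>) (i, s', a') * pmf (trans_prob M i s' a') s)\<bar>}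
    \<le> 2 * exp (- 2 * \<delta>\<^sup>2 * real h)"
proof -
  define P where "P = next_states M h \<sigma> \<alpha>"
  define J where "J = {i} \<times> {1..h * base_size M i}"
  define X where "X k \<sigma>' = (of_bool (\<sigma>' k = s) :: real)" for k and \<sigma>' :: "'s vec"
  define \<mu> where "\<mu> = (\<Sum>k\<in>J. measure_pmf.expectation P (X k))"
  define N where "N = real (total_size M h)"
  have N: "N > 0" using total_size_pos[OF h] by (simp add: N_def)
  have J: "J \<subseteq> processes M h" using i by (auto simp: J_def processes_def)
  have finJ: "finite J" by (simp add: J_def)
  have cardJ: "card J = h * base_size M i" by (simp add: J_def card_cartesian_product)
  have cpos: "real (card J) > 0"
    unfolding cardJ using h base_size_pos[OF i] by simp
  have finP: "finite (set_pmf P)"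
    unfolding P_def by (rule finite_subset[OF set_next_states[OF \<sigma> \<alpha>] finite_state_vectors])
  interpret Hoeffding_ineq "measure_pmf P" J X "\<lambda>_. 0" "\<lambda>_. 1" \<mu>
  proof unfold_locales
    have "prob_space.indep_vars (measure_pmf P) (\<lambda>_. count_space UNIV) (\<lambda>k \<sigma>'. \<sigma>' k) J"
      unfolding P_def next_states_def
      by (rule prob_space.indep_vars_subset[OF measure_pmf.prob_space_axioms
            indep_vars_Pi_pmf[OF finite_processes] J])
    then show "prob_space.indep_vars (measure_pmf P) (\<lambda>_. borel) X J"
      unfolding X_def
      by (rule prob_space.indep_vars_compose2[OF measure_pmf.prob_space_axioms]) auto
  qed (auto simp: finJ X_def \<mu>_def)
  have mean: "\<mu> / N = (\<Sum>s'\<in>states M i. \<Sum>a'\<in>actions M i.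
      Z_prop M h (\<sigma>, \<alpha>) (i, s', a') * pmf (trans_prob M i s' a') s)"
    unfolding expectation_next_Y[OF \<sigma> \<alpha> i, symmetric] P_def[symmetric] Y_prop_eq_sum_pairs
      \<mu>_def X_def J_def[symmetric] N_def
    by (simp add: Bochner_Integration.integral_sum integrable_measure_pmf_finite[OF finP]
        del: sum_of_bool_eq)
  have "{\<sigma>'. \<delta> \<le> \<bar>Y_prop M h \<sigma>' i s - \<mu> / N\<bar>} = {\<sigma>'\<in>space P. \<bar>(\<Sum>k\<in>J. X k \<sigma>') - \<mu>\<bar> \<ge> \<delta> * N}"
    unfolding Y_prop_eq_sum_pairs J_def[symmetric] X_def N_def[symmetric] diff_divide_distrib[symmetric]
    using N by (simp add: abs_divide pos_le_divide_eq del: sum_of_bool_eq)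
  then have "measure_pmf.prob P {\<sigma>'. \<delta> \<le> \<bar>Y_prop M h \<sigma>' i s - \<mu> / N\<bar>}
      \<le> 2 * exp (- 2 * (\<delta> * N)\<^sup>2 / (\<Sum>k\<in>J. (1 - 0)\<^sup>2))"
    using Hoeffding_ineq_abs_ge[of "\<delta> * N"] \<delta> N cpos by simp
  also have "\<dots> \<le> 2 * exp (- 2 * \<delta>\<^sup>2 * real h)"
  proof -
    have "real (card J) \<le> N"
      unfolding cardJ N_def total_size_def using base_size_le_total[OF i] by (simp add: mult_left_mono)
    moreover have "real h * 1 \<le> N"
      unfolding N_def total_size_def of_nat_mult using total_base_size_pos
      by (intro mult_left_mono) auto
    ultimately have "real h * real (card J) \<le> N * N"
      using N by (intro mult_mono) auto
    then have "\<delta>\<^sup>2 * (real h * real (card J)) \<le> \<delta>\<^sup>2 * (N * N)"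
      by (rule mult_left_mono) simp
    then have "\<delta>\<^sup>2 * real h \<le> (\<delta> * N)\<^sup>2 / card J"
      using cpos by (simp add: pos_le_divide_eq power2_eq_square mult_ac)
    then show ?thesis by simp
  qed
  finally show ?thesis
    unfolding mean P_def .
qed

definition deviating_Z ::
  "(nat \<Rightarrow> ('s, 'a) triple \<Rightarrow> real) \<Rightarrow> nat \<Rightarrow> nat \<Rightarrow> real \<Rightarrow> ('s vec \<times> 'a vec) set" where
  "deviating_Z x h t \<delta> = {p. \<exists>j\<in>triples M. \<delta> < \<bar>Z_prop M h p j - fluid x t j\<bar>}"

definition deviating_Y ::
  "(nat \<Rightarrow> ('s, 'a) triple \<Rightarrow> real) \<Rightarrow> nat \<Rightarrow> nat \<Rightarrow> real \<Rightarrow> 's vec set" where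
  "deviating_Y x h t \<delta> = {\<sigma>. \<exists>i\<in>{1..num_gangs M}. \<exists>s\<in>states M i.
     \<delta> < \<bar>Y_prop M h \<sigma> i s - fluid_Y x t i s\<bar>}"

text \<open>The next mean of \<open>Y\<close> and its fluid value are images of \<open>Z\<close> and
  of the fluid solution under the same map, whose coefficients are probabilities.\<close>

lemma fluid_flow_deviation:
  fixes \<eta> :: real
  assumes x: "lp_feasible M y0 x" and i: "i \<in> {1..num_gangs M}" "s \<in> states M i"
    and t: "t < horizon M" and p: "p \<notin> deviating_Z x h t \<eta>" and \<eta>: "\<eta> \<ge> 0"
  shows "\<bar>(\<Sum>s'\<in>states M i. \<Sum>a'\<in>actions M i. Z_prop M h p (i, s', a') * pmf (trans_prob M i s' a') s)
      - fluid_Y x (Suc t) i s\<bar> \<le> card (triples M) * \<eta>"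
proof -
  let ?q = "\<lambda>s' a'. pmf (trans_prob M i s' a') s"
  let ?e = "\<lambda>s' a'. (Z_prop M h p (i, s', a') - fluid x t (i, s', a')) * ?q s' a'"
  have e: "\<bar>?e s' a'\<bar> \<le> \<eta>" if "s' \<in> states M i" "a' \<in> actions M i" for s' a'
  proof -
    have "\<bar>?e s' a'\<bar> = \<bar>Z_prop M h p (i, s', a') - fluid x t (i, s', a')\<bar> * ?q s' a'"
      by (simp add: abs_mult)
    also have "\<dots> \<le> \<eta> * 1"
      using p that i \<eta> unfolding deviating_Z_def
      by (intro mult_mono) (auto simp: triples_iff pmf_le_1 not_less)
    finally show ?thesis by simp
  qed
  have "(\<Sum>s'\<in>states M i. \<Sum>a'\<in>actions M i. Z_prop M h p (i, s', a') * ?q s' a') - fluid_Y x (Suc t) i s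
    = (\<Sum>(s', a')\<in>states M i \<times> actions M i. ?e s' a')"
    unfolding fluid_flow[OF x i t]
    by (simp add: left_diff_distrib sum_subtractf sum.cartesian_product split_beta)
  then have "\<bar>(\<Sum>s'\<in>states M i. \<Sum>a'\<in>actions M i. Z_prop M h p (i, s', a') * ?q s' a') - fluid_Y x (Suc t) i s\<bar>
    = \<bar>\<Sum>(s', a')\<in>states M i \<times> actions M i. ?e s' a'\<bar>"
    by (simp only:)
  also have "\<dots> \<le> (\<Sum>(s', a')\<in>states M i \<times> actions M i. \<bar>?e s' a'\<bar>)"
    unfolding split_beta by (rule sum_abs)
  also have "\<dots> \<le> (\<Sum>_\<in>states M i \<times> actions M i. \<eta>)"
    using e by (intro sum_mono) auto
  also have "\<dots> = card (Pair i ` (states M i \<times> actions M i)) * \<eta>"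
    by (subst card_image) (auto simp: inj_on_def)
  also have "\<dots> \<le> card (triples M) * \<eta>"
    using i \<eta> by (intro mult_right_mono) (auto intro!: card_mono finite_triples simp: triples_iff)
  finally show ?thesis .
qed

text \<open>A deviation \<open>\<delta>\<close> at time \<open>t + 1\<close> comes from a deviation
  of \<open>Z\<close> at time \<open>t\<close>, which accounts for \<open>\<delta> / 2\<close>, or
  else from a random fluctuation by \<open>\<delta> / 2\<close>.\<close>

lemma deviating_Y_step:
  assumes x: "lp_feasible M y0 x" and h: "h \<ge> 1" and adm: "admissible h \<pi>"
    and \<sigma>0: "\<sigma>0 \<in> state_vectors M h" and t: "t < horizon M" and \<delta>: "\<delta> > 0"
  defines "\<eta> \<equiv> \<delta> / (2 * real (card (triples M)))"
  shows "measure_pmf.prob (state_law h \<pi> \<sigma>0 (Suc t)) (deviating_Y x h (Suc t) \<delta>)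
    \<le> measure_pmf.prob (law h \<pi> \<sigma>0 t) (deviating_Z x h t \<eta>)
      + real (card (SIGMA i:{1..num_gangs M}. states M i)) * (2 * exp (- 2 * (\<delta> / 2)\<^sup>2 * real h))"
  unfolding state_law_Suc_eq
proof (rule prob_bind_le)
  let ?G = "SIGMA i:{1..num_gangs M}. states M i"
  have J: "card (triples M) > 0"
    using finite_triples triples_nonempty by (simp add: card_gt_0_iff)
  have \<eta>: "\<eta> \<ge> 0" using \<delta> by (simp add: \<eta>_def)
  have J\<eta>: "card (triples M) * \<eta> = \<delta> / 2"
    using J by (simp add: \<eta>_def)
  show "finite (set_pmf (law h \<pi> \<sigma>0 t))"
    using t by (intro finite_set_law[OF adm \<sigma>0]) simp
  fix p assume p: "p \<in> set_pmf (law h \<pi> \<sigma>0 t)" "p \<notin> deviating_Z x h t \<eta>"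
  obtain \<sigma> \<alpha> where [simp]: "p = (\<sigma>, \<alpha>)" by (cases p)
  have \<sigma>\<alpha>: "\<sigma> \<in> state_vectors M h" "\<alpha> \<in> action_vectors M h"
    using set_law[OF adm \<sigma>0, of t] t p by auto
  let ?m = "\<lambda>i s. \<Sum>s'\<in>states M i. \<Sum>a'\<in>actions M i. Z_prop M h (\<sigma>, \<alpha>) (i, s', a') * pmf (trans_prob M i s' a') s"
  let ?E = "\<lambda>(i, s). {\<sigma>'. \<delta> / 2 \<le> \<bar>Y_prop M h \<sigma>' i s - ?m i s\<bar>}"
  have "deviating_Y x h (Suc t) \<delta> \<subseteq> (\<Union>k\<in>?G. ?E k)"
  proof
    fix \<sigma>' assume "\<sigma>' \<in> deviating_Y x h (Suc t) \<delta>"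
    then obtain i s where i: "i \<in> {1..num_gangs M}" "s \<in> states M i"
      and d: "\<delta> < \<bar>Y_prop M h \<sigma>' i s - fluid_Y x (Suc t) i s\<bar>"
      unfolding deviating_Y_def by blast
    have "\<bar>?m i s - fluid_Y x (Suc t) i s\<bar> \<le> \<delta> / 2"
      using fluid_flow_deviation[OF x i t p(2) \<eta>] unfolding J\<eta> \<open>p = _\<close> .
    then have "\<delta> / 2 \<le> \<bar>Y_prop M h \<sigma>' i s - ?m i s\<bar>" using d by linarith
    then have "\<sigma>' \<in> ?E (i, s)" by (simp only: prod.case mem_Collect_eq)
    then show "\<sigma>' \<in> (\<Union>k\<in>?G. ?E k)" using i by blast
  qed
  then have "measure_pmf.prob (next_states M h \<sigma> \<alpha>) (deviating_Y x h (Suc t) \<delta>)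
    \<le> measure_pmf.prob (next_states M h \<sigma> \<alpha>) (\<Union>k\<in>?G. ?E k)"
    by (intro measure_pmf.finite_measure_mono) auto
  also have "\<dots> \<le> (\<Sum>k\<in>?G. measure_pmf.prob (next_states M h \<sigma> \<alpha>) (?E k))"
    by (intro measure_pmf.finite_measure_subadditive_finite) (auto simp: finite_states)
  also have "\<dots> \<le> (\<Sum>k\<in>?G. 2 * exp (- 2 * (\<delta> / 2)\<^sup>2 * real h))"
  proof (rule sum_mono)
    fix k assume "k \<in> ?G"
    then show "measure_pmf.prob (next_states M h \<sigma> \<alpha>) (?E k) \<le> 2 * exp (- 2 * (\<delta> / 2)\<^sup>2 * real h)"
      using next_Y_concentration[OF h \<sigma>\<alpha>, of "fst k" "\<delta> / 2" "snd k"] \<delta> by (cases k) auto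
  qed
  finally show "measure_pmf.prob (next_states M h (fst p) (snd p)) (deviating_Y x h (Suc t) \<delta>)
    \<le> real (card ?G) * (2 * exp (- 2 * (\<delta> / 2)\<^sup>2 * real h))"
    by simp
qed simp

end

section \<open>Families of FAB policies\<close>

text \<open>The setting shared by the two halves of the theorem.\<close>

locale fab_family = cheapest_feasible_system M best
  for M :: "('s, 'a) gang_model" and best :: "nat \<Rightarrow> 's \<Rightarrow> 'a" +
  fixes y0 :: "nat \<Rightarrow> 's \<Rightarrow> real"
    and \<sigma>0 :: "nat \<Rightarrow> 's vec"
    and x :: "nat \<Rightarrow> ('s, 'a) triple \<Rightarrow> real"
    and \<psi> :: "nat \<Rightarrow> ('s, 'a) policy"
  assumes initial: "h \<ge> 1 \<Longrightarrow> \<sigma>0 h \<in> state_vectors M h \<and>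
          (\<forall>i\<in>{1..num_gangs M}. \<forall>s\<in>states M i. Y_prop M h (\<sigma>0 h) i s = y0 i s)"
    and optimal: "lp_optimal M y0 x"
    and fab: "h \<ge> 1 \<Longrightarrow> fab_policy M x h (\<psi> h)"
begin

lemma feasible: "lp_feasible M y0 x"
  using optimal by (simp add: lp_optimal_def)

lemma fab_in_policies: "h \<ge> 1 \<Longrightarrow> \<psi> h \<in> policies M h"
  using fab by (simp add: fab_policy_def)

lemma fab_admissible: "h \<ge> 1 \<Longrightarrow> admissible h (deterministic (\<psi> h))"
  using fab_in_policies by (rule admissible_deterministic)

lemma fab_in_wc_policies:
  assumes h: "h \<ge> 1"
  shows "\<psi> h \<in> wc_policies M h (\<sigma>0 h)"
  unfolding wc_policies_iff_law[OF fab_in_policies[OF h]]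
proof (intro ballI)
  fix t p l
  assume t: "t \<in> {0..horizon M}" and p: "p \<in> set_pmf (law h (deterministic (\<psi> h)) (\<sigma>0 h) t)"
    and l: "l \<in> {1..num_constraints M}"
  obtain \<sigma> where \<sigma>: "\<sigma> \<in> set_pmf (state_law h (deterministic (\<psi> h)) (\<sigma>0 h) t)" and [simp]: "p = (\<sigma>, \<psi> h t \<sigma>)"
    using p unfolding law_deterministic by auto
  have \<sigma>\<alpha>: "\<sigma> \<in> state_vectors M h" "\<psi> h t \<sigma> \<in> action_vectors M h"
    using set_law[OF fab_admissible[OF h]] initial[OF h] t p by auto
  obtain Z where Z: "fab_result M x h t \<sigma> Z" "\<forall>j\<in>triples M. Z_prop M h (\<sigma>, \<psi> h t \<sigma>) j = Z j"
    using fab[OF h] t \<sigma>\<alpha>(1) unfolding fab_policy_def by blast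
  have "load M l (Z_prop M h (\<sigma>, \<psi> h t \<sigma>)) = load M l Z"
    using Z(2) by (intro load_cong) blast
  also have "\<dots> \<le> 0"
    using fab_result_properties[OF feasible] h t \<sigma>\<alpha>(1) Z(1) l by metis
  finally have "load M l (Z_prop M h (\<sigma>, \<psi> h t \<sigma>)) \<le> 0" .
  then show "(\<Sum>i\<in>{1..num_gangs M}. \<Sum>n\<in>{1..h * base_size M i}. cost M i l (fst p (i, n)) (snd p (i, n))) \<le> 0"
    unfolding load_eq_sum_costs[OF \<sigma>\<alpha>] using total_size_pos[OF h] by (simp add: divide_le_0_iff)
qed

text \<open>By \<open>fab_result_properties\<close>, \<open>\<eta> = \<delta> / (2 * C)\<close>
  leaves half of \<open>\<delta>\<close> for the rounding error \<open>C / N\<close>, which is small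
  for large \<open>h\<close>.\<close>

lemma deviating_Z_le_deviating_Y:
  assumes \<delta>: "\<delta> > 0"
  shows "\<exists>\<eta>>0. \<forall>t\<in>{0..horizon M}. \<forall>\<^sub>F h in sequentially.
    measure_pmf.prob (law h (deterministic (\<psi> h)) (\<sigma>0 h) t) (deviating_Z x h t \<delta>)
    \<le> measure_pmf.prob (state_law h (deterministic (\<psi> h)) (\<sigma>0 h) t) (deviating_Y x h t \<eta>)"
proof -
  obtain C where C: "C > 0" and near: "\<And>h t \<sigma> Z \<eta> j. h \<ge> 1 \<Longrightarrow> t \<in> {0..horizon M} \<Longrightarrow> \<sigma> \<in> state_vectors M h \<Longrightarrow>
      fab_result M x h t \<sigma> Z \<Longrightarrow> \<eta> \<ge> 0 \<Longrightarrow>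
      (\<forall>i\<in>{1..num_gangs M}. \<forall>s\<in>states M i. \<bar>Y_prop M h \<sigma> i s - fluid_Y x t i s\<bar> \<le> \<eta>) \<Longrightarrow>
      j \<in> triples M \<Longrightarrow> \<bar>Z j - fluid x t j\<bar> \<le> C * (\<eta> + 1 / total_size M h)"
    using fab_result_properties[OF feasible] by metis
  define \<eta> where "\<eta> = \<delta> / (2 * C)"
  have \<eta>: "\<eta> > 0" using C \<delta> by (simp add: \<eta>_def)
  have "\<forall>\<^sub>F h in sequentially.
    measure_pmf.prob (law h (deterministic (\<psi> h)) (\<sigma>0 h) t) (deviating_Z x h t \<delta>)
    \<le> measure_pmf.prob (state_law h (deterministic (\<psi> h)) (\<sigma>0 h) t) (deviating_Y x h t \<eta>)"
    if t: "t \<in> {0..horizon M}" for t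
    using eventually_ge_at_top[of 1] eventually_ge_at_top[of "nat \<lceil>2 * C / \<delta>\<rceil>"]
  proof eventually_elim
    case (elim h)
    note h = elim(1)
    have "2 * C / \<delta> \<le> real h" using elim(2) by linarith
    also have "real h * 1 \<le> total_size M h"
      unfolding total_size_def of_nat_mult using total_base_size_pos by (intro mult_left_mono) auto
    then have "real h \<le> total_size M h" by simp
    finally have "2 * C \<le> \<delta> * total_size M h"
      using \<delta> by (simp add: pos_divide_le_eq mult.commute)
    then have "C * (1 / total_size M h) \<le> \<delta> / 2"
      using total_size_pos[OF h] by (simp add: pos_divide_le_eq mult.commute)
    moreover have "C * \<eta> = \<delta> / 2"
      using C by (simp add: \<eta>_def)
    ultimately have small: "C * (\<eta> + 1 / total_size M h) \<le> \<delta>"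
      unfolding distrib_left by linarith
    let ?P = "state_law h (deterministic (\<psi> h)) (\<sigma>0 h) t"
    have "measure_pmf.prob (law h (deterministic (\<psi> h)) (\<sigma>0 h) t) (deviating_Z x h t \<delta>)
      = measure_pmf.prob ?P {\<sigma>. (\<sigma>, \<psi> h t \<sigma>) \<in> deviating_Z x h t \<delta>}"
      unfolding law_deterministic by (simp add: vimage_def)
    also have "\<dots> \<le> measure_pmf.prob ?P (deviating_Y x h t \<eta>)"
    proof (rule measure_pmf.finite_measure_mono_AE, rule AE_pmfI, rule impI)
      fix \<sigma> assume "\<sigma> \<in> set_pmf ?P" and dev: "\<sigma> \<in> {\<sigma>. (\<sigma>, \<psi> h t \<sigma>) \<in> deviating_Z x h t \<delta>}"
      then have \<sigma>: "\<sigma> \<in> state_vectors M h"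
        using set_state_law[OF fab_admissible[OF h]] initial[OF h] t by auto
      obtain Z where Z: "fab_result M x h t \<sigma> Z" "\<forall>j\<in>triples M. Z_prop M h (\<sigma>, \<psi> h t \<sigma>) j = Z j"
        using fab[OF h] t \<sigma> unfolding fab_policy_def by blast
      show "\<sigma> \<in> deviating_Y x h t \<eta>"
      proof (rule ccontr)
        assume "\<sigma> \<notin> deviating_Y x h t \<eta>"
        then have "\<forall>i\<in>{1..num_gangs M}. \<forall>s\<in>states M i. \<bar>Y_prop M h \<sigma> i s - fluid_Y x t i s\<bar> \<le> \<eta>"
          unfolding deviating_Y_def by (auto simp: not_less)
        then have "\<bar>Z j - fluid x t j\<bar> \<le> \<delta>" if "j \<in> triples M" for j
          using near[OF h t \<sigma> Z(1) less_imp_le[OF \<eta>] _ that] small by linarith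
        then show False
          using dev Z(2) unfolding deviating_Z_def by force
      qed
    qed simp
    finally show ?case .
  qed
  with \<eta> show ?thesis by blast
qed

text \<open>Induction over time. Each step passes from \<open>Y\<close> to \<open>Z\<close> at the
  same time by \<open>deviating_Z_le_deviating_Y\<close> and on to \<open>Y\<close> at the next time
  by \<open>deviating_Y_step\<close>. Initially there is no deviation.\<close>

lemma deviating_Y_exp_small:
  "t \<le> horizon M \<Longrightarrow> \<delta> > 0 \<Longrightarrow>
    exp_small (\<lambda>h. measure_pmf.prob (state_law h (deterministic (\<psi> h)) (\<sigma>0 h) t) (deviating_Y x h t \<delta>))"
proof (induction t arbitrary: \<delta>)
  case 0
  have "\<forall>\<^sub>F h in sequentially.
      measure_pmf.prob (state_law h (deterministic (\<psi> h)) (\<sigma>0 h) 0) (deviating_Y x h 0 \<delta>) \<le> 0 * exp (- 1 * real h)"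
    using eventually_ge_at_top[of 1]
  proof eventually_elim
    case (elim h)
    have "\<sigma>0 h \<notin> deviating_Y x h 0 \<delta>"
      using initial[OF elim] 0 fluid_Y_initial[OF feasible] by (auto simp: deviating_Y_def)
    then show ?case by (simp add: measure_return_pmf indicator_def)
  qed
  then show ?case by (rule exp_smallI[OF zero_less_one])
next
  case (Suc t)
  define \<eta> where "\<eta> = \<delta> / (2 * real (card (triples M)))"
  have J: "card (triples M) > 0"
    using finite_triples triples_nonempty by (simp add: card_gt_0_iff)
  have \<eta>: "\<eta> > 0" using Suc.prems J by (simp add: \<eta>_def)
  let ?K = "real (card (SIGMA i:{1..num_gangs M}. states M i))"
  let ?dZ = "\<lambda>h. measure_pmf.prob (law h (deterministic (\<psi> h)) (\<sigma>0 h) t) (deviating_Z x h t \<eta>)"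
  obtain \<eta>' where \<eta>': "\<eta>' > 0" and le: "\<forall>t\<in>{0..horizon M}. \<forall>\<^sub>F h in sequentially.
      measure_pmf.prob (law h (deterministic (\<psi> h)) (\<sigma>0 h) t) (deviating_Z x h t \<eta>)
      \<le> measure_pmf.prob (state_law h (deterministic (\<psi> h)) (\<sigma>0 h) t) (deviating_Y x h t \<eta>')"
    using deviating_Z_le_deviating_Y[OF \<eta>] by blast
  have "exp_small ?dZ"
    by (rule exp_small_mono[OF Suc.IH[OF _ \<eta>'] bspec[OF le]]) (use Suc.prems(1) in simp_all)
  moreover have "exp_small (\<lambda>h. ?K * (2 * exp (- 2 * (\<delta> / 2)\<^sup>2 * real h)))"
  proof (rule exp_smallI)
    show "2 * (\<delta> / 2)\<^sup>2 > 0" using Suc.prems(2) by simp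
    show "\<forall>\<^sub>F h in sequentially. ?K * (2 * exp (- 2 * (\<delta> / 2)\<^sup>2 * real h))
        \<le> (?K * 2) * exp (- (2 * (\<delta> / 2)\<^sup>2) * real h)"
      by (intro always_eventually allI) (simp only: mult.assoc mult_minus_left order_refl)
  qed
  ultimately have "exp_small (\<lambda>h. ?dZ h + ?K * (2 * exp (- 2 * (\<delta> / 2)\<^sup>2 * real h)))"
    by (rule exp_small_add)
  then show ?case
  proof (rule exp_small_mono)
    show "\<forall>\<^sub>F h in sequentially.
      measure_pmf.prob (state_law h (deterministic (\<psi> h)) (\<sigma>0 h) (Suc t)) (deviating_Y x h (Suc t) \<delta>)
      \<le> ?dZ h + ?K * (2 * exp (- 2 * (\<delta> / 2)\<^sup>2 * real h))"
      using eventually_ge_at_top[of 1]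
    proof eventually_elim
      case (elim h)
      have "t < horizon M" using Suc.prems by simp
      then show ?case
        unfolding \<eta>_def
        by (rule deviating_Y_step[OF feasible elim fab_admissible[OF elim] conjunct1[OF initial[OF elim]]
              _ Suc.prems(2)])
    qed
  qed
qed

lemma deviating_Z_exp_small:
  assumes "t \<le> horizon M" "\<delta> > 0"
  shows "exp_small (\<lambda>h. measure_pmf.prob (law h (deterministic (\<psi> h)) (\<sigma>0 h) t) (deviating_Z x h t \<delta>))"
proof -
  obtain \<eta> where \<eta>: "\<eta> > 0" and le: "\<forall>t\<in>{0..horizon M}. \<forall>\<^sub>F h in sequentially.
      measure_pmf.prob (law h (deterministic (\<psi> h)) (\<sigma>0 h) t) (deviating_Z x h t \<delta>)
      \<le> measure_pmf.prob (state_law h (deterministic (\<psi> h)) (\<sigma>0 h) t) (deviating_Y x h t \<eta>)"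
    using deviating_Z_le_deviating_Y[OF assms(2)] by blast
  show ?thesis
    by (rule exp_small_mono[OF deviating_Y_exp_small[OF assms(1) \<eta>] bspec[OF le]])
      (use assms(1) in simp)
qed

lemma fluid_bounds:
  assumes "j \<in> triples M" "t \<in> {0..horizon M}"
  shows "0 \<le> fluid x t j" "fluid x t j \<le> 1"
proof -
  obtain i s a where [simp]: "j = (i, s, a)" by (cases j)
  have x: "0 \<le> x t j" "x t j \<le> 1"
    using feasible assms by (auto simp: lp_feasible_def)
  have i: "i \<in> {1..num_gangs M}" using assms by (simp add: triples_iff)
  show "0 \<le> fluid x t j" using x by (simp add: fluid_def)
  have "real (base_size M i) / real (total_base_size M) \<le> 1"
    using base_size_le_total[OF i] total_base_size_pos by simp
  then have "real (base_size M i) / real (total_base_size M) * x t j \<le> 1 * 1"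
    using x by (intro mult_mono) auto
  then show "fluid x t j \<le> 1" by (simp add: fluid_def)
qed

text \<open>Deviations are at most 1, because both proportions lie between 0 and 1, and on the
  complement of \<open>deviating_Z\<close> they are at most \<open>\<epsilon>\<close>.\<close>

lemma mean_deviation_le:
  assumes h: "h \<ge> 1" and t: "t \<in> {0..horizon M}" and j: "j \<in> triples M" and \<epsilon>: "\<epsilon> \<ge> 0"
  shows "\<bar>mean_Z M h (deterministic (\<psi> h)) (\<sigma>0 h) t j - fluid x t j\<bar>
    \<le> \<epsilon> + measure_pmf.prob (law h (deterministic (\<psi> h)) (\<sigma>0 h) t) (deviating_Z x h t \<epsilon>)"
proof -
  let ?P = "law h (deterministic (\<psi> h)) (\<sigma>0 h) t"
  have t': "t \<le> horizon M" using t by simp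
  have fin: "finite (set_pmf ?P)"
    using initial[OF h] by (intro finite_set_law fab_admissible h t') auto
  have int: "integrable ?P g" for g :: "_ \<Rightarrow> real"
    using fin by (rule integrable_measure_pmf_finite)
  have "mean_Z M h (deterministic (\<psi> h)) (\<sigma>0 h) t j - fluid x t j
    = measure_pmf.expectation ?P (\<lambda>p. Z_prop M h p j - fluid x t j)"
    unfolding mean_Z_eq_law[OF t'] by (subst Bochner_Integration.integral_diff[OF int int]) simp
  then have "\<bar>mean_Z M h (deterministic (\<psi> h)) (\<sigma>0 h) t j - fluid x t j\<bar>
    \<le> measure_pmf.expectation ?P (\<lambda>p. \<bar>Z_prop M h p j - fluid x t j\<bar>)"
    by (simp add: integral_abs_bound)
  also have "\<dots> \<le> measure_pmf.expectation ?P (\<lambda>p. \<epsilon> + indicator (deviating_Z x h t \<epsilon>) p)"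
  proof (rule integral_mono[OF int int])
    fix p
    have "Z_prop M h p j \<le> real (base_size M (fst j)) / real (total_base_size M)"
      by (rule Z_prop_bounds[OF h j])
    also have "\<dots> \<le> 1"
      using base_size_le_total[of "fst j"] total_base_size_pos j by (cases j) (simp add: triples_iff)
    finally have "\<bar>Z_prop M h p j - fluid x t j\<bar> \<le> 1"
      using Z_prop_bounds(1)[OF h j, of p] fluid_bounds[OF j t] by linarith
    then show "\<bar>Z_prop M h p j - fluid x t j\<bar> \<le> \<epsilon> + indicator (deviating_Z x h t \<epsilon>) p"
      using \<epsilon> j by (auto simp: deviating_Z_def indicator_def not_less)
  qed
  also have "\<dots> = \<epsilon> + measure_pmf.prob ?P (deviating_Z x h t \<epsilon>)"
    by (subst Bochner_Integration.integral_add[OF int int]) simp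
  finally show ?thesis .
qed

lemma mean_converges:
  assumes t: "t \<in> {0..horizon M}" and j: "j \<in> triples M"
  shows "(\<lambda>h. mean_Z M h (deterministic (\<psi> h)) (\<sigma>0 h) t j) \<longlonglongrightarrow> fluid x t j"
proof (rule tendstoI)
  fix e :: real assume e: "e > 0"
  obtain C where C: "C > 0" and le: "\<forall>\<^sub>F h in sequentially.
      measure_pmf.prob (law h (deterministic (\<psi> h)) (\<sigma>0 h) t) (deviating_Z x h t (e / 2)) \<le> exp (- C * real h)"
    using exp_small_eventually_le_exp[OF deviating_Z_exp_small[of t "e / 2"]] t e by auto
  have "(\<lambda>h. exp (- C * real h)) \<longlonglongrightarrow> 0" using C by real_asymp
  then have "\<forall>\<^sub>F h in sequentially. exp (- C * real h) < e / 2"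
    by (rule order_tendstoD) (use e in simp)
  with le eventually_ge_at_top[of 1]
  show "\<forall>\<^sub>F h in sequentially. dist (mean_Z M h (deterministic (\<psi> h)) (\<sigma>0 h) t j) (fluid x t j) < e"
  proof eventually_elim
    case (elim h)
    then show ?case
      using mean_deviation_le[OF elim(2) t j, of "e / 2"] e unfolding dist_real_def by linarith
  qed
qed

lemma lp_objective_eq:
  "lp_objective M x = real (total_base_size M) *
     (\<Sum>t\<in>{0..horizon M}. \<Sum>(i, s, a)\<in>triples M. fluid x t (i, s, a) * reward M i s a)"
  unfolding lp_objective_def sum_distrib_left
  using total_base_size_pos by (intro sum.cong) (auto simp: fluid_def)

lemma gain_converges: "(\<lambda>h. total_gain M h (\<psi> h) (\<sigma>0 h)) \<longlonglongrightarrow> lp_objective M x"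
  unfolding lp_objective_eq total_gain_def split_beta
  by (intro tendsto_mult tendsto_const tendsto_sum) (auto intro: mean_converges)

text \<open>The gap lies between 0 and the difference of the optimal value of the linear program and
  the gain of the FAB policy.\<close>

theorem fab_asymptotically_optimal: "asymptotically_optimal M \<sigma>0 \<psi>"
  unfolding asymptotically_optimal_def
proof (intro conjI allI impI)
  show "\<psi> h \<in> wc_policies M h (\<sigma>0 h)" if "h \<ge> 1" for h
    by (rule fab_in_wc_policies[OF that])
  let ?best = "\<lambda>h. MAX \<phi>'\<in>wc_policies M h (\<sigma>0 h). total_gain M h \<phi>' (\<sigma>0 h)"
  let ?gain = "\<lambda>h. total_gain M h (\<psi> h) (\<sigma>0 h)"
  have fin: "finite (wc_policies M h (\<sigma>0 h))" for h
  proof (rule finite_subset)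
    show "wc_policies M h (\<sigma>0 h) \<subseteq> policies M h" by (auto simp: wc_policies_def)
    show "finite (policies M h)"
      unfolding policies_def by (intro finite_PiE finite_state_vectors finite_action_vectors) auto
  qed
  have lower: "\<forall>\<^sub>F h in sequentially. 0 \<le> ?best h - ?gain h"
    using eventually_ge_at_top[of 1]
  proof eventually_elim
    case (elim h)
    then show ?case using fab_in_wc_policies[OF elim] fin by simp
  qed
  have upper: "\<forall>\<^sub>F h in sequentially. ?best h - ?gain h \<le> lp_objective M x - ?gain h"
    using eventually_ge_at_top[of 1]
  proof eventually_elim
    case (elim h)
    have "?best h \<le> lp_objective M x"
    proof (rule Max.boundedI)
      show "finite ((\<lambda>\<phi>'. total_gain M h \<phi>' (\<sigma>0 h)) ` wc_policies M h (\<sigma>0 h))"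
        using fin by simp
      show "(\<lambda>\<phi>'. total_gain M h \<phi>' (\<sigma>0 h)) ` wc_policies M h (\<sigma>0 h) \<noteq> {}"
        using fab_in_wc_policies[OF elim] by blast
      fix g assume "g \<in> (\<lambda>\<phi>'. total_gain M h \<phi>' (\<sigma>0 h)) ` wc_policies M h (\<sigma>0 h)"
      then show "g \<le> lp_objective M x"
        using gain_le_lp_optimum[OF elim _ _ _ optimal] initial[OF elim] by blast
    qed
    then show ?case by simp
  qed
  have "(\<lambda>h. lp_objective M x - ?gain h) \<longlonglongrightarrow> 0"
    using tendsto_diff[OF tendsto_const[of "lp_objective M x"] gain_converges] by simp
  then show "(\<lambda>h. ?best h - ?gain h) \<longlonglongrightarrow> 0"
    by (rule tendsto_sandwich[OF lower upper tendsto_const])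
qed

text \<open>Both bounds come from the sum over time of the probabilities of a deviation beyond
  \<open>\<epsilon>\<close>, so one rate serves for both.\<close>

theorem fab_concentrates:
  assumes \<epsilon>: "\<epsilon> > 0"
  shows "\<exists>C C1 C2 H :: real. C > 0 \<and> C2 > 0 \<and>
       (\<forall>h::nat. h \<ge> 1 \<and> real h > H \<longrightarrow>
          measure_pmf.prob (path_law M h (deterministic (\<psi> h)) (\<sigma>0 h) (horizon M))
            {\<omega>. (MAX t\<in>{0..horizon M}. triple_norm M (\<lambda>j.
                   Z_prop M h (\<omega> ! t) j - mean_Z M h (lp_policy M x h) (\<sigma>0 h) t j)) > \<epsilon>}
            \<le> exp (- C * real h) \<and>
          (MAX t\<in>{0..horizon M}. triple_norm M (\<lambda>j.
              mean_Z M h (deterministic (\<psi> h)) (\<sigma>0 h) t j - mean_Z M h (lp_policy M x h) (\<sigma>0 h) t j))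
            \<le> C1 * exp (- C2 * real h) + \<epsilon>)"
proof -
  let ?P = "\<lambda>h. path_law M h (deterministic (\<psi> h)) (\<sigma>0 h) (horizon M)"
  let ?d = "\<lambda>t h. measure_pmf.prob (law h (deterministic (\<psi> h)) (\<sigma>0 h) t) (deviating_Z x h t \<epsilon>)"
  let ?z = "\<lambda>h. mean_Z M h (lp_policy M x h) (\<sigma>0 h)"
  let ?E = "\<lambda>h. {\<omega>. (MAX t\<in>{0..horizon M}. triple_norm M (\<lambda>j. Z_prop M h (\<omega> ! t) j - ?z h t j)) > \<epsilon>}"
  have "exp_small (\<lambda>h. \<Sum>t\<in>{0..horizon M}. ?d t h)"
    using \<epsilon> by (intro exp_small_sum deviating_Z_exp_small) auto
  then obtain C where C: "C > 0"
    and "\<forall>\<^sub>F h in sequentially. (\<Sum>t\<in>{0..horizon M}. ?d t h) \<le> exp (- C * real h)"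
    by (rule exp_small_eventually_le_exp)
  then obtain H where H: "\<And>h. h \<ge> H \<Longrightarrow> (\<Sum>t\<in>{0..horizon M}. ?d t h) \<le> exp (- C * real h)"
    unfolding eventually_sequentially by blast
  have "measure_pmf.prob (?P h) (?E h) \<le> exp (- C * real h) \<and>
     (MAX t\<in>{0..horizon M}. triple_norm M (\<lambda>j. mean_Z M h (deterministic (\<psi> h)) (\<sigma>0 h) t j - ?z h t j))
            \<le> 1 * exp (- C * real h) + \<epsilon>" if h: "h \<ge> 1 \<and> real h > real H" for h
  proof
    have h1: "h \<ge> 1" and hH: "h \<ge> H" using h by auto
    have z: "?z h t j = fluid x t j" if "t \<in> {0..horizon M}" "j \<in> triples M" for t j
      using mean_lp_policy[OF feasible, of "\<sigma>0 h" h t] initial[OF h1] that by (cases j) auto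
    have "?E h \<subseteq> (\<Union>t\<in>{0..horizon M}. {\<omega>. \<omega> ! t \<in> deviating_Z x h t \<epsilon>})"
    proof
      fix \<omega> assume "\<omega> \<in> ?E h"
      then have "\<not> (MAX t\<in>{0..horizon M}. triple_norm M (\<lambda>j. Z_prop M h (\<omega> ! t) j - ?z h t j)) \<le> \<epsilon>"
        by (simp only: mem_Collect_eq not_le)
      then show "\<omega> \<in> (\<Union>t\<in>{0..horizon M}. {\<omega>. \<omega> ! t \<in> deviating_Z x h t \<epsilon>})"
        unfolding max_triple_norm_le_iff by (auto simp: z deviating_Z_def not_le)
    qed
    then have "measure_pmf.prob (?P h) (?E h)
      \<le> measure_pmf.prob (?P h) (\<Union>t\<in>{0..horizon M}. {\<omega>. \<omega> ! t \<in> deviating_Z x h t \<epsilon>})"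
      by (intro measure_pmf.finite_measure_mono) auto
    also have "\<dots> \<le> (\<Sum>t\<in>{0..horizon M}. measure_pmf.prob (?P h) {\<omega>. \<omega> ! t \<in> deviating_Z x h t \<epsilon>})"
      by (intro measure_pmf.finite_measure_subadditive_finite) auto
    also have "\<dots> = (\<Sum>t\<in>{0..horizon M}. ?d t h)"
      by (intro sum.cong refl) (simp add: vimage_def flip: map_nth_path_law[of _ "horizon M"])
    also have "\<dots> \<le> exp (- C * real h)" by (rule H[OF hH])
    finally show "measure_pmf.prob (?P h) (?E h) \<le> exp (- C * real h)" .
    show "(MAX t\<in>{0..horizon M}. triple_norm M (\<lambda>j. mean_Z M h (deterministic (\<psi> h)) (\<sigma>0 h) t j - ?z h t j))
            \<le> 1 * exp (- C * real h) + \<epsilon>"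
      unfolding max_triple_norm_le_iff
    proof (intro ballI)
      fix t j assume t: "t \<in> {0..horizon M}" and j: "j \<in> triples M"
      have "?d t h \<le> (\<Sum>t\<in>{0..horizon M}. ?d t h)"
        using t by (intro member_le_sum) auto
      also have "\<dots> \<le> exp (- C * real h)" by (rule H[OF hH])
      finally show "\<bar>mean_Z M h (deterministic (\<psi> h)) (\<sigma>0 h) t j - ?z h t j\<bar> \<le> 1 * exp (- C * real h) + \<epsilon>"
        using mean_deviation_le[OF h1 t j, of \<epsilon>] \<epsilon> by (simp add: z[OF t j])
    qed
  qed
  with C show ?thesis by blast
qed

end

section \<open>The optimality and concentration theorem\<close>

theorem proposition3:
  fixes M :: "('s, 'a) gang_model"
    and y0 :: "nat \<Rightarrow> 's \<Rightarrow> real"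
    and \<sigma>0 :: "nat \<Rightarrow> 's vec"
    and best :: "nat \<Rightarrow> 's \<Rightarrow> 'a"
    and x :: "nat \<Rightarrow> ('s, 'a) triple \<Rightarrow> real"
    and \<psi> :: "nat \<Rightarrow> ('s, 'a) policy"
  assumes model: "valid_model M"
    and initial: "\<And>h. h \<ge> 1 \<Longrightarrow> \<sigma>0 h \<in> state_vectors M h \<and>
          (\<forall>i\<in>{1..num_gangs M}. \<forall>s\<in>states M i. Y_prop M h (\<sigma>0 h) i s = y0 i s)"
    and best_action: "\<And>i s. i \<in> {1..num_gangs M} \<Longrightarrow> s \<in> states M i \<Longrightarrow>
          best i s \<in> actions M i \<and>
          (\<forall>l\<in>{1..num_constraints M}. cost M i l s (best i s) = (MIN a\<in>actions M i. cost M i l s a))"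
    and best_feasible: "\<And>h \<sigma> l. h \<ge> 1 \<Longrightarrow> \<sigma> \<in> state_vectors M h \<Longrightarrow> l \<in> {1..num_constraints M} \<Longrightarrow>
          (\<Sum>i\<in>{1..num_gangs M}. \<Sum>n\<in>{1..h * base_size M i}.
             cost M i l (\<sigma> (i, n)) (best i (\<sigma> (i, n)))) \<le> 0"
    and optimal: "lp_optimal M y0 x"
    and fab: "\<And>h. h \<ge> 1 \<Longrightarrow> fab_policy M x h (\<psi> h)"
  shows "asymptotically_optimal M \<sigma>0 \<psi> \<and>
    (\<forall>\<epsilon>>0. \<exists>C C1 C2 H :: real. C > 0 \<and> C2 > 0 \<and>
       (\<forall>h::nat. h \<ge> 1 \<and> real h > H \<longrightarrow>
          measure_pmf.prob (path_law M h (deterministic (\<psi> h)) (\<sigma>0 h) (horizon M))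
            {\<omega>. (MAX t\<in>{0..horizon M}. triple_norm M (\<lambda>j.
                   Z_prop M h (\<omega> ! t) j - mean_Z M h (lp_policy M x h) (\<sigma>0 h) t j)) > \<epsilon>}
            \<le> exp (- C * real h) \<and>
          (MAX t\<in>{0..horizon M}. triple_norm M (\<lambda>j.
              mean_Z M h (deterministic (\<psi> h)) (\<sigma>0 h) t j - mean_Z M h (lp_policy M x h) (\<sigma>0 h) t j))
            \<le> C1 * exp (- C2 * real h) + \<epsilon>))"
proof -
  interpret fab_family M best y0 \<sigma>0 x \<psi>
    by unfold_locales (rule model best_action best_feasible initial optimal fab; assumption)+
  show ?thesis
    using fab_asymptotically_optimal fab_concentrates by blast
qed

end
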